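(* Let $R=\mathbb{C}\{x,y\}$ and let $f\in R$ define an isolated plane curve singularity $X:f=0$ at the origin $0\in\mathbb{C}^2$ which is not quasi-homogeneous. Let $f_x=\partial_x f$, $f_y=\partial_y f$, let $J_f=(f_x,f_y)$ be the Jacobian ideal, $I_f=(f_x,f_y,f)$ the Tjurina ideal, $M(f)=R/J_f$, $\tau(f)=\dim_{\mathbb{C}}R/I_f$, and $$\operatorname{Syz}(f)=\{(a,b,c)\in R^3 : af_x+bf_y+cf=0\}.$$ Then the following hold. 1. The $R$-module $\operatorname{Syz}(f)$ is free of rank $2$. 2. If $\rho_1,\rho_2$ is a basis of the $R$-module $\operatorname{Syz}(f)$, then $$0\to R^2\xrightarrow{\;u\;}R^3\xrightarrow{\;v\;}I_f\to 0$$ is a minimal free resolution of $I_f$, where $u(s,t)=s\rho_1+t\rho_2$ and $v(a,b,c)=af_x+bf_y+cf$. 3. Let $U$ denote the matrix of the morphism $u$ and let $I_k(U)$ be the ideal of $R$ generated by all the $k$-minors of $U$. Then $I_j(U)=\operatorname{Fitt}_{3-j}(I_f)$ for $j=1,2$, where $\operatorname{Fitt}_i(I_f)$ denotes the $i$-th Fitting ideal of the $R$-module $I_f$. 4. In addition, $I_f=I_2(U)=\operatorname{Fitt}_1(I_f)$, and in particular $$\tau(f)=\dim_{\mathbb{C}}\frac{R}{\operatorname{Fitt}_1(I_f)}.$$ 5. The ideal $$\operatorname{Ann}(f)=\{g\in R : gf=0\text{ in }M(f)\}\subset R$$ is minimally generated by exactly two elements, and hence it is a $0$-dimensional complete inte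rsection.
   Context: $R=\mathbb{C}\{x,y\}$ is the ring of convergent power series in two variables over $\mathbb{C}$, a local ring with maximal ideal $(x,y)$. That $X:f=0$ is an isolated singularity at the origin means $f(0)=0$ and $\dim_{\mathbb{C}}R/J_f<\infty$. The Milnor number is $\mu(f)=\dim_{\mathbb{C}}R/J_f$ and the Tjurina number is $\tau(f)=\dim_{\mathbb{C}}R/I_f$. By a theorem of K. Saito, $X$ is quasi-homogeneous if and only if $I_f=J_f$ (i.e. $f\in J_f$), equivalently $\mu(f)=\tau(f)$; so "not quasi-homogeneous" means $f\notin J_f$. Fitting ideals convention: if a finitely generated $R$-module $N$ has a finite free presentation $R^m\xrightarrow{\;\phi\;}R^n\to N\to 0$, then $\operatorname{Fitt}_i(N)$ is the ideal generated by the $(n-i)$-minors of a matrix of $\phi$; it does not depend on the presentation. *)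

theory Defs
  imports
    "HOL-Algebra.QuotRing"
    "HOL-Computational_Algebra.Formal_Power_Series"
    "HOL-Analysis.Infinite_Sum"
    "Jordan_Normal_Form.VS_Connect"
    "Jordan_Normal_Form.DL_Submatrix"
begin

hide_const (open) Multiset.mult

section \<open>Convergent power series in two variables\<close>

text \<open>
  A formal power series in \<open>x, y\<close> is an element of \<open>complex fps fps\<close>: the outer variable is \<open>x\<close>
  and the inner one \<open>y\<close>, so that the coefficient of \<open>x\<^sup>i y\<^sup>j\<close> in \<open>F\<close> is
  \<open>fps_nth (fps_nth F i) j\<close>.
\<close>

definition fps2_convergent :: "complex fps fps \<Rightarrow> bool" where
  "fps2_convergent F \<longleftrightarrow> (\<exists>r>0. \<forall>x y. norm x < r \<and> norm y < r \<longrightarrow>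
     (\<lambda>(i, j). fps_nth (fps_nth F i) j * x ^ i * y ^ j) summable_on UNIV)"

lemma fps2_convergent_bound:
  assumes "fps2_convergent F"
  shows "\<exists>C r. C \<ge> 0 \<and> 0 < r \<and>
    (\<forall>s i j. 0 \<le> s \<longrightarrow> s \<le> r \<longrightarrow> norm (fps_nth (fps_nth F i) j) * s ^ (i + j) \<le> C)"
proof -
  obtain R where R: "R > 0" "\<And>x y. norm x < R \<and> norm y < R \<Longrightarrow>
     (\<lambda>(i, j). fps_nth (fps_nth F i) j * x ^ i * y ^ j) summable_on UNIV"
    using assms by (auto simp: fps2_convergent_def)
  define r where "r = R / 2"
  define t where "t = (\<lambda>(i, j). fps_nth (fps_nth F i) j * complex_of_real r ^ i * complex_of_real r ^ j)"
  have r: "r > 0" using R(1) by (simp add: r_def)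
  have nr: "norm (complex_of_real r) < R" using R(1) by (simp add: r_def)
  have "t summable_on UNIV" unfolding t_def by (rule R(2)) (use nr in simp)
  hence "t abs_summable_on UNIV" by (simp add: summable_on_iff_abs_summable_on_complex)
  hence "bdd_above (sum (\<lambda>p. norm (t p)) ` {F. F \<subseteq> UNIV \<and> finite F})"
    by (simp only: abs_summable_iff_bdd_above)
  then obtain C where C: "\<And>F. finite F \<Longrightarrow> sum (\<lambda>p. norm (t p)) F \<le> C"
    by (auto simp: bdd_above_def)
  have "norm (fps_nth (fps_nth F i) j) * s ^ (i + j) \<le> C" if "0 \<le> s" "s \<le> r" for s i j
  proof -
    have "norm (fps_nth (fps_nth F i) j) * s ^ (i + j)
            \<le> norm (fps_nth (fps_nth F i) j) * r ^ (i + j)"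
      using that by (intro mult_left_mono power_mono) auto
    also have "\<dots> = norm (t (i, j))"
      using r by (simp add: t_def norm_mult norm_power power_add)
    also have "\<dots> \<le> C" using C[of "{(i, j)}"] by simp
    finally show ?thesis .
  qed
  moreover have "C \<ge> 0" using C[of "{}"] by simp
  ultimately show ?thesis using r by blast
qed

lemma fps2_convergentI:
  assumes r: "0 < r" and C: "\<And>i j. norm (fps_nth (fps_nth F i) j) * r ^ (i + j) \<le> C"
  shows "fps2_convergent F"
  unfolding fps2_convergent_def
proof (intro exI[of _ r] conjI allI impI r)
  fix x y :: complex
  assume xy: "norm x < r \<and> norm y < r"
  define s t where "s = norm x / r" and "t = norm y / r"
  have s: "0 \<le> s" "s < 1" and t: "0 \<le> t" "t < 1"
    using xy r by (auto simp: s_def t_def divide_simps)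
  have "(\<lambda>(i, j). s ^ i * t ^ j) summable_on (Sigma UNIV (\<lambda>_. UNIV))"
  proof (rule summable_on_SigmaI)
    show "((\<lambda>j. case (i, j) of (i, j) \<Rightarrow> s ^ i * t ^ j) has_sum s ^ i * (1 / (1 - t))) UNIV" for i
    proof -
      have "(\<lambda>j. s ^ i * t ^ j) sums (s ^ i * (1 / (1 - t)))"
        using t by (intro sums_mult geometric_sums) auto
      moreover have "summable (\<lambda>j. norm (s ^ i * t ^ j))"
        using s t by (simp add: norm_mult norm_power summable_geometric)
      ultimately show ?thesis by (simp add: norm_summable_imp_has_sum)
    qed
    show "(\<lambda>i. s ^ i * (1 / (1 - t))) summable_on UNIV"
      using s t by (intro norm_summable_imp_summable_on)
                   (simp add: norm_mult norm_power summable_geometric summable_divide)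
  qed (use s t in auto)
  hence "(\<lambda>p. C * (case p of (i, j) \<Rightarrow> s ^ i * t ^ j)) summable_on UNIV"
    by (simp add: summable_on_cmult_right)
  moreover have "norm (case p of (i, j) \<Rightarrow> fps_nth (fps_nth F i) j * x ^ i * y ^ j)
                   \<le> C * (case p of (i, j) \<Rightarrow> s ^ i * t ^ j)" for p
  proof (cases p)
    case (Pair i j)
    have "norm (fps_nth (fps_nth F i) j * x ^ i * y ^ j)
            = (norm (fps_nth (fps_nth F i) j) * r ^ (i + j)) * (s ^ i * t ^ j)"
      using r by (simp add: s_def t_def norm_mult norm_power power_add power_divide)
    also have "\<dots> \<le> C * (s ^ i * t ^ j)"
      using s t by (intro mult_right_mono C) auto
    finally show ?thesis by (simp add: Pair)
  qed
  ultimately show "(\<lambda>(i, j). fps_nth (fps_nth F i) j * x ^ i * y ^ j) summable_on UNIV"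
    by (rule abs_summable_summable[OF abs_summable_on_comparison_test'])
qed

lemma Suc_le_power2: "real (Suc n) \<le> 2 ^ n"
proof (induction n)
  case (Suc n)
  have "real (Suc (Suc n)) = real (Suc n) + 1" by simp
  also have "\<dots> \<le> 2 ^ n + 2 ^ n" by (intro add_mono Suc.IH) simp
  also have "\<dots> = 2 ^ Suc n" by (simp only: power_Suc mult_2)
  finally show ?case .
qed simp

lemma half_power_le:
  fixes a r c :: real
  assumes "a * r ^ k \<le> 2 ^ k * c"
  shows "a * (r / 2) ^ k \<le> c"
  using assms by (simp add: power_divide pos_divide_le_eq mult.commute)

lemma fps2_convergent_add:
  assumes "fps2_convergent F" "fps2_convergent G"
  shows "fps2_convergent (F + G)"
proof -
  obtain C r where F: "C \<ge> 0" "0 < r"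
    "\<And>s i j. 0 \<le> s \<Longrightarrow> s \<le> r \<Longrightarrow> norm (fps_nth (fps_nth F i) j) * s ^ (i + j) \<le> C"
    using fps2_convergent_bound[OF assms(1)] by auto
  obtain D q where G: "D \<ge> 0" "0 < q"
    "\<And>s i j. 0 \<le> s \<Longrightarrow> s \<le> q \<Longrightarrow> norm (fps_nth (fps_nth G i) j) * s ^ (i + j) \<le> D"
    using fps2_convergent_bound[OF assms(2)] by auto
  define s where "s = min r q"
  have s: "0 < s" "s \<le> r" "s \<le> q" using F(2) G(2) by (auto simp: s_def)
  show ?thesis
  proof (rule fps2_convergentI[OF s(1), of _ "C + D"])
    fix i j
    have "norm (fps_nth (fps_nth (F + G) i) j) * s ^ (i + j)
        \<le> (norm (fps_nth (fps_nth F i) j) + norm (fps_nth (fps_nth G i) j)) * s ^ (i + j)"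
      using s by (intro mult_right_mono) (auto intro: norm_triangle_ineq)
    also have "\<dots> \<le> C + D"
      using F(3)[of s i j] G(3)[of s i j] s by (simp add: distrib_right)
    finally show "norm (fps_nth (fps_nth (F + G) i) j) * s ^ (i + j) \<le> C + D" .
  qed
qed

lemma fps2_convergent_uminus:
  assumes "fps2_convergent F"
  shows "fps2_convergent (- F)"
proof -
  obtain C r where F: "C \<ge> 0" "0 < r"
    "\<And>s i j. 0 \<le> s \<Longrightarrow> s \<le> r \<Longrightarrow> norm (fps_nth (fps_nth F i) j) * s ^ (i + j) \<le> C"
    using fps2_convergent_bound[OF assms] by auto
  show ?thesis
    by (rule fps2_convergentI[OF F(2), of _ C]) (use F(2) F(3)[of r] in simp)
qed

lemma fps2_convergent_mult:
  assumes "fps2_convergent F" "fps2_convergent G"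
  shows "fps2_convergent (F * G)"
proof -
  obtain C r where F: "C \<ge> 0" "0 < r"
    "\<And>s i j. 0 \<le> s \<Longrightarrow> s \<le> r \<Longrightarrow> norm (fps_nth (fps_nth F i) j) * s ^ (i + j) \<le> C"
    using fps2_convergent_bound[OF assms(1)] by auto
  obtain D q where G: "D \<ge> 0" "0 < q"
    "\<And>s i j. 0 \<le> s \<Longrightarrow> s \<le> q \<Longrightarrow> norm (fps_nth (fps_nth G i) j) * s ^ (i + j) \<le> D"
    using fps2_convergent_bound[OF assms(2)] by auto
  define s where "s = min r q"
  have s: "0 < s" "s \<le> r" "s \<le> q" using F(2) G(2) by (auto simp: s_def)
  have s2: "s / 2 > 0" using s by simp
  show ?thesis
  proof (rule fps2_convergentI[OF s2, of _ "C * D"])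
    fix i j
    define a where "a = (\<lambda>k l. norm (fps_nth (fps_nth F k) l))"
    define b where "b = (\<lambda>k l. norm (fps_nth (fps_nth G k) l))"
    have "norm (fps_nth (fps_nth (F * G) i) j)
        = norm (\<Sum>k=0..i. \<Sum>l=0..j. fps_nth (fps_nth F k) l * fps_nth (fps_nth G (i - k)) (j - l))"
      by (simp add: fps_mult_nth fps_sum_nth)
    also have "\<dots> \<le> (\<Sum>k=0..i. \<Sum>l=0..j. a k l * b (i - k) (j - l))"
      unfolding a_def b_def
      by (intro order_trans[OF norm_sum] sum_mono) (simp add: norm_mult)
    finally have 1: "norm (fps_nth (fps_nth (F * G) i) j) * s ^ (i + j)
        \<le> (\<Sum>k=0..i. \<Sum>l=0..j. a k l * b (i - k) (j - l)) * s ^ (i + j)"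
      using s by (intro mult_right_mono) auto
    also have "\<dots> = (\<Sum>k=0..i. \<Sum>l=0..j.
        (a k l * s ^ (k + l)) * (b (i - k) (j - l) * s ^ ((i - k) + (j - l))))"
      unfolding sum_distrib_right
    proof (intro sum.cong refl)
      fix k l assume "k \<in> {0..i}" "l \<in> {0..j}"
      hence "i + j = (k + l) + ((i - k) + (j - l))" by auto
      hence "s ^ (i + j) = s ^ (k + l) * s ^ ((i - k) + (j - l))" by (metis power_add)
      thus "a k l * b (i - k) (j - l) * s ^ (i + j)
          = (a k l * s ^ (k + l)) * (b (i - k) (j - l) * s ^ ((i - k) + (j - l)))" by simp
    qed
    also have "\<dots> \<le> (\<Sum>k=0..i. \<Sum>l=0..j. C * D)"
    proof (intro sum_mono mult_mono)
      show "a k l * s ^ (k + l) \<le> C" for k l unfolding a_def using F(3) s by simp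
      show "b k l * s ^ (k + l) \<le> D" for k l unfolding b_def using G(3) s by simp
    qed (use F(1) s in \<open>auto simp: a_def b_def\<close>)
    also have "\<dots> = (real (Suc i) * real (Suc j)) * (C * D)" by simp
    also have "\<dots> \<le> (2 ^ i * 2 ^ j) * (C * D)"
      using F(1) G(1) by (intro mult_right_mono mult_mono Suc_le_power2) auto
    also have "\<dots> = 2 ^ (i + j) * (C * D)"
      by (simp only: power_add)
    finally show "norm (fps_nth (fps_nth (F * G) i) j) * (s / 2) ^ (i + j) \<le> C * D"
      by (rule half_power_le)
  qed
qed

lemma fps2_convergent_const: "fps2_convergent (fps_const (fps_const c))"
proof (rule fps2_convergentI[of 1 _ "norm c"])
  fix i j
  show "norm (fps_nth (fps_nth (fps_const (fps_const c)) i) j) * 1 ^ (i + j) \<le> norm c"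
    by (cases "i = 0"; cases "j = 0") auto
qed simp

lemma fps2_convergent_X: "fps2_convergent fps_X"
proof (rule fps2_convergentI[of 1 _ 1])
  fix i j
  show "norm (fps_nth (fps_nth (fps_X :: complex fps fps) i) j) * 1 ^ (i + j) \<le> 1"
    by (cases "i = 1"; cases "j = 0") (auto simp: fps_X_def)
qed simp

lemma fps2_convergent_Y: "fps2_convergent (fps_const fps_X)"
proof (rule fps2_convergentI[of 1 _ 1])
  fix i j
  show "norm (fps_nth (fps_nth (fps_const fps_X :: complex fps fps) i) j) * 1 ^ (i + j) \<le> 1"
    by (cases "i = 0"; cases "j = 1") (auto simp: fps_X_def)
qed simp

lemma fps2_convergent_deriv_x:
  assumes "fps2_convergent F"
  shows "fps2_convergent (fps_deriv F)"
proof -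
  obtain C r where F: "C \<ge> 0" "0 < r"
    "\<And>s i j. 0 \<le> s \<Longrightarrow> s \<le> r \<Longrightarrow> norm (fps_nth (fps_nth F i) j) * s ^ (i + j) \<le> C"
    using fps2_convergent_bound[OF assms] by auto
  have r2: "r / 2 > 0" using F by simp
  show ?thesis
  proof (rule fps2_convergentI[OF r2, of _ "C / r"])
    fix i j
    have c: "fps_nth (fps_nth (fps_deriv F) i) j = of_nat (Suc i) * fps_nth (fps_nth F (Suc i)) j"
      unfolding fps_deriv_nth fps_of_nat[of "i + 1", symmetric] fps_mult_left_const_nth by simp
    have "norm (fps_nth (fps_nth (fps_deriv F) i) j) * r ^ (i + j)
        = real (Suc i) * ((norm (fps_nth (fps_nth F (Suc i)) j) * r ^ (Suc i + j)) / r)"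
      unfolding c norm_mult norm_of_nat using F(2) by simp
    also have "\<dots> \<le> 2 ^ i * (C / r)"
      using F(1,2) F(3)[of r "Suc i" j]
      by (intro mult_mono Suc_le_power2 divide_right_mono) simp_all
    also have "\<dots> \<le> 2 ^ (i + j) * (C / r)"
      using F by (intro mult_right_mono power_increasing) auto
    finally show "norm (fps_nth (fps_nth (fps_deriv F) i) j) * (r / 2) ^ (i + j) \<le> C / r"
      by (rule half_power_le)
  qed
qed

lemma fps2_convergent_deriv_y:
  assumes "fps2_convergent F"
  shows "fps2_convergent (Abs_fps (\<lambda>i. fps_deriv (fps_nth F i)))"
proof -
  obtain C r where F: "C \<ge> 0" "0 < r"
    "\<And>s i j. 0 \<le> s \<Longrightarrow> s \<le> r \<Longrightarrow> norm (fps_nth (fps_nth F i) j) * s ^ (i + j) \<le> C"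
    using fps2_convergent_bound[OF assms] by auto
  have r2: "r / 2 > 0" using F by simp
  show ?thesis
  proof (rule fps2_convergentI[OF r2, of _ "C / r"])
    fix i j
    let ?c = "fps_nth (fps_nth (Abs_fps (\<lambda>i. fps_deriv (fps_nth F i))) i) j"
    have c: "?c = of_nat (Suc j) * fps_nth (fps_nth F i) (Suc j)"
      by (simp del: of_nat_Suc)
    have "norm ?c * r ^ (i + j)
        = real (Suc j) * ((norm (fps_nth (fps_nth F i) (Suc j)) * r ^ (i + Suc j)) / r)"
      unfolding c norm_mult norm_of_nat using F(2) by simp
    also have "\<dots> \<le> 2 ^ j * (C / r)"
      using F(1,2) F(3)[of r i "Suc j"]
      by (intro mult_mono Suc_le_power2 divide_right_mono) simp_all
    also have "\<dots> \<le> 2 ^ (i + j) * (C / r)"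
      using F by (intro mult_right_mono power_increasing) auto
    finally show "norm ?c * (r / 2) ^ (i + j) \<le> C / r"
      by (rule half_power_le)
  qed
qed

typedef conv_ps2 = "{F. fps2_convergent F}"
  morphisms fps2_of_conv Abs_conv_ps2
  using fps2_convergent_X by blast

setup_lifting type_definition_conv_ps2

instantiation conv_ps2 :: idom
begin

lift_definition zero_conv_ps2 :: conv_ps2 is 0
  using fps2_convergent_const[of 0] by simp

lift_definition one_conv_ps2 :: conv_ps2 is 1
  using fps2_convergent_const[of 1] by simp

lift_definition plus_conv_ps2 :: "conv_ps2 \<Rightarrow> conv_ps2 \<Rightarrow> conv_ps2" is "(+)"
  by (rule fps2_convergent_add)

lift_definition uminus_conv_ps2 :: "conv_ps2 \<Rightarrow> conv_ps2" is uminus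
  by (rule fps2_convergent_uminus)

lift_definition minus_conv_ps2 :: "conv_ps2 \<Rightarrow> conv_ps2 \<Rightarrow> conv_ps2" is "(-)"
  using fps2_convergent_add fps2_convergent_uminus by (metis diff_conv_add_uminus)

lift_definition times_conv_ps2 :: "conv_ps2 \<Rightarrow> conv_ps2 \<Rightarrow> conv_ps2" is "(*)"
  by (rule fps2_convergent_mult)

instance
proof
  fix a b c :: conv_ps2
  show "a * b * c = a * (b * c)" by transfer (rule mult.assoc)
  show "a * b = b * a" by transfer (rule mult.commute)
  show "1 * a = a" by transfer (rule mult_1_left)
  show "a + b + c = a + (b + c)" by transfer (rule add.assoc)
  show "a + b = b + a" by transfer (rule add.commute)
  show "0 + a = a" by transfer (rule add_0_left)
  show "- a + a = 0" by transfer (rule left_minus)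
  show "a - b = a + - b" by transfer (rule diff_conv_add_uminus)
  show "(a + b) * c = a * c + b * c" by transfer (rule distrib_right)
  show "a * (b + c) = a * b + a * c" by transfer (rule distrib_left)
  show "0 * a = 0" by transfer (rule mult_zero_left)
  show "a * 0 = 0" by transfer (rule mult_zero_right)
  show "(0 :: conv_ps2) \<noteq> 1" by transfer (rule zero_neq_one)
  show "a \<noteq> 0 \<Longrightarrow> b \<noteq> 0 \<Longrightarrow> a * b \<noteq> 0" by transfer (rule no_zero_divisors)
qed

end

lift_definition ps_coeff :: "conv_ps2 \<Rightarrow> nat \<Rightarrow> nat \<Rightarrow> complex"
  is "\<lambda>F i j. fps_nth (fps_nth F i) j" .

lift_definition ps_const :: "complex \<Rightarrow> conv_ps2" is "\<lambda>c. fps_const (fps_const c)"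
  by (rule fps2_convergent_const)

lift_definition ps_X :: conv_ps2 is fps_X
  by (rule fps2_convergent_X)

lift_definition ps_Y :: conv_ps2 is "fps_const fps_X"
  by (rule fps2_convergent_Y)

lift_definition deriv_x :: "conv_ps2 \<Rightarrow> conv_ps2" is fps_deriv
  by (rule fps2_convergent_deriv_x)

lift_definition deriv_y :: "conv_ps2 \<Rightarrow> conv_ps2" is "\<lambda>F. Abs_fps (\<lambda>i. fps_deriv (fps_nth F i))"
  by (rule fps2_convergent_deriv_y)

abbreviation ps_ring :: "conv_ps2 ring" where
  "ps_ring \<equiv> class_ring"


section \<open>Modules, minors and Fitting ideals over a commutative ring\<close>

text \<open>
  A commutative ring is a type of class \<open>comm_ring_1\<close>, viewed as the record \<^term>\<open>class_ring\<close> with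
  carrier \<^term>\<open>UNIV\<close>; modules over it are records in the sense of HOL-Algebra, and the free module
  of rank \<open>n\<close> is \<^term>\<open>module_vec TYPE('a::comm_ring_1) n\<close>.
\<close>

definition ideal_module :: "'a::comm_ring_1 set \<Rightarrow> ('a, 'a) module" where
  "ideal_module I = \<lparr>carrier = I, mult = (*), one = 1, zero = 0, add = (+), smult = (*)\<rparr>"

definition module_basis :: "('a::comm_ring_1, 'b) module \<Rightarrow> 'b set \<Rightarrow> bool" where
  "module_basis M B \<longleftrightarrow> B \<subseteq> carrier M \<and> \<not> module.lin_dep class_ring M B \<and>
     module.span class_ring M B = carrier M"

definition free_of_rank :: "('a::comm_ring_1, 'b) module \<Rightarrow> nat \<Rightarrow> bool" where
  "free_of_rank M n \<longleftrightarrow> Module.module class_ring M \<and>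
     (\<exists>B. finite B \<and> card B = n \<and> module_basis M B)"

definition morphism_matrix :: "nat \<Rightarrow> nat \<Rightarrow> ('a::comm_ring_1 vec \<Rightarrow> 'a vec) \<Rightarrow> 'a mat" where
  "morphism_matrix n m \<phi> = mat n m (\<lambda>(i, j). \<phi> (unit_vec m j) $ i)"

definition minors :: "nat \<Rightarrow> 'a::comm_ring_1 mat \<Rightarrow> 'a set" where
  "minors k A = {det (submatrix A I J) | I J.
     I \<subseteq> {..<dim_row A} \<and> J \<subseteq> {..<dim_col A} \<and> card I = k \<and> card J = k}"

definition minors_ideal :: "nat \<Rightarrow> 'a::comm_ring_1 mat \<Rightarrow> 'a set" where
  "minors_ideal k A = Idl\<^bsub>class_ring\<^esub> (minors k A)"

text \<open>
  The sequence \<open>R\<^sup>m \<rightarrow> R\<^sup>n \<rightarrow> N \<rightarrow> 0\<close>, with first map given by the matrix \<open>A\<close> and second map \<open>\<pi>\<close>,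
  is exact.
\<close>

definition finite_free_presentation ::
  "('a::comm_ring_1, 'b) module \<Rightarrow> nat \<Rightarrow> nat \<Rightarrow> 'a mat \<Rightarrow> ('a vec \<Rightarrow> 'b) \<Rightarrow> bool" where
  "finite_free_presentation N n m A \<pi> \<longleftrightarrow>
     A \<in> carrier_mat n m \<and>
     \<pi> \<in> LinearCombinations.module_hom class_ring (module_vec TYPE('a) n) N \<and>
     \<pi> ` carrier_vec n = carrier N \<and>
     {w \<in> carrier_vec n. \<pi> w = \<zero>\<^bsub>N\<^esub>} = (\<lambda>z. A *\<^sub>v z) ` carrier_vec m"

text \<open>
  The definite description is justified by the independence of the ideal from the presentation.
  For \<open>i \<ge> n\<close> the truncated difference \<open>n - i\<close> is \<open>0\<close>; the only \<open>0\<close>-minor is \<open>1\<close>, which gives the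
  unit ideal, as it should.
\<close>

definition fitting_ideal :: "nat \<Rightarrow> ('a::comm_ring_1, 'b) module \<Rightarrow> 'a set" where
  "fitting_ideal i N =
     (THE I. \<exists>n m A \<pi>. finite_free_presentation N n m A \<pi> \<and> I = minors_ideal (n - i) A)"

definition minimally_generated_by :: "'a::comm_ring_1 set \<Rightarrow> nat \<Rightarrow> bool" where
  "minimally_generated_by I n \<longleftrightarrow>
     (\<exists>S. finite S \<and> card S = n \<and> Idl\<^bsub>class_ring\<^esub> S = I) \<and>
     (\<forall>S. finite S \<and> Idl\<^bsub>class_ring\<^esub> S = I \<longrightarrow> n \<le> card S)"

definition regular_sequence :: "'a::comm_ring_1 list \<Rightarrow> bool" where
  "regular_sequence rs \<longleftrightarrow>
     (\<forall>i<length rs. \<forall>g. rs ! i * g \<in> Idl\<^bsub>class_ring\<^esub> (set (take i rs)) \<longrightarrow>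
        g \<in> Idl\<^bsub>class_ring\<^esub> (set (take i rs))) \<and>
     Idl\<^bsub>class_ring\<^esub> (set rs) \<noteq> UNIV"

definition complete_intersection :: "'a::comm_ring_1 set \<Rightarrow> bool" where
  "complete_intersection I \<longleftrightarrow> (\<exists>rs. regular_sequence rs \<and> I = Idl\<^bsub>class_ring\<^esub> (set rs))"

text \<open>The Krull dimension of \<open>R/I\<close> is \<open>0\<close>.\<close>

definition zero_dimensional :: "'a::comm_ring_1 set \<Rightarrow> bool" where
  "zero_dimensional I \<longleftrightarrow>
     (\<exists>P. primeideal P (class_ring Quot I)) \<and>
     (\<forall>P. primeideal P (class_ring Quot I) \<longrightarrow> maximalideal P (class_ring Quot I))"


section \<open>Plane curve singularities\<close>

definition ps_max_ideal :: "conv_ps2 set" where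
  "ps_max_ideal = Idl\<^bsub>ps_ring\<^esub> {ps_X, ps_Y}"

text \<open>\<open>R/I\<close> as an algebra over \<open>\<complex>\<close>.\<close>

definition quotient_algebra :: "conv_ps2 set \<Rightarrow> (complex, conv_ps2 set) module" where
  "quotient_algebra I = \<lparr>carrier = carrier (ps_ring Quot I), mult = mult (ps_ring Quot I),
     one = one (ps_ring Quot I), zero = zero (ps_ring Quot I), add = add (ps_ring Quot I),
     smult = (\<lambda>c K. (I +>\<^bsub>ps_ring\<^esub> ps_const c) \<otimes>\<^bsub>ps_ring Quot I\<^esub> K)\<rparr>"

abbreviation fin_dim_complex :: "(complex, 'b) module \<Rightarrow> bool" where
  "fin_dim_complex V \<equiv> vectorspace.fin_dim class_ring V"

abbreviation dim_complex :: "(complex, 'b) module \<Rightarrow> nat" where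
  "dim_complex V \<equiv> vectorspace.dim class_ring V"

definition jacobian_ideal :: "conv_ps2 \<Rightarrow> conv_ps2 set" where
  "jacobian_ideal f = Idl\<^bsub>ps_ring\<^esub> {deriv_x f, deriv_y f}"

definition tjurina_ideal :: "conv_ps2 \<Rightarrow> conv_ps2 set" where
  "tjurina_ideal f = Idl\<^bsub>ps_ring\<^esub> {deriv_x f, deriv_y f, f}"

definition milnor_algebra :: "conv_ps2 \<Rightarrow> (complex, conv_ps2 set) module" where
  "milnor_algebra f = quotient_algebra (jacobian_ideal f)"

definition tjurina_number :: "conv_ps2 \<Rightarrow> nat" where
  "tjurina_number f = dim_complex (quotient_algebra (tjurina_ideal f))"

definition isolated_singularity :: "conv_ps2 \<Rightarrow> bool" where
  "isolated_singularity f \<longleftrightarrow> ps_coeff f 0 0 = 0 \<and> fin_dim_complex (milnor_algebra f)"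

text \<open>By Saito's theorem this is quasi-homogeneity of the germ \<open>f = 0\<close>.\<close>

definition quasi_homogeneous :: "conv_ps2 \<Rightarrow> bool" where
  "quasi_homogeneous f \<longleftrightarrow> tjurina_ideal f = jacobian_ideal f"

definition syz :: "conv_ps2 \<Rightarrow> conv_ps2 vec set" where
  "syz f = {vec_of_list [a, b, c] | a b c. a * deriv_x f + b * deriv_y f + c * f = 0}"

definition syz_module :: "conv_ps2 \<Rightarrow> (conv_ps2, conv_ps2 vec) module" where
  "syz_module f = module_vec TYPE(conv_ps2) 3 \<lparr>carrier := syz f\<rparr>"

definition annihilator :: "conv_ps2 \<Rightarrow> conv_ps2 set" where
  "annihilator f = {g. jacobian_ideal f +>\<^bsub>ps_ring\<^esub> (g * f) = \<zero>\<^bsub>milnor_algebra f\<^esub>}"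

text \<open>
  The sequence \<open>0 \<rightarrow> R\<^sup>p \<rightarrow> R\<^sup>q \<rightarrow> N \<rightarrow> 0\<close> with maps \<open>u\<close> and \<open>v\<close> is exact; it is minimal in the sense
  that \<open>u\<close> maps \<open>R\<^sup>p\<close> into \<open>\<mm> R\<^sup>q\<close>, where \<open>\<mm>\<close> is the maximal ideal.
\<close>

definition minimal_free_resolution ::
  "nat \<Rightarrow> nat \<Rightarrow> (conv_ps2, 'b) module \<Rightarrow> (conv_ps2 vec \<Rightarrow> conv_ps2 vec) \<Rightarrow>
     (conv_ps2 vec \<Rightarrow> 'b) \<Rightarrow> bool" where
  "minimal_free_resolution p q N u v \<longleftrightarrow>
     Module.module ps_ring N \<and>
     u \<in> LinearCombinations.module_hom ps_ring (module_vec TYPE(conv_ps2) p) (module_vec TYPE(conv_ps2) q) \<and>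
     v \<in> LinearCombinations.module_hom ps_ring (module_vec TYPE(conv_ps2) q) N \<and>
     inj_on u (carrier_vec p) \<and>
     u ` carrier_vec p = {w \<in> carrier_vec q. v w = \<zero>\<^bsub>N\<^esub>} \<and>
     v ` carrier_vec q = carrier N \<and>
     u ` carrier_vec p \<subseteq> {w \<in> carrier_vec q. \<forall>i<q. w $ i \<in> ps_max_ideal}"

end

theory Submission
  imports Defs "HOL-Library.Product_Plus"
begin

text \<open>
  All that is used of the finiteness of \<open>\<mu>(f)\<close> is that \<open>x\<^sup>n\<close> and \<open>y\<^sup>m\<close> lie in \<open>J = (f\<^sub>x, f\<^sub>y)\<close>. Since \<open>x\<close> is
  prime and does not divide \<open>y\<close>, the pair \<open>f\<^sub>x, f\<^sub>y\<close> then has only Koszul syzygies. Modulo \<open>x\<close> the syzygies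
  of \<open>(f\<^sub>x, f\<^sub>y, f)\<close> become a rank-two module over a discrete valuation ring; lifts of a triangular basis
  generate by Nakayama's lemma, because \<open>x\<^sup>n Syz(f)\<close> lies in the span of the three Koszul syzygies.

  The resolution is minimal: a syzygy with a unit in the third place gives \<open>f \<in> J\<close>, and one with a unit in
  another place is a vector field with \<open>\<partial>f \<in> (f)\<close> that does not vanish at the origin; in formal
  coordinates straightening it, \<open>f\<close> is \<open>z\<^sup>k\<close> times a unit, so \<open>f\<close> is smooth or not isolated.

  The cross product of the two basis syzygies is \<open>t (f\<^sub>x, f\<^sub>y, f)\<close>; comparing with the cross products of
  the Koszul syzygies, \<open>t\<close> divides \<open>f\<^sub>x\<close> and \<open>f\<^sub>y\<close>, hence \<open>x\<^sup>n\<close> and \<open>y\<^sup>m\<close>, and is a unit. The third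
  components of the basis generate \<open>Ann(f)\<close>, which contains \<open>x\<^sup>n\<close> and \<open>y\<^sup>m\<close> and so is neither principal
  nor of positive dimension.
\<close>

section \<open>Ideals and determinants\<close>

text \<open>Three points are left implicit there. Nakayama's lemma needs finite generation, which is
  not known for \<open>Syz(f)\<close> beforehand: reduction modulo \<open>x\<close> only gives
  \<open>Syz(f) = L + x^i Syz(f)\<close> for every \<open>i\<close>, with \<open>L\<close> spanned
  by the lifted basis. At \<open>i = n\<close> the remainder falls into the span of the three Koszul
  syzygies, and these alone have to be absorbed into \<open>L\<close>. The vector field is
  straightened in formal power series because there the Cauchy problem is solved by a recursion on
  coefficients; the contradiction is an identity in the formal ring, so no convergence has to be
  proved. The Fitting ideal is a definite description and has a value only once its independence of
  the presentation is established. That proof replaces the matrix by the set of all relations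
  between the chosen generators: minors are formed from arbitrary vectors of this set, and two
  systems of generators are compared by padding each with as many free coordinates as the other has
  members.\<close>

lemma ideal_Idl [simp]: "ideal (Idl\<^bsub>class_ring\<^esub> S) (class_ring :: 'a::comm_ring_1 ring)"
  by (rule ring.genideal_ideal[OF class_ring.ring_axioms]) simp

lemma Idl_base: "x \<in> S \<Longrightarrow> x \<in> Idl\<^bsub>class_ring\<^esub> (S :: 'a::comm_ring_1 set)"
  using ring.genideal_self[OF class_ring.ring_axioms, of S] by auto

lemma ideal_0: "ideal I (class_ring :: 'a::comm_ring_1 ring) \<Longrightarrow> 0 \<in> I"
  using additive_subgroup.zero_closed[OF ideal.axioms(1)] by fastforce

lemma ideal_add: "ideal I (class_ring :: 'a::comm_ring_1 ring) \<Longrightarrow> x \<in> I \<Longrightarrow> y \<in> I \<Longrightarrow> x + y \<in> I"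
  using additive_subgroup.a_closed[OF ideal.axioms(1)] by fastforce

lemma ideal_mult: "ideal I (class_ring :: 'a::comm_ring_1 ring) \<Longrightarrow> x \<in> I \<Longrightarrow> c * x \<in> I"
  using ideal.I_l_closed[of I class_ring x c] by simp

lemma ideal_uminus: "ideal I (class_ring :: 'a::comm_ring_1 ring) \<Longrightarrow> x \<in> I \<Longrightarrow> - x \<in> I"
  using ideal_mult[of I x "-1"] by simp

lemma ideal_sum:
  "ideal I (class_ring :: 'a::comm_ring_1 ring) \<Longrightarrow> (\<And>i. i \<in> A \<Longrightarrow> f i \<in> I) \<Longrightarrow> sum f A \<in> I"
  by (induction A rule: infinite_finite_induct) (auto intro: ideal_0 ideal_add)

lemma Idl_subset:
  "ideal I (class_ring :: 'a::comm_ring_1 ring) \<Longrightarrow> S \<subseteq> I \<Longrightarrow> Idl\<^bsub>class_ring\<^esub> S \<subseteq> I"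
  by (rule ring.genideal_minimal[OF class_ring.ring_axioms])

lemma Idl_le: "S \<subseteq> Idl\<^bsub>class_ring\<^esub> T \<Longrightarrow> Idl\<^bsub>class_ring\<^esub> S \<subseteq> Idl\<^bsub>class_ring\<^esub> (T :: 'a::comm_ring_1 set)"
  by (rule Idl_subset) simp_all

lemma ideal_classI:
  fixes I :: "'a::comm_ring_1 set"
  assumes "0 \<in> I" "\<And>x y. x \<in> I \<Longrightarrow> y \<in> I \<Longrightarrow> x + y \<in> I" "\<And>c x. x \<in> I \<Longrightarrow> c * x \<in> I"
  shows "ideal I class_ring"
proof (rule idealI)
  show "ring (class_ring :: 'a ring)" by (rule class_ring.ring_axioms)
  have "- x \<in> I" if "x \<in> I" for x using assms(3)[OF that, of "-1"] by simp
  thus "subgroup I (add_monoid (class_ring :: 'a ring))"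
    using assms(1,2) class_ring.add.subgroupI[of I] by (auto simp: a_inv_def[symmetric] class_ring_simps)
qed (use assms(3) in \<open>auto simp: mult.commute\<close>)

section \<open>Determinants of matrices given by functions\<close>

lemma det_mat_transpose:
  "det (mat k k (\<lambda>(i, j). f j i)) = det (mat k k (\<lambda>(i, j). f i j))"
proof -
  have "mat k k (\<lambda>(i, j). f j i) = transpose_mat (mat k k (\<lambda>(i, j). f i j))" by (rule eq_matI) auto
  thus ?thesis using det_transpose[of "mat k k (\<lambda>(i, j). f i j)" k] by simp
qed

lemma det_mat_cong:
  "(\<And>i j. i < k \<Longrightarrow> j < k \<Longrightarrow> f i j = g i j) \<Longrightarrow>
    det (mat k k (\<lambda>(i, j). f i j)) = det (mat k k (\<lambda>(i, j). g i j))"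
  by (rule arg_cong[of _ _ det]) (rule eq_matI, auto)

text \<open>By multilinearity in the rows the determinant expands into a sum over all choices
  \<open>f\<close> of one summand per row; each term is a product of coefficients
  \<open>c i (f i)\<close> times a determinant covered by \<open>mem\<close>. This takes the place
  of the Cauchy-Binet formula wherever a minor of a product has to be placed in an ideal.\<close>

lemma det_row_sums_in_ideal:
  fixes c :: "nat \<Rightarrow> nat \<Rightarrow> 'a::comm_ring_1"
  assumes I: "ideal I class_ring" and S: "finite S"
    and mem: "\<And>f. (\<And>i. i < k \<Longrightarrow> f i \<in> S) \<Longrightarrow> det (mat k k (\<lambda>(i, j). a i (f i) j)) \<in> I"
  shows "det (mat k k (\<lambda>(i, j). \<Sum>l\<in>S. c i l * a i l j)) \<in> I"
proof -
  define v where "v = (\<lambda>i l. vec k (\<lambda>j. c i l * a i l j))"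
  have "mat k k (\<lambda>(i, j). \<Sum>l\<in>S. c i l * a i l j) = mat\<^sub>r k k (\<lambda>i. finsum_vec TYPE('a) k (v i) S)"
    by (rule eq_matI) (auto simp: v_def index_finsum_vec[OF S])
  also have "det \<dots> = sum (\<lambda>f. det (mat\<^sub>r k k (\<lambda> i. v i (f i))))
      {f. (\<forall>i\<in>{0..<k}. f i \<in> S) \<and> (\<forall>i. i \<notin> {0..<k} \<longrightarrow> f i = i)}"
    by (rule det_linear_rows_sum[OF S]) (auto simp: v_def)
  also have "\<dots> \<in> I"
  proof (rule ideal_sum[OF I])
    fix f assume f: "f \<in> {f. (\<forall>i\<in>{0..<k}. f i \<in> S) \<and> (\<forall>i. i \<notin> {0..<k} \<longrightarrow> f i = i)}"
    have "mat\<^sub>r k k (\<lambda> i. v i (f i)) = mat\<^sub>r k k (\<lambda> i. c i (f i) \<cdot>\<^sub>v vec k (\<lambda>j. a i (f i) j))"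
      by (rule eq_matI) (auto simp: v_def)
    also have "det \<dots> = prod (\<lambda>i. c i (f i)) {0..<k} * det (mat\<^sub>r k k (\<lambda>i. vec k (\<lambda>j. a i (f i) j)))"
      by (rule det_rows_mul) auto
    also have "mat\<^sub>r k k (\<lambda>i. vec k (\<lambda>j. a i (f i) j)) = mat k k (\<lambda>(i, j). a i (f i) j)"
      by (rule eq_matI) auto
    also have "prod (\<lambda>i. c i (f i)) {0..<k} * det (mat k k (\<lambda>(i, j). a i (f i) j)) \<in> I"
      by (rule ideal_mult[OF I mem]) (use f in auto)
    finally show "det (mat\<^sub>r k k (\<lambda> i. v i (f i))) \<in> I" .
  qed
  finally show ?thesis .
qed

text \<open>Minors of the possibly infinite matrix whose columns are all members of
  \<open>K\<close>. Row indices may repeat and come in any order, which adds only zeros and signs.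
  Vectors are functions on all naturals: if \<open>K\<close> constrains only the first
  \<open>n\<close> values, the same \<open>K\<close> read with \<open>n + p\<close> rows describes
  the relations padded by \<open>p\<close> free coordinates.\<close>

definition gen_minors :: "nat \<Rightarrow> nat \<Rightarrow> (nat \<Rightarrow> 'a::comm_ring_1) set \<Rightarrow> 'a set" where
  "gen_minors k n K = {det (mat k k (\<lambda>(i, j). w j (r i))) | r w.
     (\<forall>i<k. r i < n) \<and> (\<forall>j<k. w j \<in> K)}"

definition gen_minors_ideal :: "nat \<Rightarrow> nat \<Rightarrow> (nat \<Rightarrow> 'a::comm_ring_1) set \<Rightarrow> 'a set" where
  "gen_minors_ideal k n K = Idl\<^bsub>class_ring\<^esub> (gen_minors k n K)"

lemma gen_minors_idealI:
  "(\<And>i. i < k \<Longrightarrow> r i < n) \<Longrightarrow> (\<And>j. j < k \<Longrightarrow> w j \<in> K) \<Longrightarrow>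
    det (mat k k (\<lambda>(i, j). w j (r i))) \<in> gen_minors_ideal k n K"
  unfolding gen_minors_ideal_def by (rule Idl_base) (auto simp: gen_minors_def)

lemma gen_minors_ideal_subset:
  assumes "ideal I class_ring"
    and "\<And>r w. (\<And>i. i < k \<Longrightarrow> r i < n) \<Longrightarrow> (\<And>j. j < k \<Longrightarrow> w j \<in> K) \<Longrightarrow>
      det (mat k k (\<lambda>(i, j). w j (r i))) \<in> I"
  shows "gen_minors_ideal k n K \<subseteq> I"
  unfolding gen_minors_ideal_def by (rule Idl_subset) (use assms in \<open>auto simp: gen_minors_def\<close>)

lemma ideal_gen_minors_ideal [simp]: "ideal (gen_minors_ideal k n K) class_ring"
  by (simp add: gen_minors_ideal_def)

text \<open>Each row of a minor of \<open>K'\<close> is a combination, with coefficients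
  \<open>F\<close>, of rows of \<open>K\<close>, so the minor expands into minors of
  \<open>K\<close> of the same size.\<close>

lemma gen_minors_ideal_linear_image:
  fixes F :: "nat \<Rightarrow> nat \<Rightarrow> 'a::comm_ring_1"
  assumes "\<And>w'. w' \<in> K' \<Longrightarrow> \<exists>w\<in>K. \<forall>i<n'. w' i = (\<Sum>l<n. F i l * w l)"
  shows "gen_minors_ideal k n' K' \<subseteq> gen_minors_ideal k n K"
proof (rule gen_minors_ideal_subset)
  fix r w' assume r: "\<And>i. i < k \<Longrightarrow> r i < n'" and w': "\<And>j. j < k \<Longrightarrow> w' j \<in> K'"
  have "\<exists>w. \<forall>j<k. w j \<in> K \<and> (\<forall>i<n'. w' j i = (\<Sum>l<n. F i l * w j l))"
    using assms[OF w'] by (metis (full_types))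
  then obtain w where w: "\<And>j. j < k \<Longrightarrow> w j \<in> K"
    "\<And>i j. j < k \<Longrightarrow> i < n' \<Longrightarrow> w' j i = (\<Sum>l<n. F i l * w j l)" by blast
  have "det (mat k k (\<lambda>(i, j). w' j (r i))) = det (mat k k (\<lambda>(i, j). \<Sum>l\<in>{..<n}. F (r i) l * w j l))"
    by (rule det_mat_cong) (simp add: w r)
  also have "\<dots> \<in> gen_minors_ideal k n K"
    by (rule det_row_sums_in_ideal) (auto intro!: gen_minors_idealI w)
  finally show "det (mat k k (\<lambda>(i, j). w' j (r i))) \<in> gen_minors_ideal k n K" .
qed simp

lemma det_laplace_mat:
  fixes f :: "nat \<Rightarrow> nat \<Rightarrow> 'a::comm_ring_1"
  assumes "i < Suc k"
  shows "det (mat (Suc k) (Suc k) (\<lambda>(i, j). f i j)) =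
    (\<Sum>j<Suc k. f i j * ((-1) ^ (i + j) * det (mat k k (\<lambda>(i', j').
       f (insert_index i i') (insert_index j j')))))"
proof -
  let ?A = "mat (Suc k) (Suc k) (\<lambda>(i, j). f i j)"
  have "mat_delete ?A i j = mat k k (\<lambda>(i', j'). f (insert_index i i') (insert_index j j'))"
    if "j < Suc k" for j
    by (rule eq_matI) (use that assms in \<open>auto simp: mat_delete_def insert_index_def\<close>)
  thus ?thesis
    using laplace_expansion_row[of ?A "Suc k" i] assms by (simp add: cofactor_def)
qed

lemma det_mat_identical_rows:
  assumes "i < k" "i' < k" "i \<noteq> i'" "\<And>j. j < k \<Longrightarrow> f i j = f i' j"
  shows "det (mat k k (\<lambda>(i, j). f i j)) = (0 :: 'a::comm_ring_1)"
  by (rule det_identical_rows[of _ k i i']) (use assms in \<open>auto intro!: eq_vecI\<close>)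

text \<open>A coordinate left free by \<open>K\<close> belongs to a generator that is zero in the
  module, so the number of generators and the size of the minors may grow together. Downwards, a
  minor is expanded along its row with index \<open>n\<close>; upwards, the unit vector at
  \<open>n\<close>, which lies in \<open>K\<close> by \<open>K0\<close> and \<open>dep\<close>, is
  appended as last column.\<close>

lemma gen_minors_ideal_Suc:
  fixes K :: "(nat \<Rightarrow> 'a::comm_ring_1) set"
  assumes K0: "(\<lambda>_. 0) \<in> K"
    and dep: "\<And>w w'. w \<in> K \<Longrightarrow> (\<And>i. i < n \<Longrightarrow> w i = w' i) \<Longrightarrow> w' \<in> K"
  shows "gen_minors_ideal (Suc k) (Suc n) K = gen_minors_ideal k n K"
proof
  show "gen_minors_ideal (Suc k) (Suc n) K \<subseteq> gen_minors_ideal k n K"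
  proof (rule gen_minors_ideal_subset)
    fix r w assume r: "\<And>i. i < Suc k \<Longrightarrow> r i < Suc n" and w: "\<And>j. j < Suc k \<Longrightarrow> w j \<in> K"
    let ?D = "det (mat (Suc k) (Suc k) (\<lambda>(i, j). w j (r i)))"
    show "?D \<in> gen_minors_ideal k n K"
    proof (cases "\<exists>i i'. i < Suc k \<and> i' < Suc k \<and> i \<noteq> i' \<and> r i = n \<and> r i' = n")
      case True
      then obtain i i' where "i < Suc k" "i' < Suc k" "i \<noteq> i'" "r i = n" "r i' = n" by blast
      hence "?D = 0" by (intro det_mat_identical_rows[of i "Suc k" i']) auto
      thus ?thesis by (simp add: ideal_0)
    next
      case False
      \<comment> \<open>If no row has index \<open>n\<close>, any row serves as \<open>a\<close>;
        two such rows were excluded, so the expansion leaves only indices below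
        \<open>n\<close>.\<close>
      then obtain a where a: "a < Suc k" "\<And>i. i < Suc k \<Longrightarrow> i \<noteq> a \<Longrightarrow> r i \<noteq> n"
        by (metis zero_less_Suc)
      have ins: "insert_index a i < Suc k" "insert_index a i \<noteq> a" if "i < k" for a i
        using that by (auto simp: insert_index_def)
      have "r (insert_index a i) < n" if "i < k" for i
        using a(2)[OF ins[OF that]] r[OF ins(1)[OF that]] by (metis less_SucE)
      hence "det (mat k k (\<lambda>(i', j'). w (insert_index j j') (r (insert_index a i'))))
          \<in> gen_minors_ideal k n K" if "j < Suc k" for j
        using w ins that by (intro gen_minors_idealI) auto
      thus ?thesis unfolding det_laplace_mat[OF a(1)]
        by (intro ideal_sum ideal_mult) auto
    qed
  qed simp
  show "gen_minors_ideal k n K \<subseteq> gen_minors_ideal (Suc k) (Suc n) K"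
  proof (rule gen_minors_ideal_subset)
    fix r w assume r: "\<And>i. i < k \<Longrightarrow> r i < n" and w: "\<And>j. j < k \<Longrightarrow> w j \<in> K"
    define r' where "r' = r(k := n)"
    define w' where "w' = (\<lambda>j. if j < k then (w j)(n := 0) else (\<lambda>i. if i = n then 1 else 0))"
    have "w' j \<in> K" for j
    proof (cases "j < k")
      case True
      show ?thesis by (rule dep[OF w[OF True]]) (simp add: w'_def True)
    qed (auto intro: dep[OF K0] simp: w'_def)
    hence "det (mat (Suc k) (Suc k) (\<lambda>(i, j). w' j (r' i))) \<in> gen_minors_ideal (Suc k) (Suc n) K"
      using r by (intro gen_minors_idealI) (auto simp: r'_def less_Suc_eq)
    also have "det (mat (Suc k) (Suc k) (\<lambda>(i, j). w' j (r' i))) =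
        det (mat k k (\<lambda>(i', j'). w' (insert_index k j') (r' (insert_index k i'))))"
      unfolding det_laplace_mat[of k k, OF lessI] sum.lessThan_Suc
      by (simp add: w'_def r'_def)
    also have "\<dots> = det (mat k k (\<lambda>(i, j). w j (r i)))"
      by (rule det_mat_cong) (use r in \<open>auto simp: w'_def r'_def insert_index_def\<close>)
    finally show "det (mat k k (\<lambda>(i, j). w j (r i))) \<in> gen_minors_ideal (Suc k) (Suc n) K" .
  qed simp
qed

lemma gen_minors_ideal_add:
  fixes K :: "(nat \<Rightarrow> 'a::comm_ring_1) set"
  assumes K0: "(\<lambda>_. 0) \<in> K"
    and dep: "\<And>w w'. w \<in> K \<Longrightarrow> (\<And>i. i < n \<Longrightarrow> w i = w' i) \<Longrightarrow> w' \<in> K"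
  shows "gen_minors_ideal (k + p) (n + p) K = gen_minors_ideal k n K"
proof (induction p)
  case (Suc p)
  have "gen_minors_ideal (Suc (k + p)) (Suc (n + p)) K = gen_minors_ideal (k + p) (n + p) K"
    by (rule gen_minors_ideal_Suc[OF K0]) (auto intro: dep)
  with Suc show ?case by simp
qed simp

lemma gen_minors_ideal_0:
  assumes "K \<noteq> {}" shows "gen_minors_ideal 0 n K = UNIV"
proof -
  obtain w where "w \<in> K" using assms by blast
  have 1: "1 \<in> gen_minors_ideal 0 n K"
    using gen_minors_idealI[of 0 "\<lambda>_. 0" n "\<lambda>_. w" K] by simp
  show ?thesis using ideal_mult[OF ideal_gen_minors_ideal 1] by auto
qed

text \<open>Truncated subtraction forces the case split. For \<open>n < i \<le> n + p\<close> the
  right side has minors of size 0 while the left side may not; stripping free coordinates down to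
  \<open>n + m = i\<close> rows brings the left side to size 0 as well, and both are the unit
  ideal.\<close>

lemma gen_minors_ideal_diff_add:
  fixes K :: "(nat \<Rightarrow> 'a::comm_ring_1) set"
  assumes K0: "(\<lambda>_. 0) \<in> K"
    and dep: "\<And>w w'. w \<in> K \<Longrightarrow> (\<And>i. i < n \<Longrightarrow> w i = w' i) \<Longrightarrow> w' \<in> K"
  shows "gen_minors_ideal (n + p - i) (n + p) K = gen_minors_ideal (n - i) n K"
proof (cases "i \<le> n")
  case True
  thus ?thesis using gen_minors_ideal_add[OF K0 dep, where k = "n - i" and p = p and n = n] by simp
next
  case False
  have unit: "gen_minors_ideal 0 m K = UNIV" for m
    by (rule gen_minors_ideal_0) (use K0 in auto)
  show ?thesis
  proof (cases "i \<le> n + p")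
    case True
    define q where "q = n + p - i"
    define m where "m = i - n"
    have eq: "n + p = (n + m) + q" using False True by (simp add: q_def m_def)
    have "gen_minors_ideal (0 + q) ((n + m) + q) K = gen_minors_ideal 0 (n + m) K"
      by (rule gen_minors_ideal_add[OF K0]) (auto intro: dep)
    also have "\<dots> = UNIV" by (rule unit)
    finally have "gen_minors_ideal (n + p - i) (n + p) K = UNIV"
      by (simp add: q_def[symmetric] eq[symmetric])
    moreover have "gen_minors_ideal (n - i) n K = UNIV"
      using False unit by simp
    ultimately show ?thesis by simp
  qed (use False unit in simp)
qed

text \<open>The columns of \<open>A\<close> are particular relations, which gives one inclusion.
  Conversely, multilinearity reduces a minor of combinations to minors of columns of
  \<open>A\<close> with arbitrary index functions: these vanish if an index repeats and otherwise
  differ by two permutations from a minor with increasing indices.\<close>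

lemma minors_ideal_eq_gen_minors_ideal:
  fixes A :: "'a::comm_ring_1 mat"
  assumes A: "A \<in> carrier_mat n m"
  shows "minors_ideal k A = gen_minors_ideal k n {w. \<exists>z. \<forall>i<n. w i = (\<Sum>l<m. A $$ (i, l) * z l)}"
    (is "_ = gen_minors_ideal k n ?K")
proof
  show "minors_ideal k A \<subseteq> gen_minors_ideal k n ?K"
    unfolding minors_ideal_def
  proof (rule Idl_subset)
    show "minors k A \<subseteq> gen_minors_ideal k n ?K"
    proof
      fix d assume "d \<in> minors k A"
      then obtain I J where d: "d = det (submatrix A I J)"
        and I: "I \<subseteq> {..<n}" "card I = k" and J: "J \<subseteq> {..<m}" "card J = k"
        using A by (auto simp: minors_def)
      have IJ: "{i. i < n \<and> i \<in> I} = I" "{i. i < m \<and> i \<in> J} = J" using I J by auto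
      have pick: "pick I i < n" "pick J i < m" if "i < k" for i
        using pick_in_set_le[of i I] pick_in_set_le[of i J] that I J by auto
      have "submatrix A I J = mat k k (\<lambda>(i, j). A $$ (pick I i, pick J j))"
        using A I J IJ by (simp add: submatrix_def)
      moreover have "det \<dots> = det (mat k k (\<lambda>(i, j). (\<lambda>i. A $$ (i, pick J j)) (pick I i)))" by simp
      moreover have "\<dots> \<in> gen_minors_ideal k n ?K"
      proof (rule gen_minors_idealI)
        fix j assume "j < k"
        show "(\<lambda>i. A $$ (i, pick J j)) \<in> ?K"
          by (rule CollectI, rule exI[of _ "\<lambda>l. if l = pick J j then 1 else 0"])
             (use pick(2)[OF \<open>j < k\<close>] in \<open>simp add: if_distrib cong: if_cong\<close>)
      qed (use pick in auto)
      ultimately show "d \<in> gen_minors_ideal k n ?K" using d by simp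
    qed
  qed simp
  have perm: "\<exists>p. p permutes {0..<k} \<and> (\<forall>i<k. r i = pick (r ` {..<k}) (p i))"
    if "inj_on r {..<k}" for r :: "nat \<Rightarrow> nat"
  proof -
    let ?I = "r ` {..<k}"
    have cI: "card ?I = k" using card_image[OF that] by simp
    \<comment> \<open>The rank of \<open>r i\<close> within the image of \<open>r\<close>, so that
      \<open>pick\<close> at \<open>p i\<close> returns \<open>r i\<close>.\<close>
    define p where "p = (\<lambda>i. if i < k then card {a \<in> ?I. a < r i} else i)"
    have pick: "r i = pick ?I (p i)" if "i < k" for i
      using that pick_card_in_set[of "r i" ?I] by (simp add: p_def)
    have lt: "p i < k" if "i < k" for i
    proof -
      have "{a \<in> ?I. a < r i} \<subset> ?I" using that by auto
      from psubset_card_mono[OF _ this] show ?thesis using that cI by (simp add: p_def)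
    qed
    have "inj_on p {0..<k}"
      using pick \<open>inj_on r {..<k}\<close> by (auto simp: inj_on_def)
    hence "bij_betw p {0..<k} {0..<k}"
      unfolding bij_betw_def by (intro conjI endo_inj_surj) (use lt in auto)
    hence "p permutes {0..<k}" by (rule bij_imp_permutes) (simp add: p_def)
    thus ?thesis using pick by blast
  qed
  have minor: "det (mat k k (\<lambda>(i, j). A $$ (r i, c j))) \<in> minors_ideal k A"
    if r: "\<And>i. i < k \<Longrightarrow> r i < n" and c: "\<And>j. j < k \<Longrightarrow> c j < m" for r c
  proof (cases "inj_on r {..<k} \<and> inj_on c {..<k}")
    case True
    then obtain p q where p: "p permutes {0..<k}" "\<And>i. i < k \<Longrightarrow> r i = pick (r ` {..<k}) (p i)"
      and q: "q permutes {0..<k}" "\<And>i. i < k \<Longrightarrow> c i = pick (c ` {..<k}) (q i)"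
      using perm by meson
    let ?I = "r ` {..<k}" and ?J = "c ` {..<k}"
    define B where "B = submatrix A ?I ?J"
    have IJ: "?I \<subseteq> {..<n}" "?J \<subseteq> {..<m}" "card ?I = k" "card ?J = k"
      using r c True by (auto simp: card_image)
    hence "{i. i < n \<and> i \<in> ?I} = ?I" "{i. i < m \<and> i \<in> ?J} = ?J" by auto
    hence B: "B = mat k k (\<lambda>(i, j). A $$ (pick ?I i, pick ?J j))"
      using A IJ by (simp add: B_def submatrix_def)
    have pq: "p i < k" "q i < k" if "i < k" for i
      using that permutes_in_image[OF p(1), of i] permutes_in_image[OF q(1), of i] by auto
    have "det (mat k k (\<lambda>(i, j). A $$ (r i, c j))) = det (mat k k (\<lambda>(i, j). mat k k (\<lambda>(i, j). B $$ (i, q j)) $$ (p i, j)))"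
      by (rule det_mat_cong) (simp add: pq B p(2)[symmetric] q(2)[symmetric])
    also have "\<dots> = signof p * det (mat k k (\<lambda>(i, j). B $$ (i, q j)))"
      by (rule det_permute_rows) (auto simp: p)
    also have "det (mat k k (\<lambda>(i, j). B $$ (i, q j))) = det (mat k k (\<lambda>(i, j). transpose_mat B $$ (q i, j)))"
      by (subst det_mat_transpose[symmetric], rule det_mat_cong) (simp add: pq B)
    also have "\<dots> = signof q * det (transpose_mat B)"
      by (rule det_permute_rows) (auto simp: q B)
    also have "det (transpose_mat B) = det B" by (rule det_transpose[of _ k]) (simp add: B)
    finally have "det (mat k k (\<lambda>(i, j). A $$ (r i, c j))) = signof p * (signof q * det B)" .
    moreover have "det B \<in> minors_ideal k A"
      unfolding minors_ideal_def using A IJ by (intro Idl_base) (auto simp: minors_def B_def)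
    ultimately show ?thesis by (simp add: minors_ideal_def ideal_mult)
  next
    case False
    hence "det (mat k k (\<lambda>(i, j). A $$ (r i, c j))) = 0"
    proof (cases "inj_on r {..<k}")
      case True
      with False obtain j j' where "j < k" "j' < k" "j \<noteq> j'" "c j = c j'" by (auto simp: inj_on_def)
      thus ?thesis by (subst det_mat_transpose[symmetric]) (auto intro: det_mat_identical_rows[of j k j'])
    next
      case False
      then obtain i i' where "i < k" "i' < k" "i \<noteq> i'" "r i = r i'" by (auto simp: inj_on_def)
      thus ?thesis by (auto intro: det_mat_identical_rows[of i k i'])
    qed
    thus ?thesis by (simp add: minors_ideal_def ideal_0)
  qed
  show "gen_minors_ideal k n ?K \<subseteq> minors_ideal k A"
  proof (rule gen_minors_ideal_subset)
    fix r w assume r: "\<And>i. i < k \<Longrightarrow> r i < n" and w: "\<And>j. j < k \<Longrightarrow> w j \<in> ?K"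
    obtain z where z: "\<And>j i. j < k \<Longrightarrow> i < n \<Longrightarrow> w j i = (\<Sum>l<m. A $$ (i, l) * z j l)"
      using w by (simp add: Bex_def) metis
    have "det (mat k k (\<lambda>(i, j). w j (r i))) = det (mat k k (\<lambda>(i, j). w i (r j)))"
      by (rule det_mat_transpose[symmetric])
    also have "\<dots> = det (mat k k (\<lambda>(i, j). \<Sum>l\<in>{..<m}. z i l * A $$ (r j, l)))"
      by (rule det_mat_cong) (simp add: z r mult.commute)
    also have "\<dots> \<in> minors_ideal k A"
    proof (rule det_row_sums_in_ideal)
      fix c assume "\<And>i. i < k \<Longrightarrow> c i \<in> {..<m}"
      thus "det (mat k k (\<lambda>(i, j). A $$ (r j, c i))) \<in> minors_ideal k A"
        by (subst det_mat_transpose) (use r in \<open>auto intro: minor\<close>)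
    qed (auto simp: minors_ideal_def)
    finally show "det (mat k k (\<lambda>(i, j). w j (r i))) \<in> minors_ideal k A" .
  qed (simp add: minors_ideal_def)
qed

section \<open>Independence of Fitting ideals from the presentation\<close>

lemma unit_vec_sum_step:
  "vec n (\<lambda>i. if i < Suc t then u i else (0::'a::comm_ring_1)) =
    vec n (\<lambda>i. if i < t then u i else 0) + u t \<cdot>\<^sub>v unit_vec n t"
  by (rule eq_vecI) (auto simp: less_Suc_eq unit_vec_def)

lemma vec_cong: "n = m \<Longrightarrow> (\<And>i. i < m \<Longrightarrow> f i = g i) \<Longrightarrow> vec n f = vec m g"
  by (auto intro!: eq_vecI)

lemma module_hom_vecD:
  fixes \<pi> :: "'a::comm_ring_1 vec \<Rightarrow> 'b"
  assumes "\<pi> \<in> LinearCombinations.module_hom class_ring (module_vec TYPE('a) n) N"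
  shows "\<And>u. u \<in> carrier_vec n \<Longrightarrow> \<pi> u \<in> carrier N"
    and "\<And>u v. u \<in> carrier_vec n \<Longrightarrow> v \<in> carrier_vec n \<Longrightarrow> \<pi> (u + v) = \<pi> u \<oplus>\<^bsub>N\<^esub> \<pi> v"
    and "\<And>c u. u \<in> carrier_vec n \<Longrightarrow> \<pi> (c \<cdot>\<^sub>v u) = c \<odot>\<^bsub>N\<^esub> \<pi> u"
  using assms by (auto simp: LinearCombinations.module_hom_def module_vec_simps)

text \<open>Free modules are projective: the images of the unit vectors are lifted through
  \<open>\<pi>'\<close>, and column \<open>l\<close> of \<open>P\<close> is the lift of the
  \<open>l\<close>-th. The induction on \<open>t\<close> adds one coordinate at a time.\<close>

lemma module_hom_vec_factor:
  fixes \<pi> \<pi>' :: "'a::comm_ring_1 vec \<Rightarrow> 'b"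
  assumes N: "Module.module class_ring N"
    and \<pi>: "\<pi> \<in> LinearCombinations.module_hom class_ring (module_vec TYPE('a) n) N"
    and \<pi>': "\<pi>' \<in> LinearCombinations.module_hom class_ring (module_vec TYPE('a) p) N"
    and surj: "carrier N \<subseteq> \<pi>' ` carrier_vec p"
  shows "\<exists>P. \<forall>u. \<pi> (vec n u) = \<pi>' (vec p (\<lambda>i. \<Sum>l<n. P i l * u l))"
proof -
  interpret N: Module.module "class_ring :: 'a ring" N by (rule N)
  note h = module_hom_vecD[OF \<pi>] and h' = module_hom_vecD[OF \<pi>']
  have "\<exists>v. v \<in> carrier_vec p \<and> \<pi> (unit_vec n l) = \<pi>' v" for l
    using h(1)[of "unit_vec n l"] surj by auto
  then obtain v where v: "\<And>l. v l \<in> carrier_vec p" "\<And>l. \<pi> (unit_vec n l) = \<pi>' (v l)" by metis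
  have "\<pi> (vec n (\<lambda>i. if i < t then u i else 0)) = \<pi>' (vec p (\<lambda>i. \<Sum>l<t. v l $ i * u l))"
    if "t \<le> n" for t u using that
  proof (induction t)
    case 0
    have "vec n (\<lambda>i. 0) = 0 \<cdot>\<^sub>v (0\<^sub>v n :: 'a vec)" "vec p (\<lambda>i. 0) = 0 \<cdot>\<^sub>v (0\<^sub>v p :: 'a vec)"
      by (auto intro!: eq_vecI)
    thus ?case using h(1)[of "0\<^sub>v n"] h(3)[of "0\<^sub>v n" 0] h'(1)[of "0\<^sub>v p"] h'(3)[of "0\<^sub>v p" 0] N.smult_l_null by simp
  next
    case (Suc t)
    have "\<pi> (vec n (\<lambda>i. if i < Suc t then u i else 0)) =
      \<pi>' (vec p (\<lambda>i. \<Sum>l<t. v l $ i * u l)) \<oplus>\<^bsub>N\<^esub> \<pi>' (u t \<cdot>\<^sub>v v t)"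
      unfolding unit_vec_sum_step using Suc v h(2,3) h'(3) by simp
    also have "\<dots> = \<pi>' (vec p (\<lambda>i. \<Sum>l<t. v l $ i * u l) + u t \<cdot>\<^sub>v v t)"
      using v(1) by (intro h'(2)[symmetric]) auto
    also have "vec p (\<lambda>i. \<Sum>l<t. v l $ i * u l) + u t \<cdot>\<^sub>v v t = vec p (\<lambda>i. \<Sum>l<Suc t. v l $ i * u l)"
      using carrier_vecD[OF v(1)] by (intro eq_vecI) (auto simp: mult.commute)
    finally show ?case .
  qed
  from this[of n] have *: "\<pi> (vec n (\<lambda>i. if i < n then u i else 0)) = \<pi>' (vec p (\<lambda>i. \<Sum>l<n. v l $ i * u l))" for u
    by simp
  have "vec n u = vec n (\<lambda>i. if i < n then u i else 0)" for u :: "nat \<Rightarrow> 'a" by (rule eq_vecI) auto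
  with * show ?thesis by (intro exI[of _ "\<lambda>i l. v l $ i"]) simp
qed

text \<open>The kernel of \<open>\<pi>\<close> with vectors turned into functions whose values from
  \<open>n\<close> on are free, the shape in which \<open>gen_minors_ideal\<close> can be padded
  without changing the set.\<close>

definition relations :: "('a::comm_ring_1, 'b) module \<Rightarrow> nat \<Rightarrow> ('a vec \<Rightarrow> 'b) \<Rightarrow> (nat \<Rightarrow> 'a) set" where
  "relations N n \<pi> = {w. \<pi> (vec n w) = \<zero>\<^bsub>N\<^esub>}"

lemma relations_cong:
  "w \<in> relations N n \<pi> \<Longrightarrow> (\<And>i. i < n \<Longrightarrow> w i = w' i) \<Longrightarrow> w' \<in> relations N n \<pi>"
  by (simp add: relations_def cong: vec_cong)

lemma minors_ideal_presentation:
  assumes "finite_free_presentation N n m A \<pi>"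
  shows "minors_ideal k A = gen_minors_ideal k n (relations N n \<pi>)"
proof -
  have A: "A \<in> carrier_mat n m"
    and ker: "{w \<in> carrier_vec n. \<pi> w = \<zero>\<^bsub>N\<^esub>} = (\<lambda>z. A *\<^sub>v z) ` carrier_vec m"
    using assms by (auto simp: finite_free_presentation_def)
  have "w \<in> relations N n \<pi> \<longleftrightarrow> (\<exists>z. \<forall>i<n. w i = (\<Sum>l<m. A $$ (i, l) * z l))" for w
  proof -
    have "w \<in> relations N n \<pi> \<longleftrightarrow> vec n w \<in> (\<lambda>z. A *\<^sub>v z) ` carrier_vec m"
      unfolding ker[symmetric] by (simp add: relations_def)
    also have "\<dots> \<longleftrightarrow> (\<exists>z. \<forall>i<n. w i = (\<Sum>l<m. A $$ (i, l) * z l))"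
    proof
      assume "vec n w \<in> (\<lambda>z. A *\<^sub>v z) ` carrier_vec m"
      then obtain z where z: "z \<in> carrier_vec m" "vec n w = A *\<^sub>v z" by auto
      have "w i = (\<Sum>l<m. A $$ (i, l) * z $ l)" if "i < n" for i
        using arg_cong[OF z(2), of "\<lambda>v. v $ i"] that A z(1)
        by (simp add: scalar_prod_def atLeast0LessThan)
      thus "\<exists>z. \<forall>i<n. w i = (\<Sum>l<m. A $$ (i, l) * z l)" by blast
    next
      assume "\<exists>z. \<forall>i<n. w i = (\<Sum>l<m. A $$ (i, l) * z l)"
      then obtain z where z: "\<And>i. i < n \<Longrightarrow> w i = (\<Sum>l<m. A $$ (i, l) * z l)" by blast
      have "vec n w = A *\<^sub>v vec m z"
        by (rule eq_vecI) (use A z in \<open>auto simp: scalar_prod_def atLeast0LessThan\<close>)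
      thus "vec n w \<in> (\<lambda>z. A *\<^sub>v z) ` carrier_vec m" by auto
    qed
    finally show ?thesis .
  qed
  hence "relations N n \<pi> = {w. \<exists>z. \<forall>i<n. w i = (\<Sum>l<m. A $$ (i, l) * z l)}" by blast
  thus ?thesis using minors_ideal_eq_gen_minors_ideal[OF A] by simp
qed

text \<open>One inclusion suffices, since the two systems of generators play symmetric parts.
  Padding gives both sides \<open>p + n\<close> coordinates and minors of the same size
  \<open>p + n - i\<close>; a linear map between the padded relations then carries minors to
  minors.\<close>

lemma gen_minors_ideal_relations_mono:
  fixes \<pi> \<pi>' :: "'a::comm_ring_1 vec \<Rightarrow> 'b"
  assumes N: "Module.module class_ring N"
    and \<pi>: "\<pi> \<in> LinearCombinations.module_hom class_ring (module_vec TYPE('a) n) N"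
    and surj: "carrier N \<subseteq> \<pi> ` carrier_vec n"
    and \<pi>': "\<pi>' \<in> LinearCombinations.module_hom class_ring (module_vec TYPE('a) p) N"
    and surj': "carrier N \<subseteq> \<pi>' ` carrier_vec p"
  shows "gen_minors_ideal (p - i) p (relations N p \<pi>') \<subseteq> gen_minors_ideal (n - i) n (relations N n \<pi>)"
proof -
  interpret N: Module.module "class_ring :: 'a ring" N by (rule N)
  note h = module_hom_vecD[OF \<pi>] and h' = module_hom_vecD[OF \<pi>']
  obtain P where P: "\<And>u. \<pi> (vec n u) = \<pi>' (vec p (\<lambda>i. \<Sum>l<n. P i l * u l))"
    using module_hom_vec_factor[OF N \<pi> \<pi>' surj'] by blast
  obtain Q where Q: "\<And>u. \<pi>' (vec p u) = \<pi> (vec n (\<lambda>i. \<Sum>l<p. Q i l * u l))"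
    using module_hom_vec_factor[OF N \<pi>' \<pi> surj] by blast
  have zero: "(\<lambda>_. 0) \<in> relations N q \<psi>"
    if "\<psi> \<in> LinearCombinations.module_hom class_ring (module_vec TYPE('a) q) N" for q \<psi>
  proof -
    have "vec q (\<lambda>_. 0) = 0 \<cdot>\<^sub>v (0\<^sub>v q :: 'a vec)" by (auto intro!: eq_vecI)
    thus ?thesis using module_hom_vecD(1)[OF that, of "0\<^sub>v q"] module_hom_vecD(3)[OF that, of "0\<^sub>v q" 0] N.smult_l_null
      by (simp add: relations_def)
  qed
  have diff: "\<psi> (vec q (\<lambda>i. a i + c * b i)) = \<psi> (vec q a) \<oplus>\<^bsub>N\<^esub> c \<odot>\<^bsub>N\<^esub> \<psi> (vec q b)"
    if "\<psi> \<in> LinearCombinations.module_hom class_ring (module_vec TYPE('a) q) N" for q \<psi> a b c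
  proof -
    have "vec q (\<lambda>i. a i + c * b i) = vec q a + c \<cdot>\<^sub>v vec q b" by (auto intro!: eq_vecI)
    thus ?thesis using module_hom_vecD(2,3)[OF that] by simp
  qed
  text \<open>
    Both \<open>\<pi>\<close>-relations and \<open>\<pi>'\<close>-relations, padded by free coordinates, are isomorphic to the relations
    between the concatenated generators; the matrix \<open>F\<close> is the composite
    \<open>(u, v) \<mapsto> (v + P (u - Q v), u - Q v)\<close> of the two isomorphisms.
  \<close>
  define F :: "nat \<Rightarrow> nat \<Rightarrow> 'a" where "F = (\<lambda>i l.
     if i < p then
       (if l < n then P i l
        else (if i = l - n then 1 else 0) - (\<Sum>a<n. P i a * Q a (l - n)))
     else (if l < n then (if i - p = l then 1 else 0) else - Q (i - p) (l - n)))"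
  have "gen_minors_ideal (p + n - i) (p + n) (relations N p \<pi>')
      \<subseteq> gen_minors_ideal (p + n - i) (n + p) (relations N n \<pi>)"
  proof (rule gen_minors_ideal_linear_image)
    fix w' assume w': "w' \<in> relations N p \<pi>'"
    \<comment> \<open>The preimage of \<open>w'\<close> under \<open>F\<close>: \<open>u'\<close> is
      the block of free coordinates of \<open>w'\<close>, and solving \<open>u - Q v = u'\<close>
      and \<open>v + P u' = w'\<close> yields \<open>v\<close> and then \<open>u\<close>.\<close>
    define u' where "u' = (\<lambda>i. w' (p + i))"
    define v where "v = (\<lambda>i. w' i - (\<Sum>l<n. P i l * u' l))"
    define u where "u = (\<lambda>i. u' i + (\<Sum>l<p. Q i l * v l))"
    define w where "w = (\<lambda>i. if i < n then u i else v (i - n))"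
    have "\<pi> (vec n w) = \<pi> (vec n (\<lambda>i. u' i + 1 * (\<Sum>l<p. Q i l * v l)))"
      by (simp add: w_def u_def cong: vec_cong)
    also have "\<dots> = \<pi> (vec n u') \<oplus>\<^bsub>N\<^esub> 1 \<odot>\<^bsub>N\<^esub> \<pi>' (vec p v)"
      unfolding diff[OF \<pi>] Q ..
    also have "\<dots> = \<pi>' (vec p (\<lambda>i. (\<Sum>l<n. P i l * u' l) + 1 * v i))"
      unfolding P diff[OF \<pi>'] ..
    also have "\<dots> = \<pi>' (vec p w')" by (simp add: v_def)
    also have "\<dots> = \<zero>\<^bsub>N\<^esub>" using w' by (simp add: relations_def)
    finally have w: "w \<in> relations N n \<pi>" by (simp add: relations_def)
    have split: "(\<Sum>l<n+p. g l) = (\<Sum>l<n. g l) + (\<Sum>l<p. g (n + l))" for g :: "nat \<Rightarrow> 'a"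
      by (induction p) (simp_all add: add.assoc)
    have "w' i = (\<Sum>l<n+p. F i l * w l)" if i: "i < p + n" for i
    proof (cases "i < p")
      case True
      have "(\<Sum>l<n+p. F i l * w l) = (\<Sum>l<n. P i l * u l)
          + (\<Sum>l<p. ((if i = l then 1 else 0) - (\<Sum>a<n. P i a * Q a l)) * v l)"
        using True by (simp add: split F_def w_def)
      also have "(\<Sum>l<p. ((if i = l then 1 else 0) - (\<Sum>a<n. P i a * Q a l)) * v l) =
          v i - (\<Sum>l<p. \<Sum>a<n. P i a * Q a l * v l)"
        using True by (simp add: left_diff_distrib sum_subtractf sum_distrib_right if_distrib[of "\<lambda>x. x * _"] cong: if_cong)
      also have "(\<Sum>l<p. \<Sum>a<n. P i a * Q a l * v l) = (\<Sum>a<n. P i a * (\<Sum>l<p. Q a l * v l))"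
        by (subst sum.swap) (simp add: sum_distrib_left mult.assoc)
      also have "(\<Sum>l<n. P i l * u l) + (v i - \<dots>) = (\<Sum>l<n. P i l * u' l) + v i"
        by (simp add: u_def distrib_left sum.distrib)
      also have "\<dots> = w' i" by (simp add: v_def)
      finally show ?thesis ..
    next
      case False
      have "(\<Sum>l<n+p. F i l * w l) = (\<Sum>l<n. (if i - p = l then 1 else 0) * u l) - (\<Sum>l<p. Q (i - p) l * v l)"
        using False by (simp add: split F_def w_def sum_negf)
      also have "\<dots> = u (i - p) - (\<Sum>l<p. Q (i - p) l * v l)"
        using False i by (simp add: if_distrib[of "\<lambda>x. x * _"] cong: if_cong)
      also have "\<dots> = w' i" using False by (simp add: u_def u'_def)
      finally show ?thesis ..
    qed
    with w show "\<exists>w\<in>relations N n \<pi>. \<forall>i<p + n. w' i = (\<Sum>l<n + p. F i l * w l)" by blast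
  qed
  also have "gen_minors_ideal (p + n - i) (n + p) (relations N n \<pi>) = gen_minors_ideal (n - i) n (relations N n \<pi>)"
    unfolding add.commute[of p n] by (rule gen_minors_ideal_diff_add[OF zero[OF \<pi>]]) (rule relations_cong)
  also have "gen_minors_ideal (p + n - i) (p + n) (relations N p \<pi>') = gen_minors_ideal (p - i) p (relations N p \<pi>')"
    by (rule gen_minors_ideal_diff_add[OF zero[OF \<pi>']]) (rule relations_cong)
  finally show ?thesis .
qed

theorem fitting_ideal_presentation:
  fixes N :: "('a::comm_ring_1, 'b) module"
  assumes N: "Module.module class_ring N" and A: "finite_free_presentation N n m A \<pi>"
  shows "fitting_ideal i N = minors_ideal (n - i) A"
  unfolding fitting_ideal_def
proof (rule the_equality)
  fix I assume "\<exists>n m A \<pi>. finite_free_presentation N n m A \<pi> \<and> I = minors_ideal (n - i) A"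
  then obtain n' m' A' \<pi>' where A': "finite_free_presentation N n' m' A' \<pi>'"
    and I: "I = minors_ideal (n' - i) A'" by blast
  show "I = minors_ideal (n - i) A"
    unfolding I minors_ideal_presentation[OF A] minors_ideal_presentation[OF A']
    using A A' by (intro equalityI gen_minors_ideal_relations_mono[OF N])
      (auto simp: finite_free_presentation_def)
qed (use A in blast)

section \<open>Convergent power series in two variables\<close>

lemma conv_ps2_eqI: "(\<And>i j. ps_coeff F i j = ps_coeff G i j) \<Longrightarrow> F = G"
  by transfer (auto simp: fps_eq_iff)

lemma ps_coeff_0 [simp]: "ps_coeff 0 i j = 0"
  by transfer simp

lemma ps_coeff_1: "ps_coeff 1 i j = (if i = 0 \<and> j = 0 then 1 else 0)"
  by transfer simp

lemma ps_coeff_add [simp]: "ps_coeff (F + G) i j = ps_coeff F i j + ps_coeff G i j"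
  by transfer simp

lemma ps_coeff_diff [simp]: "ps_coeff (F - G) i j = ps_coeff F i j - ps_coeff G i j"
  by transfer simp

lemma ps_coeff_const: "ps_coeff (ps_const c) i j = (if i = 0 \<and> j = 0 then c else 0)"
  by transfer simp

lemma ps_coeff_mult:
  "ps_coeff (F * G) i j = (\<Sum>k\<le>i. \<Sum>l\<le>j. ps_coeff F k l * ps_coeff G (i - k) (j - l))"
  by transfer (simp add: fps_mult_nth fps_sum_nth atLeast0AtMost)

lemma ps_coeff_mult_00 [simp]: "ps_coeff (F * G) 0 0 = ps_coeff F 0 0 * ps_coeff G 0 0"
  by (simp add: ps_coeff_mult)

lemma ps_coeff_power_00 [simp]: "ps_coeff (F ^ n) 0 0 = ps_coeff F 0 0 ^ n"
  by (induction n) (auto simp: ps_coeff_1)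

lemma ps_coeff_X_mult: "ps_coeff (ps_X * F) i j = (if i = 0 then 0 else ps_coeff F (i - 1) j)"
  by transfer simp

lemma ps_coeff_Y_mult: "ps_coeff (ps_Y * F) i j = (if j = 0 then 0 else ps_coeff F i (j - 1))"
  by transfer simp

lemma ps_coeff_Y_power_mult:
  "ps_coeff (ps_Y ^ k * F) i j = (if j < k then 0 else ps_coeff F i (j - k))"
proof (induction k arbitrary: j)
  case (Suc k)
  show ?case using Suc[of "j - 1"] by (cases j) (auto simp: mult.assoc ps_coeff_Y_mult)
qed simp

lemma ps_coeff_X_power_mult:
  "ps_coeff (ps_X ^ k * F) i j = (if i < k then 0 else ps_coeff F (i - k) j)"
proof (induction k arbitrary: i)
  case (Suc k)
  show ?case using Suc[of "i - 1"] by (cases i) (auto simp: mult.assoc ps_coeff_X_mult)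
qed simp

text \<open>A Cauchy estimate at one radius is equivalent to convergence, so new elements of
  \<open>conv_ps2\<close> are obtained by bounding their coefficients.\<close>

definition conv_coeffs :: "(nat \<Rightarrow> nat \<Rightarrow> complex) \<Rightarrow> bool" where
  "conv_coeffs a \<longleftrightarrow> (\<exists>C r. r > 0 \<and> (\<forall>i j. norm (a i j) * r ^ (i + j) \<le> C))"

lemma conv_coeffs_ps_coeff: "conv_coeffs (ps_coeff F)"
  unfolding conv_coeffs_def by transfer (meson fps2_convergent_bound less_imp_le order_refl)

lemma conv_ps2_of_coeffs:
  assumes "conv_coeffs a" shows "\<exists>F. \<forall>i j. ps_coeff F i j = a i j"
proof -
  obtain C r where r: "r > 0" "\<And>i j. norm (a i j) * r ^ (i + j) \<le> C"
    using assms by (auto simp: conv_coeffs_def)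
  have "fps2_convergent (Abs_fps (\<lambda>i. Abs_fps (a i)))"
    by (rule fps2_convergentI[OF r(1), of _ C]) (use r in simp)
  thus ?thesis by (intro exI[of _ "Abs_conv_ps2 (Abs_fps (\<lambda>i. Abs_fps (a i)))"])
    (simp add: ps_coeff.rep_eq Abs_conv_ps2_inverse)
qed

lemma X_dvd_iff: "ps_X dvd F \<longleftrightarrow> (\<forall>j. ps_coeff F 0 j = 0)"
proof
  assume *: "\<forall>j. ps_coeff F 0 j = 0"
  obtain C r where r: "r > 0" "\<And>i j. norm (ps_coeff F i j) * r ^ (i + j) \<le> C"
    using conv_coeffs_ps_coeff[of F] by (auto simp: conv_coeffs_def)
  have "norm (ps_coeff F (Suc i) j) * r ^ (i + j) \<le> C / r" for i j
    using r(2)[of "Suc i" j] r(1) by (simp add: field_simps)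
  hence "conv_coeffs (\<lambda>i j. ps_coeff F (Suc i) j)" using r(1) by (auto simp: conv_coeffs_def)
  then obtain G where G: "\<And>i j. ps_coeff G i j = ps_coeff F (Suc i) j"
    using conv_ps2_of_coeffs by blast
  have "F = ps_X * G" by (rule conv_ps2_eqI) (use * G in \<open>auto simp: ps_coeff_X_mult\<close>)
  thus "ps_X dvd F" by simp
qed (auto simp: dvd_def ps_coeff_X_mult)

section \<open>Units of the local ring of convergent power series\<close>

lemma sum_geometric_le:
  fixes q :: real
  assumes "0 \<le> q" "q < 1"
  shows "(\<Sum>k\<le>n. q ^ k) \<le> 1 / (1 - q)"
proof -
  have "(\<Sum>k\<le>n. q ^ k) \<le> suminf (\<lambda>k. q ^ k)"
    by (rule sum_le_suminf) (use assms in \<open>auto intro!: summable_geometric\<close>)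
  thus ?thesis using assms by (simp add: suminf_geometric)
qed

text \<open>The formal inverse always exists; only its convergence is at stake. After scaling,
  \<open>F\<close> becomes \<open>1 - H\<close> with \<open>H\<close> in the maximal ideal, and the
  coefficients \<open>b\<close> of the inverse obey the recursion \<open>rec\<close>, from which
  \<open>bound\<close> follows by induction on the total degree.\<close>

lemma conv_unit:
  assumes "ps_coeff F 0 0 \<noteq> 0"
  shows "F dvd 1"
proof -
  define H where "H = 1 - ps_const (1 / ps_coeff F 0 0) * F"
  have H00: "ps_coeff H 0 0 = 0" using assms by (simp add: H_def ps_coeff_1 ps_coeff_const)
  obtain C r where r: "r > 0" "\<And>i j. norm (ps_coeff H i j) * r ^ (i + j) \<le> C"
    using conv_coeffs_ps_coeff[of H] by (auto simp: conv_coeffs_def)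
  have C: "C \<ge> 0" using r(2)[of 0 0] H00 by simp
  text \<open>The radius is shrunk so far that the sum of the absolute values of the terms of \<open>H\<close> is at most \<open>1\<close>.\<close>
  define q where "q = 1 / (4 * (C + 1))"
  have q: "0 < q" "q \<le> 1 / 4" "C * (4 * q) \<le> 1"
    using C by (auto simp: q_def field_simps)
  define s where "s = r * q"
  have s: "s > 0" using r q by (simp add: s_def)
  define f :: "complex fps fps" where "f = 1 - fps2_of_conv H"
  define g where "g = fps_right_inverse f (inverse (fps_nth f 0))"
  have fg: "f * g = 1" unfolding g_def
    by (rule fps_right_inverse) (use H00 in \<open>simp add: f_def ps_coeff.rep_eq inverse_mult_eq_1'\<close>)
  hence g: "g = 1 + fps2_of_conv H * g" by (simp add: f_def algebra_simps)
  define h where "h = (\<lambda>i j. ps_coeff H i j)"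
  define b where "b = (\<lambda>i j. fps_nth (fps_nth g i) j)"
  have rec: "b i j = (if i = 0 \<and> j = 0 then 1 else 0) + (\<Sum>k\<le>i. \<Sum>l\<le>j. h k l * b (i - k) (j - l))" for i j
    unfolding b_def h_def ps_coeff.rep_eq
    by (subst g) (auto simp: fps_mult_nth fps_sum_nth atLeast0AtMost)
  have hb: "norm (h k l) * s ^ (k + l) \<le> C * q ^ (k + l)" for k l
    using r(2)[of k l] mult_right_mono[OF r(2)[of k l], of "q ^ (k + l)"] q
    by (simp add: h_def s_def power_mult_distrib mult.assoc)
  have bound: "norm (b i j) * s ^ (i + j) \<le> 1" for i j
  proof (induction "i + j" arbitrary: i j rule: less_induct)
    case less
    show ?case
    proof (cases "i = 0 \<and> j = 0")
      case True
      thus ?thesis using rec[of 0 0] H00 by (simp add: h_def)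
    next
      case False
      let ?a = "\<lambda>k l. norm (h k l * b (i - k) (j - l)) * s ^ (i + j)"
      have summand_le: "?a k l \<le> (if k = 0 \<and> l = 0 then 0 else C * q ^ (k + l))" if "k \<le> i" "l \<le> j" for k l
      proof (cases "k = 0 \<and> l = 0")
        case False
        have "?a k l = (norm (h k l) * s ^ (k + l)) * (norm (b (i - k) (j - l)) * s ^ ((i - k) + (j - l)))"
        proof -
          have "i + j = (k + l) + ((i - k) + (j - l))" using that by simp
          hence "s ^ (i + j) = s ^ (k + l) * s ^ ((i - k) + (j - l))" by (metis power_add)
          thus ?thesis by (simp add: norm_mult)
        qed
        also have "\<dots> \<le> (C * q ^ (k + l)) * 1"
          using False that s C q by (intro mult_mono hb less) auto
        finally show ?thesis by (simp add: False)
      qed (use H00 in \<open>simp add: h_def\<close>)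
      have "norm (b i j) * s ^ (i + j) = norm (\<Sum>k\<le>i. \<Sum>l\<le>j. h k l * b (i - k) (j - l)) * s ^ (i + j)"
        using rec[of i j] False by simp
      also have "\<dots> \<le> (\<Sum>k\<le>i. \<Sum>l\<le>j. norm (h k l * b (i - k) (j - l))) * s ^ (i + j)"
        using s by (intro mult_right_mono order_trans[OF norm_sum] sum_mono) auto
      also have "\<dots> = (\<Sum>k\<le>i. \<Sum>l\<le>j. ?a k l)" by (simp add: sum_distrib_right)
      also have "\<dots> \<le> (\<Sum>k\<le>i. \<Sum>l\<le>j. if k = 0 \<and> l = 0 then 0 else C * q ^ (k + l))"
        by (intro sum_mono summand_le) auto
      \<comment> \<open>Removing the term at \<open>(0, 0)\<close>, which \<open>H\<close> does not
        have, turns the sum into a product of two geometric sums minus 1; this is small for small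
        \<open>q\<close>.\<close>
      also have "\<dots> = (\<Sum>k\<le>i. \<Sum>l\<le>j. C * q ^ (k + l) - (if l = 0 then (if k = 0 then C else 0) else 0))"
        by (intro sum.cong) auto
      also have "\<dots> = C * ((\<Sum>k\<le>i. q ^ k) * (\<Sum>l\<le>j. q ^ l) - 1)"
      proof -
        have "(\<Sum>k\<le>i. \<Sum>l\<le>j. C * q ^ (k + l)) = C * ((\<Sum>k\<le>i. q ^ k) * (\<Sum>l\<le>j. q ^ l))"
          unfolding sum_product by (simp only: sum_distrib_left power_add)
        thus ?thesis by (simp add: sum_subtractf right_diff_distrib)
      qed
      also have "\<dots> \<le> C * (1 / (1 - q) * (1 / (1 - q)) - 1)"
        using C q by (intro mult_left_mono mult_mono sum_geometric_le diff_mono order_refl)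
                     (auto intro: sum_nonneg)
      \<comment> \<open>For \<open>q \<le> 1/4\<close> the value \<open>1 / (1 - q)\<close> is at
        most \<open>1 + 4q/3\<close>, whose square is at most \<open>1 + 4q\<close>. This is the
        origin of the factor 4 in \<open>q\<close>.\<close>
      also have "\<dots> \<le> C * (4 * q)"
      proof (intro mult_left_mono C)
        have "1 / (1 - q) \<le> 1 + 4 / 3 * q"
        proof -
          have "q * q \<le> q * (1 / 4)" using q by (intro mult_left_mono) auto
          thus ?thesis using q by (simp add: field_simps)
        qed
        hence "1 / (1 - q) * (1 / (1 - q)) \<le> (1 + 4 / 3 * q) * (1 + 4 / 3 * q)"
          using q by (intro mult_mono) auto
        also have "\<dots> = 1 + 8 / 3 * q + 16 / 9 * (q * q)" by (simp add: algebra_simps)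
        also have "q * q \<le> q * (1 / 4)" using q by (intro mult_left_mono) auto
        finally have "1 / (1 - q) * (1 / (1 - q)) \<le> 1 + 4 * q" using q by simp

        thus "1 / (1 - q) * (1 / (1 - q)) - 1 \<le> 4 * q" by simp
      qed
      also have "\<dots> \<le> 1" by (rule q)
      finally show ?thesis .
    qed
  qed
  have "conv_coeffs b" using bound s by (auto simp: conv_coeffs_def)
  then obtain G where "\<And>i j. ps_coeff G i j = b i j" using conv_ps2_of_coeffs by blast
  hence "fps2_of_conv G = g" by (auto simp: fps_eq_iff b_def ps_coeff.rep_eq)
  hence "(1 - H) * G = 1" using fg unfolding f_def by (simp add: fps2_of_conv_inject[symmetric] times_conv_ps2.rep_eq minus_conv_ps2.rep_eq one_conv_ps2.rep_eq)
  hence "F * (ps_const (1 / ps_coeff F 0 0) * G) = 1" by (simp add: H_def algebra_simps)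
  thus ?thesis by (metis dvd_triv_left)
qed

lemma conv_unit_iff: "F dvd 1 \<longleftrightarrow> ps_coeff F 0 0 \<noteq> 0"
proof
  assume "F dvd 1"
  then obtain G where "F * G = 1" by (auto simp: dvd_def)
  hence "ps_coeff F 0 0 * ps_coeff G 0 0 = 1" by (metis ps_coeff_mult_00 ps_coeff_1)
  thus "ps_coeff F 0 0 \<noteq> 0" by auto
qed (rule conv_unit)

text \<open>Modulo \<open>x\<close> the ring is the discrete valuation ring of series in
  \<open>y\<close>: \<open>k\<close> is the valuation of the residue of \<open>F\<close>,
  \<open>u\<close> the lift of the unit part without powers of \<open>x\<close>, and
  \<open>w\<close> collects the rest.\<close>

lemma conv_decomp:
  assumes "\<not> ps_X dvd F"
  shows "\<exists>k u w. u dvd 1 \<and> F = ps_Y ^ k * u + ps_X * w"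
proof -
  define k where "k = (LEAST j. ps_coeff F 0 j \<noteq> 0)"
  have k: "ps_coeff F 0 k \<noteq> 0" "\<And>j. j < k \<Longrightarrow> ps_coeff F 0 j = 0"
  proof -
    obtain j where "ps_coeff F 0 j \<noteq> 0" using assms unfolding X_dvd_iff by blast
    thus "ps_coeff F 0 k \<noteq> 0" unfolding k_def by (rule LeastI)
    show "ps_coeff F 0 j = 0" if "j < k" for j using not_less_Least[of j] that unfolding k_def by blast
  qed
  obtain C r where r: "r > 0" "\<And>i j. norm (ps_coeff F i j) * r ^ (i + j) \<le> C"
    using conv_coeffs_ps_coeff[of F] by (auto simp: conv_coeffs_def)
  have "norm (if i = 0 then ps_coeff F 0 (j + k) else 0) * r ^ (i + j) \<le> max 0 (C / r ^ k)" for i j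
  proof (cases "i = 0")
    case True
    thus ?thesis using r(2)[of 0 "j + k"] r(1)
      by (simp add: le_max_iff_disj pos_le_divide_eq power_add mult.assoc)
  qed simp
  hence "conv_coeffs (\<lambda>i j. if i = 0 then ps_coeff F 0 (j + k) else 0)"
    using r(1) unfolding conv_coeffs_def by blast
  then obtain u where u: "\<And>i j. ps_coeff u i j = (if i = 0 then ps_coeff F 0 (j + k) else 0)"
    using conv_ps2_of_coeffs by blast
  have "ps_X dvd F - ps_Y ^ k * u"
    unfolding X_dvd_iff using k(2) by (auto simp: ps_coeff_Y_power_mult u)
  then obtain w where "F - ps_Y ^ k * u = ps_X * w" by (auto simp: dvd_def)
  moreover have "u dvd 1" using k(1) u[of 0 0] by (intro conv_unit) simp
  ultimately show ?thesis by (metis add.commute diff_add_cancel)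
qed

section \<open>Primality of \<open>x\<close>, and coprimality of powers of \<open>x\<close> and
  \<open>y\<close>\<close>

lemma Y_power_not_X_dvd: "\<not> ps_X dvd ps_Y ^ k"
  unfolding X_dvd_iff using ps_coeff_Y_power_mult[of k 1 0 k] by (auto simp: ps_coeff_1 intro!: exI[of _ k])

lemma ps_X_nonzero [simp]: "ps_X \<noteq> 0"
proof
  assume "ps_X = 0"
  with ps_coeff_X_mult[of 1 1 0] show False by (simp add: ps_coeff_1)
qed

lemma X_dvd_mult_iff: "ps_X dvd F * G \<longleftrightarrow> ps_X dvd F \<or> ps_X dvd G"
proof
  assume *: "ps_X dvd F * G"
  show "ps_X dvd F \<or> ps_X dvd G"
  proof (rule ccontr)
    assume "\<not> ?thesis"
    hence nd: "\<not> ps_X dvd F" "\<not> ps_X dvd G" by auto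
    obtain k u w where F: "u dvd 1" "F = ps_Y ^ k * u + ps_X * w" using conv_decomp[OF nd(1)] by blast
    obtain l v w' where G: "v dvd 1" "G = ps_Y ^ l * v + ps_X * w'" using conv_decomp[OF nd(2)] by blast
    have "F * G = ps_Y ^ (k + l) * (u * v) + ps_X * (w * (ps_Y ^ l * v + ps_X * w') + ps_Y ^ k * u * w')"
      unfolding F(2) G(2) power_add by (simp add: algebra_simps)
    hence "ps_coeff (F * G) 0 (k + l) = ps_coeff (ps_Y ^ (k + l) * (u * v)) 0 (k + l)"
      by (simp only: ps_coeff_add ps_coeff_X_mult) simp
    also have "\<dots> = ps_coeff u 0 0 * ps_coeff v 0 0" by (simp add: ps_coeff_Y_power_mult)
    finally show False using * F(1) G(1) by (simp add: X_dvd_iff conv_unit_iff)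
  qed
qed auto

text \<open>The \<open>x\<close>-adic topology is separated; this ends the descent that proves
  linear independence of the basis syzygies.\<close>

lemma X_power_dvd_all: "(\<And>n. ps_X ^ n dvd F) \<Longrightarrow> F = 0"
proof (rule conv_ps2_eqI)
  fix i j assume *: "\<And>n. ps_X ^ n dvd F"
  obtain G where "F = ps_X ^ Suc i * G" using *[of "Suc i"] by (auto simp: dvd_def)
  thus "ps_coeff F i j = ps_coeff 0 i j" by (simp only: ps_coeff_X_power_mult) simp
qed

lemma ps_coeff_X_Y_00 [simp]: "ps_coeff ps_X 0 0 = 0" "ps_coeff ps_Y 0 0 = 0"
  by (transfer, simp)+

lemma max_ideal_iff: "ps_coeff F 0 0 = 0 \<longleftrightarrow> (\<exists>a b. F = a * ps_X + b * ps_Y)"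
proof
  assume F: "ps_coeff F 0 0 = 0"
  show "\<exists>a b. F = a * ps_X + b * ps_Y"
  proof (cases "ps_X dvd F")
    case True
    then obtain a where "F = ps_X * a" by (rule dvdE)
    hence "F = a * ps_X + 0 * ps_Y" by (simp only: mult.commute[of a] mult_zero_left add_0_right)
    thus ?thesis by blast
  next
    case False
    then obtain k u w where u: "u dvd 1" and eq: "F = ps_Y ^ k * u + ps_X * w" using conv_decomp by blast
    have "k \<noteq> 0" using F u by (auto simp: eq ps_coeff_X_mult conv_unit_iff)
    then obtain k' where "k = Suc k'" by (cases k) auto
    hence "F = w * ps_X + (ps_Y ^ k' * u) * ps_Y" by (simp add: eq algebra_simps)
    thus ?thesis by blast
  qed
next
  assume "\<exists>a b. F = a * ps_X + b * ps_Y"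
  thus "ps_coeff F 0 0 = 0"
    by auto
qed

text \<open>The prime \<open>x\<close> does not divide \<open>t\<close>, because it does not divide
  \<open>y^m\<close>. So the factors \<open>x\<close> can be cancelled from \<open>x^n = t q\<close>
  one at a time, until \<open>t\<close> divides 1. No unique factorisation is involved.\<close>

lemma unit_dvd_X_Y_powers:
  assumes "t dvd ps_X ^ n" "t dvd ps_Y ^ m"
  shows "t dvd 1"
proof -
  have nd: "\<not> ps_X dvd t" using assms(2) Y_power_not_X_dvd dvd_trans by blast
  show ?thesis using assms(1)
  proof (induction n)
    case (Suc n)
    obtain q where q: "ps_X ^ Suc n = t * q" using Suc.prems by (rule dvdE)
    hence "ps_X dvd t * q" by (metis dvd_triv_left power_Suc)
    with nd have "ps_X dvd q" unfolding X_dvd_mult_iff by blast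
    then obtain q' where "q = ps_X * q'" by (rule dvdE)
    with q have "ps_X * ps_X ^ n = ps_X * (t * q')" by (simp only: power_Suc mult.left_commute[of t ps_X])
    hence "ps_X ^ n = t * q'" by (simp only: mult_cancel_left ps_X_nonzero) simp
    thus ?case using Suc.IH by simp
  qed simp
qed

lemma X_power_dvd_Y_power_mult:
  "ps_X ^ n dvd ps_Y ^ m * F \<Longrightarrow> ps_X ^ n dvd F"
proof (induction n arbitrary: F)
  case (Suc n)
  have "ps_X dvd ps_X ^ Suc n" by (metis dvd_triv_left power_Suc)
  hence "ps_X dvd ps_Y ^ m * F" using Suc.prems dvd_trans by blast
  hence "ps_X dvd F" using Y_power_not_X_dvd X_dvd_mult_iff by blast
  then obtain G where G: "F = ps_X * G" by (rule dvdE)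
  obtain H where "ps_Y ^ m * F = ps_X ^ Suc n * H" using Suc.prems by (rule dvdE)
  hence "ps_X * (ps_Y ^ m * G) = ps_X * (ps_X ^ n * H)"
    unfolding G power_Suc by (metis mult.assoc mult.commute)
  hence "ps_Y ^ m * G = ps_X ^ n * H" by (metis mult_left_cancel ps_X_nonzero)
  hence "ps_X ^ n dvd G" using Suc.IH by (metis dvd_triv_left)
  thus ?case unfolding G power_Suc by (rule mult_dvd_mono[OF dvd_refl])
qed simp

text \<open>Multiplying the relation by the two combinations gives
  \<open>x^n (a, b) = s (-q, p)\<close> and \<open>y^m (a, b) = s' (-q, p)\<close>. Comparison
  yields \<open>y^m s = x^n s'\<close>, hence \<open>x^n\<close> divides \<open>s\<close> and can be
  cancelled. The lemma serves both the partial derivatives and the two generators of the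
  annihilator.\<close>

lemma koszul_exact:
  assumes x: "ps_X ^ n = \<alpha> * p + \<beta> * q" and y: "ps_Y ^ m = \<gamma> * p + \<delta> * q"
    and rel: "a * p + b * q = 0"
  shows "\<exists>s. a = s * q \<and> b = - s * p"
proof -
  define s where "s = \<beta> * -a + \<alpha> * b"
  define s' where "s' = \<delta> * -a + \<gamma> * b"
  have 1: "ps_X ^ n * a = - s * q" "ps_X ^ n * b = s * p"
  proof -
    have ap: "a * p = - (b * q)" using rel by (simp add: eq_neg_iff_add_eq_0)
    have "ps_X ^ n * a = \<alpha> * (a * p) + \<beta> * q * a" "ps_X ^ n * b = \<alpha> * p * b + \<beta> * (b * q)"
      unfolding x by (simp_all add: algebra_simps)
    thus "ps_X ^ n * a = - s * q" "ps_X ^ n * b = s * p"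
      using ap unfolding s_def by (simp_all add: algebra_simps)
  qed
  have 2: "ps_Y ^ m * a = - s' * q" "ps_Y ^ m * b = s' * p"
  proof -
    have ap: "a * p = - (b * q)" using rel by (simp add: eq_neg_iff_add_eq_0)
    have "ps_Y ^ m * a = \<gamma> * (a * p) + \<delta> * q * a" "ps_Y ^ m * b = \<gamma> * p * b + \<delta> * (b * q)"
      unfolding y by (simp_all add: algebra_simps)
    thus "ps_Y ^ m * a = - s' * q" "ps_Y ^ m * b = s' * p"
      using ap unfolding s'_def by (simp_all add: algebra_simps)
  qed
  have eq: "ps_Y ^ m * s * p = ps_X ^ n * s' * p" "ps_Y ^ m * s * q = ps_X ^ n * s' * q"
  proof -
    have "ps_Y ^ m * (s * p) = ps_X ^ n * (s' * p)"
      unfolding 1(2)[symmetric] 2(2)[symmetric] by (rule mult.left_commute)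
    thus "ps_Y ^ m * s * p = ps_X ^ n * s' * p" by (simp only: mult.assoc)
    have "ps_Y ^ m * (- s * q) = ps_X ^ n * (- s' * q)"
      unfolding 1(1)[symmetric] 2(1)[symmetric] by (rule mult.left_commute)
    thus "ps_Y ^ m * s * q = ps_X ^ n * s' * q" by (simp add: mult.assoc)
  qed
  have "p \<noteq> 0 \<or> q \<noteq> 0" using x by auto
  hence "ps_Y ^ m * s = ps_X ^ n * s'" using eq by auto
  then obtain \<sigma> where \<sigma>: "s = ps_X ^ n * \<sigma>"
    using X_power_dvd_Y_power_mult[of n m s] by (auto simp: dvd_def)
  have "ps_X ^ n * a = ps_X ^ n * (- \<sigma> * q)" "ps_X ^ n * b = ps_X ^ n * (\<sigma> * p)"
    using 1 by (auto simp: \<sigma> algebra_simps)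
  hence "a = - \<sigma> * q" "b = \<sigma> * p" by (simp_all only: mult_cancel_left) auto
  thus ?thesis by (intro exI[of _ "- \<sigma>"]) simp
qed

section \<open>Syzygies of three power series\<close>

text \<open>A relative Nakayama lemma: members of \<open>W\<close> are eliminated one at a time. The
  hypothesis \<open>unit\<close> says that \<open>x\<close> lies in the Jacobson radical, so a
  generator that occurs in its own expression with coefficient \<open>x d\<close> can be solved
  for.\<close>

lemma (in Modules.module) nakayama:
  assumes "finite W" and unit: "\<And>d. (1 - x * d) dvd 1"
    and "\<And>w. w \<in> W \<Longrightarrow> \<exists>s\<in>span L. \<exists>m\<in>span (L \<union> W). w = s + scale x m"
  shows "span (L \<union> W) = span L"
  using assms(1,3)
proof (induction W rule: finite_induct)
  case (insert w W)
  obtain s m where sm: "s \<in> span L" "m \<in> span (insert w (L \<union> W))" "w = s + scale x m"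
    using insert.prems[of w] by auto
  obtain d where d: "m - scale d w \<in> span (L \<union> W)" using sm(2) by (auto simp: span_insert)
  obtain e where e: "(1 - x * d) * e = 1" using unit[of d] by (auto simp: dvd_def)
  have "s \<in> span (L \<union> W)" using sm(1) span_mono[of L "L \<union> W"] by auto
  hence "s + scale x (m - scale d w) \<in> span (L \<union> W)" using d by (intro span_add span_scale)
  also have "s + scale x (m - scale d w) = scale (1 - x * d) w"
    using sm(3) by (simp add: algebra_simps)
  finally have "scale e (scale (1 - x * d) w) \<in> span (L \<union> W)" by (rule span_scale)
  hence w: "w \<in> span (L \<union> W)" using e by (simp add: mult.commute)
  hence eq: "span (insert w (L \<union> W)) = span (L \<union> W)"
  proof -
    have "insert w (L \<union> W) \<subseteq> span (L \<union> W)" using w span_superset[of "L \<union> W"] by auto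
    moreover have "L \<union> W \<subseteq> span (insert w (L \<union> W))" using span_superset[of "insert w (L \<union> W)"] by auto
    ultimately show ?thesis unfolding span_eq by blast
  qed
  \<comment> \<open>With \<open>w\<close> redundant the larger span is unchanged, so the hypothesis
    on the remaining members of \<open>W\<close> survives.\<close>
  have "span (L \<union> W) = span L"
    by (rule insert.IH) (use insert.prems in \<open>auto simp: eq\<close>)
  thus ?case using eq by simp
qed simp

text \<open>Modulo \<open>x\<close> the elements of \<open>S\<close> lie in a discrete valuation
  ring, where an element of least order \<open>k\<close> divides all others.\<close>

lemma min_order_element:
  assumes "\<exists>h\<in>S. \<not> ps_X dvd h"
  shows "\<exists>h0\<in>S. \<not> ps_X dvd h0 \<and> (\<forall>h\<in>S. \<exists>s. ps_X dvd h - s * h0)"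
proof -
  define P where "P = (\<lambda>k. \<exists>h\<in>S. \<exists>u w. u dvd 1 \<and> h = ps_Y ^ k * u + ps_X * w)"
  define k where "k = (LEAST k. P k)"
  obtain h where "h \<in> S" "\<not> ps_X dvd h" using assms by blast
  hence "\<exists>k. P k" unfolding P_def using conv_decomp[of h] by (metis (no_types))
  hence "P k" unfolding k_def by (rule LeastI_ex)
  then obtain h0 u w where h0: "h0 \<in> S" "u dvd 1" "h0 = ps_Y ^ k * u + ps_X * w"
    unfolding P_def by (elim bexE exE conjE)
  obtain v where v: "u * v = 1" using h0(2) by (auto simp: dvd_def)
  have "\<not> ps_X dvd u"
    using h0(2) unfolding X_dvd_iff conv_unit_iff by blast
  hence nd: "\<not> ps_X dvd h0"
  proof -
    have "\<not> ps_X dvd ps_Y ^ k * u" using \<open>\<not> ps_X dvd u\<close> Y_power_not_X_dvd X_dvd_mult_iff by blast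
    thus ?thesis unfolding h0(3) by (subst dvd_add_left_iff) simp_all
  qed
  have "\<exists>s. ps_X dvd h - s * h0" if "h \<in> S" for h
  proof (cases "ps_X dvd h")
    case True thus ?thesis by (intro exI[of _ 0]) simp
  next
    case False
    then obtain k' u' w' where h: "u' dvd 1" "h = ps_Y ^ k' * u' + ps_X * w'"
      using conv_decomp[OF False] by (elim exE conjE)
    hence "P k'" unfolding P_def by (intro bexI[OF _ that] exI conjI)
    hence "k \<le> k'" unfolding k_def by (rule Least_le)
    \<comment> \<open>The quotient of the residues of \<open>h\<close> and \<open>h0\<close>;
      \<open>v\<close> is the inverse of \<open>u\<close>.\<close>
    define s where "s = ps_Y ^ (k' - k) * u' * v"
    have "s * (ps_Y ^ k * u) = (ps_Y ^ (k' - k) * ps_Y ^ k) * u' * (u * v)"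
      unfolding s_def by (simp only: mult_ac)
    also have "\<dots> = ps_Y ^ k' * u'" using \<open>k \<le> k'\<close> by (simp add: v flip: power_add)
    finally have "s * h0 = ps_Y ^ k' * u' + ps_X * (s * w)"
      unfolding h0(3) distrib_left by (simp only: mult_ac)
    hence "h - s * h0 = ps_X * (w' - s * w)"
      unfolding h(2) by (simp add: right_diff_distrib)
    thus ?thesis by (metis dvd_triv_left)
  qed
  with h0(1) nd show ?thesis by blast
qed

text \<open>Triples rather than vectors of length three, because their addition is total on the
  type, as \<open>Modules.module\<close> and its \<open>span\<close> require. The translation to
  \<open>vec\<close> takes place in \<open>exists_syz_basis\<close>.\<close>

definition scale3 :: "conv_ps2 \<Rightarrow> conv_ps2 \<times> conv_ps2 \<times> conv_ps2 \<Rightarrow> conv_ps2 \<times> conv_ps2 \<times> conv_ps2" where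
  "scale3 r v = (r * fst v, r * fst (snd v), r * snd (snd v))"

lemma scale3_Pair [simp]: "scale3 r (a, b, c) = (r * a, r * b, r * c)"
  by (simp add: scale3_def)

interpretation triples: Modules.module scale3
  by unfold_locales (auto simp: scale3_def plus_prod_def algebra_simps)

lemma scale3_X_eq_0: "scale3 ps_X v = 0 \<Longrightarrow> v = 0"
  by (cases v) (simp add: zero_prod_def)

section \<open>The module of syzygies of a triple\<close>

definition syz3 :: "conv_ps2 \<Rightarrow> conv_ps2 \<Rightarrow> conv_ps2 \<Rightarrow> (conv_ps2 \<times> conv_ps2 \<times> conv_ps2) set" where
  "syz3 p q r = {(a, b, c). a * p + b * q + c * r = 0}"

lemma syz3_iff: "(a, b, c) \<in> syz3 p q r \<longleftrightarrow> a * p + b * q + c * r = 0"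
  by (simp add: syz3_def)

lemma syz3_diff_scale:
  assumes "v \<in> syz3 p q r" "w \<in> syz3 p q r" shows "v - scale3 s w \<in> syz3 p q r"
proof -
  obtain a b c a' b' c' where [simp]: "v = (a, b, c)" "w = (a', b', c')" by (metis prod_cases3)
  have "(a - s * a') * p + (b - s * b') * q + (c - s * c') * r =
      (a * p + b * q + c * r) - s * (a' * p + b' * q + c' * r)" by (simp add: algebra_simps)
  thus ?thesis using assms by (simp add: syz3_iff)
qed

text \<open>This cancellation allows the reduction modulo \<open>x\<close> to be iterated: a syzygy
  with all entries divisible by \<open>x\<close> is \<open>x\<close> times a syzygy.\<close>

lemma syz3_saturated:
  assumes "scale3 ps_X v \<in> syz3 p q r" shows "v \<in> syz3 p q r"
proof -
  obtain a b c where [simp]: "v = (a, b, c)" by (metis prod_cases3)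
  have "ps_X * (a * p + b * q + c * r) = 0"
    using assms by (simp add: syz3_iff algebra_simps)
  thus ?thesis by (simp add: syz3_iff)
qed

lemma subspace_syz3: "triples.subspace (syz3 p q r)"
proof -
  have "0 \<in> syz3 p q r" by (simp add: syz3_def zero_prod_def)
  moreover have "v + w \<in> syz3 p q r" if "v \<in> syz3 p q r" "w \<in> syz3 p q r" for v w
    using syz3_diff_scale[OF that, of "-1"] by simp
  moreover have "scale3 s v \<in> syz3 p q r" if "v \<in> syz3 p q r" for s v
    using syz3_diff_scale[OF \<open>0 \<in> syz3 p q r\<close> that, of "- s"] by simp
  ultimately show ?thesis unfolding triples.subspace_def by blast
qed

text \<open>As \<open>x\<close> does not divide \<open>p\<close>, the first entry of a syzygy is
  determined modulo \<open>x\<close> by the other two, so modulo \<open>x\<close> only pairs of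
  series in \<open>y\<close> matter. The basis is triangular there: \<open>\<rho>1\<close> has a
  second entry of least order, and \<open>\<rho>2\<close> a third entry of least order among the
  syzygies whose second entry vanishes modulo \<open>x\<close>.\<close>

lemma syz3_basis_of_not_X_dvd:
  assumes x: "ps_X ^ n = \<alpha> * p + \<beta> * q" and y: "ps_Y ^ m = \<gamma> * p + \<delta> * q"
    and nd: "\<not> ps_X dvd p"
  shows "\<exists>\<rho>1 \<rho>2. \<rho>1 \<in> syz3 p q r \<and> \<rho>2 \<in> syz3 p q r \<and>
    (\<forall>v\<in>syz3 p q r. \<exists>s t. v = scale3 s \<rho>1 + scale3 t \<rho>2) \<and>
    (\<forall>s t. scale3 s \<rho>1 + scale3 t \<rho>2 = 0 \<longrightarrow> s = 0 \<and> t = 0)"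
proof -
  let ?M = "syz3 p q r"
  \<comment> \<open>The Koszul syzygies. The entry \<open>- p\<close> in second place of
    \<open>k1\<close> and in third place of \<open>k2\<close>, whose second entry is 0, ensures that
    both minima are taken over sets not contained in \<open>(x)\<close>.\<close>
  define k1 where "k1 = (q, - p, 0 :: conv_ps2)"
  define k2 where "k2 = (r, 0 :: conv_ps2, - p)"
  define k3 where "k3 = (0 :: conv_ps2, r, - q)"
  have k: "k1 \<in> ?M" "k2 \<in> ?M" "k3 \<in> ?M"
    by (simp_all add: k1_def k2_def k3_def syz3_iff algebra_simps)
  have "\<exists>h\<in>(\<lambda>v. fst (snd v)) ` ?M. \<not> ps_X dvd h"
    using k(1) nd by (intro bexI[of _ "- p"]) (auto simp: k1_def image_iff intro!: bexI[of _ k1])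
  from min_order_element[OF this] obtain a1 b1 c1
    where \<rho>1: "(a1, b1, c1) \<in> ?M" "\<not> ps_X dvd b1"
      "\<And>a b c. (a, b, c) \<in> ?M \<Longrightarrow> \<exists>s. ps_X dvd b - s * b1" by fastforce
  define M' where "M' = {v \<in> ?M. ps_X dvd fst (snd v)}"
  have "\<exists>h\<in>(\<lambda>v. snd (snd v)) ` M'. \<not> ps_X dvd h"
    using k(2) nd by (intro bexI[of _ "- p"]) (auto simp: k2_def M'_def image_iff intro!: bexI[of _ k2])
  from min_order_element[OF this] obtain a2 b2 c2
    where \<rho>2: "(a2, b2, c2) \<in> ?M" "ps_X dvd b2" "\<not> ps_X dvd c2"
      "\<And>a b c. (a, b, c) \<in> ?M \<Longrightarrow> ps_X dvd b \<Longrightarrow> \<exists>s. ps_X dvd c - s * c2"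
    unfolding M'_def by fastforce
  define \<rho>1 where "\<rho>1 = (a1, b1, c1)"
  define \<rho>2 where "\<rho>2 = (a2, b2, c2)"
  define L where "L = triples.span {\<rho>1, \<rho>2}"
  have LM: "L \<subseteq> ?M" unfolding L_def
    by (rule triples.span_minimal[OF _ subspace_syz3]) (use \<rho>1 \<rho>2 in \<open>auto simp: \<rho>1_def \<rho>2_def\<close>)
  have step: "\<exists>l\<in>L. \<exists>v'\<in>?M. v = l + scale3 ps_X v'" if v: "v \<in> ?M" for v
  proof -
    obtain a b c where v_eq: "v = (a, b, c)" by (metis prod_cases3)
    obtain s where s: "ps_X dvd b - s * b1" using \<rho>1(3) v v_eq by blast
    define v1 where "v1 = v - scale3 s \<rho>1"
    have v1: "v1 \<in> ?M" unfolding v1_def \<rho>1_def by (rule syz3_diff_scale[OF v \<rho>1(1)])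
    have v1_eq: "v1 = (a - s * a1, b - s * b1, c - s * c1)" by (simp add: v1_def v_eq \<rho>1_def)
    obtain t where t: "ps_X dvd (c - s * c1) - t * c2" using \<rho>2(4) v1 v1_eq s by blast
    define v2 where "v2 = v1 - scale3 t \<rho>2"
    have v2: "v2 \<in> ?M" unfolding v2_def \<rho>2_def by (rule syz3_diff_scale[OF v1 \<rho>2(1)])
    obtain a' b' c' where v2_eq: "v2 = (a', b', c')" by (metis prod_cases3)
    have b': "ps_X dvd b'" and c': "ps_X dvd c'"
      using v2_eq s t \<rho>2(2) by (auto simp: v2_def v1_eq \<rho>2_def)
    have "a' * p = - (b' * q + c' * r)"
      using v2 v2_eq by (simp only: syz3_iff eq_neg_iff_add_eq_0 add.assoc)
    moreover have "ps_X dvd b' * q + c' * r" using b' c' by simp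
    ultimately have "ps_X dvd a' * p" by (simp only: dvd_minus_iff)
    hence "ps_X dvd a'" using nd X_dvd_mult_iff by blast
    then obtain a'' b'' c'' where "a' = ps_X * a''" "b' = ps_X * b''" "c' = ps_X * c''"
      using b' c' by (meson dvdE)
    hence v2_X: "v2 = scale3 ps_X (a'', b'', c'')" using v2_eq by simp
    have "v = (scale3 s \<rho>1 + scale3 t \<rho>2) + scale3 ps_X (a'', b'', c'')"
      unfolding v2_X[symmetric] v2_def v1_def by simp
    moreover have "scale3 s \<rho>1 + scale3 t \<rho>2 \<in> L"
      unfolding L_def by (intro triples.span_add triples.span_scale triples.span_base) auto
    moreover have "(a'', b'', c'') \<in> ?M" using v2 v2_X syz3_saturated by metis
    ultimately show ?thesis by blast
  qed
  have steps: "\<exists>l\<in>L. \<exists>v'\<in>?M. v = l + scale3 (ps_X ^ i) v'" if "v \<in> ?M" for v i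
  proof (induction i)
    case 0
    have "0 \<in> L" unfolding L_def by (rule triples.span_zero)
    thus ?case using that by (intro bexI[of _ 0] bexI[of _ v]) auto
  next
    case (Suc i)
    then obtain l v' where l: "l \<in> L" "v' \<in> ?M" "v = l + scale3 (ps_X ^ i) v'" by blast
    obtain l' v'' where l': "l' \<in> L" "v'' \<in> ?M" "v' = l' + scale3 ps_X v''" using step[OF l(2)] by blast
    have "v = (l + scale3 (ps_X ^ i) l') + scale3 (ps_X ^ Suc i) v''"
      unfolding l(3) l'(3) by (simp add: triples.scale_right_distrib mult.commute)
    moreover have "l + scale3 (ps_X ^ i) l' \<in> L"
      using l(1) l'(1) unfolding L_def by (intro triples.span_add triples.span_scale)
    ultimately show ?case using l'(2) by blast
  qed
  let ?W = "{k1, k2, k3}"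
  have span_W: "scale3 (ps_X ^ n) v \<in> triples.span ?W" if v: "v \<in> ?M" for v
  proof -
    obtain a b c where v_eq: "v = (a, b, c)" by (metis prod_cases3)
    \<comment> \<open>Since \<open>x^n\<close> is \<open>\<alpha> p + \<beta> q\<close>, the added
      multiples cancel the third entry; what is left is a syzygy of \<open>p\<close> and
      \<open>q\<close> alone, hence a multiple of \<open>k1\<close>.\<close>
    define v1 where "v1 = scale3 (ps_X ^ n) v + scale3 (c * \<alpha>) k2 + scale3 (c * \<beta>) k3"
    have "v1 \<in> ?M" unfolding v1_def
      using subspace_syz3 v k by (meson triples.subspace_add triples.subspace_scale)
    moreover have "snd (snd v1) = 0"
      by (simp add: v1_def v_eq k2_def k3_def x algebra_simps)
    moreover obtain a' b' c' where v1_eq: "v1 = (a', b', c')" by (metis prod_cases3)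
    ultimately have "a' * p + b' * q = 0" and [simp]: "c' = 0" by (auto simp: syz3_iff)
    then obtain s where "a' = s * q" "b' = - s * p" using koszul_exact[OF x y] by blast
    hence "v1 = scale3 s k1" by (simp add: v1_eq k1_def)
    hence "scale3 (ps_X ^ n) v = scale3 s k1 - scale3 (c * \<alpha>) k2 - scale3 (c * \<beta>) k3"
      unfolding v1_def by (simp add: algebra_simps)
    also have "\<dots> \<in> triples.span ?W"
      by (intro triples.span_diff triples.span_scale triples.span_base) auto
    finally show ?thesis .
  qed
  have M_span: "?M \<subseteq> triples.span ({\<rho>1, \<rho>2} \<union> ?W)"
  proof
    fix v assume "v \<in> ?M"
    then obtain l v' where l: "l \<in> L" "v' \<in> ?M" "v = l + scale3 (ps_X ^ n) v'" using steps by blast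
    have "l \<in> triples.span ({\<rho>1, \<rho>2} \<union> ?W)" "scale3 (ps_X ^ n) v' \<in> triples.span ({\<rho>1, \<rho>2} \<union> ?W)"
      using l(1) span_W[OF l(2)] triples.span_mono[of "{\<rho>1, \<rho>2}" "{\<rho>1, \<rho>2} \<union> ?W"]
        triples.span_mono[of ?W "{\<rho>1, \<rho>2} \<union> ?W"] unfolding L_def by blast+
    thus "v \<in> triples.span ({\<rho>1, \<rho>2} \<union> ?W)" unfolding l(3) by (rule triples.span_add)
  qed
  \<comment> \<open>By \<open>step\<close> each Koszul syzygy is an element of \<open>L\<close> plus
    \<open>x\<close> times a syzygy, and that syzygy lies in the larger span by
    \<open>M_span\<close>.\<close>
  have "triples.span ({\<rho>1, \<rho>2} \<union> ?W) = triples.span {\<rho>1, \<rho>2}"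
  proof (rule triples.nakayama)
    show "(1 - ps_X * d) dvd 1" for d by (simp add: conv_unit_iff ps_coeff_1)
    fix w assume "w \<in> ?W"
    hence "w \<in> ?M" using k by auto
    thus "\<exists>s\<in>triples.span {\<rho>1, \<rho>2}. \<exists>m\<in>triples.span ({\<rho>1, \<rho>2} \<union> ?W). w = s + scale3 ps_X m"
      using step M_span unfolding L_def by blast
  qed simp
  hence gen: "?M \<subseteq> L" using M_span unfolding L_def by simp
  have gen': "\<exists>s t. v = scale3 s \<rho>1 + scale3 t \<rho>2" if "v \<in> ?M" for v
  proof -
    have "v \<in> L" using gen that by blast
    then obtain s where "v - scale3 s \<rho>1 \<in> triples.span {\<rho>2}"
      by (auto simp: L_def triples.span_insert[of \<rho>1])
    then obtain t where "v - scale3 s \<rho>1 = scale3 t \<rho>2" by (auto simp: triples.span_singleton)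
    thus ?thesis by (metis add.commute diff_add_cancel)
  qed
  \<comment> \<open>Modulo \<open>x\<close> the relation is triangular, since \<open>x\<close>
    divides \<open>b2\<close> but neither \<open>b1\<close> nor \<open>c2\<close>. So
    \<open>x\<close> divides \<open>s\<close>, then \<open>t\<close>, and the relation may be
    divided by \<open>x\<close>.\<close>
  have dvd: "ps_X ^ i dvd s \<and> ps_X ^ i dvd t" if "scale3 s \<rho>1 + scale3 t \<rho>2 = 0" for s t i
    using that
  proof (induction i arbitrary: s t)
    case (Suc i)
    have eqs: "s * b1 + t * b2 = 0" "s * c1 + t * c2 = 0"
      using Suc.prems by (auto simp: \<rho>1_def \<rho>2_def zero_prod_def)
    have "s * b1 = - (t * b2)" using eqs(1) by (simp only: eq_neg_iff_add_eq_0)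
    hence "ps_X dvd s * b1" using \<rho>2(2) by simp
    hence s: "ps_X dvd s" using \<rho>1(2) X_dvd_mult_iff by blast
    have "t * c2 = - (s * c1)" using eqs(2) by (simp only: add_eq_0_iff)
    hence "ps_X dvd t * c2" using s by simp
    hence "ps_X dvd t" using \<rho>2(3) X_dvd_mult_iff by blast
    then obtain s' t' where st: "s = ps_X * s'" "t = ps_X * t'" using s by (meson dvdE)
    have "scale3 ps_X (scale3 s' \<rho>1 + scale3 t' \<rho>2) = 0"
      using Suc.prems by (simp add: st triples.scale_right_distrib)
    hence "scale3 s' \<rho>1 + scale3 t' \<rho>2 = 0" by (rule scale3_X_eq_0)
    from Suc.IH[OF this] show ?case by (simp add: st)
  qed simp
  have "s = 0" "t = 0" if "scale3 s \<rho>1 + scale3 t \<rho>2 = 0" for s t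
    using dvd[OF that] by (auto intro: X_power_dvd_all)
  with gen' \<rho>1(1) \<rho>2(1) show ?thesis unfolding \<rho>1_def[symmetric] \<rho>2_def[symmetric] by metis
qed

text \<open>Not both \<open>p\<close> and \<open>q\<close> are divisible by \<open>x\<close>, since
  \<open>y^m\<close> is not. If \<open>p\<close> is, the two exchange roles, and
  \<open>\<sigma>\<close> swaps the first two entries of the syzygies.\<close>

lemma syz3_basis:
  assumes x: "ps_X ^ n = \<alpha> * p + \<beta> * q" and y: "ps_Y ^ m = \<gamma> * p + \<delta> * q"
  shows "\<exists>\<rho>1 \<rho>2. \<rho>1 \<in> syz3 p q r \<and> \<rho>2 \<in> syz3 p q r \<and>
    (\<forall>v\<in>syz3 p q r. \<exists>s t. v = scale3 s \<rho>1 + scale3 t \<rho>2) \<and>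
    (\<forall>s t. scale3 s \<rho>1 + scale3 t \<rho>2 = 0 \<longrightarrow> s = 0 \<and> t = 0)"
proof (cases "ps_X dvd p")
  case False
  thus ?thesis by (rule syz3_basis_of_not_X_dvd[OF x y])
next
  case True
  have "\<not> ps_X dvd q"
  proof
    assume "ps_X dvd q"
    with True have "ps_X dvd ps_Y ^ m" unfolding y by simp
    thus False using Y_power_not_X_dvd by blast
  qed
  from syz3_basis_of_not_X_dvd[OF x[unfolded add.commute[of "\<alpha> * p"]] y[unfolded add.commute[of "\<gamma> * p"]] this]
  obtain \<rho>1 \<rho>2 where \<rho>: "\<rho>1 \<in> syz3 q p r" "\<rho>2 \<in> syz3 q p r"
    "\<And>v. v \<in> syz3 q p r \<Longrightarrow> \<exists>s t. v = scale3 s \<rho>1 + scale3 t \<rho>2"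
    "\<And>s t. scale3 s \<rho>1 + scale3 t \<rho>2 = 0 \<Longrightarrow> s = 0 \<and> t = 0" by metis
  define \<sigma> where "\<sigma> = (\<lambda>(a, b, c). (b, a, c) :: conv_ps2 \<times> conv_ps2 \<times> conv_ps2)"
  have \<sigma>_mem: "\<sigma> v \<in> syz3 p q r \<longleftrightarrow> v \<in> syz3 q p r" "\<sigma> v \<in> syz3 q p r \<longleftrightarrow> v \<in> syz3 p q r" for v
    by (cases v; simp add: \<sigma>_def syz3_iff add_ac)+
  have \<sigma>_\<sigma>: "\<sigma> (\<sigma> v) = v" for v by (simp add: \<sigma>_def split: prod.splits)
  have \<sigma>_lin: "\<sigma> (scale3 s v + scale3 t w) = scale3 s (\<sigma> v) + scale3 t (\<sigma> w)" for s t v w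
    by (simp add: \<sigma>_def scale3_def plus_prod_def split: prod.splits)
  have \<sigma>_0: "\<sigma> 0 = 0" by (simp add: \<sigma>_def zero_prod_def)
  show ?thesis
  proof (rule exI[of _ "\<sigma> \<rho>1"], rule exI[of _ "\<sigma> \<rho>2"], intro conjI ballI allI impI)
    show "\<sigma> \<rho>1 \<in> syz3 p q r" "\<sigma> \<rho>2 \<in> syz3 p q r" using \<rho>(1,2) \<sigma>_mem by auto
    show "\<exists>s t. v = scale3 s (\<sigma> \<rho>1) + scale3 t (\<sigma> \<rho>2)" if "v \<in> syz3 p q r" for v
      using \<rho>(3)[of "\<sigma> v"] that \<sigma>_mem \<sigma>_lin \<sigma>_\<sigma> by metis
    fix s t assume "scale3 s (\<sigma> \<rho>1) + scale3 t (\<sigma> \<rho>2) = 0"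
    hence "scale3 s \<rho>1 + scale3 t \<rho>2 = 0" using \<sigma>_lin \<sigma>_\<sigma> \<sigma>_0 by metis
    thus "s = 0" "t = 0" using \<rho>(4) by auto
  qed
qed

section \<open>Formal vector fields that do not vanish at the origin\<close>

definition fps2_dy :: "complex fps fps \<Rightarrow> complex fps fps" where
  "fps2_dy F = Abs_fps (\<lambda>i. fps_deriv (fps_nth F i))"

lemma fps2_dy_nth [simp]: "fps_nth (fps2_dy F) i = fps_deriv (fps_nth F i)"
  by (simp add: fps2_dy_def)

lemma fps2_dy_diff: "fps2_dy (F - G) = fps2_dy F - fps2_dy G"
  by (rule fps_ext) simp

lemma fps2_dy_mult: "fps2_dy (F * G) = F * fps2_dy G + fps2_dy F * G"
  by (rule fps_ext) (simp add: fps_mult_nth fps_deriv_sum sum.distrib)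

text \<open>Comparing coefficients of \<open>x^n\<close> in \<open>F_x = A F_y + B F\<close>
  expresses \<open>n + 1\<close> times the next coefficient by this sum: the formal Cauchy problem
  with initial value \<open>\<phi>\<close> on the line \<open>x = 0\<close>.\<close>

fun pde_coeff :: "complex fps fps \<Rightarrow> complex fps fps \<Rightarrow> complex fps \<Rightarrow> nat \<Rightarrow> complex fps" where
  "pde_coeff A B \<phi> 0 = \<phi>"
| "pde_coeff A B \<phi> (Suc n) = fps_const (1 / of_nat (Suc n)) *
     (\<Sum>i\<in>{0..n}. fps_nth A i * fps_deriv (pde_coeff A B \<phi> (n - i)) + fps_nth B i * pde_coeff A B \<phi> (n - i))"

lemma linear_pde_solution:
  "\<exists>F. fps_nth F 0 = \<phi> \<and> fps_deriv F = A * fps2_dy F + B * F"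
proof (intro exI conjI)
  let ?F = "Abs_fps (pde_coeff A B \<phi>)"
  show "fps_nth ?F 0 = \<phi>" by simp
  show "fps_deriv ?F = A * fps2_dy ?F + B * ?F"
  proof (rule fps_ext)
    fix n
    have "of_nat (Suc n) * (fps_const (1 / of_nat (Suc n)) * S) = S" for S :: "complex fps"
      by (simp only: fps_of_nat[symmetric] mult.assoc[symmetric] fps_const_mult) (simp del: of_nat_Suc)
    thus "fps_nth (fps_deriv ?F) n = fps_nth (A * fps2_dy ?F + B * ?F) n"
      by (simp add: fps_mult_nth sum.distrib del: of_nat_Suc)
  qed
qed

lemma linear_pde_unique:
  assumes eq: "fps_deriv F = A * fps2_dy F + B * F" and F0: "fps_nth F 0 = 0"
  shows "F = 0"
proof (rule fps_ext)
  fix n show "fps_nth F n = fps_nth 0 n"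
  proof (induction n rule: less_induct)
    case (less n)
    show ?case
    proof (cases n)
      case (Suc m)
      have "of_nat (Suc m) * fps_nth F (Suc m) = fps_nth (A * fps2_dy F + B * F) m"
        unfolding eq[symmetric] by simp
      also have "\<dots> = 0" using less Suc by (simp add: fps_mult_nth)
      finally show ?thesis using Suc by (simp del: of_nat_Suc)
    qed (use F0 in simp)
  qed
qed

text \<open>
  The vector field \<open>\<partial>\<^sub>x - A \<partial>\<^sub>y\<close> does not vanish at the origin; straightening it formally by a solution \<open>z\<close>
  of \<open>z\<^sub>x = A z\<^sub>y\<close> turns a semi-invariant \<open>F\<close> into \<open>z\<^sup>k w\<close>, whose singularity is not isolated if \<open>k \<ge> 2\<close>.
\<close>

lemma formal_no_transversal_field:
  assumes F00: "fps_nth (fps_nth F 0) 0 = 0" and F01: "fps_nth (fps_nth F 0) 1 = 0"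
    and eq: "fps_deriv F = A * fps2_dy F + B * F"
    and X: "fps_X ^ N = p * fps_deriv F + q * fps2_dy F"
  shows False
proof -
  define \<phi> where "\<phi> = fps_nth F 0"
  have "\<phi> \<noteq> 0"
  proof
    assume "\<phi> = 0"
    hence "F = 0" using linear_pde_unique[OF eq] by (simp add: \<phi>_def)
    moreover have "fps2_dy 0 = 0" by (rule fps_ext) simp
    ultimately show False using X by simp
  qed
  define k where "k = subdegree \<phi>"
  have "fps_nth \<phi> k \<noteq> 0" using \<open>\<phi> \<noteq> 0\<close> by (simp add: k_def)
  \<comment> \<open>Vanishing of \<open>F\<close> and of its \<open>y\<close>-derivative at the
    origin makes the order of \<open>F\<close> on \<open>x = 0\<close> at least 2.\<close>
  hence "k \<noteq> 0" "k \<noteq> 1" using F00 F01 unfolding \<phi>_def by metis+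
  then obtain l where k: "k = Suc (Suc l)" by (metis One_nat_def not0_implies_Suc)
  define v where "v = fps_shift k \<phi>"
  have v: "\<phi> = fps_X ^ k * v"
    using subdegree_decompose[of \<phi>] by (simp add: k_def v_def mult.commute)
  \<comment> \<open>\<open>z\<close> is a first integral of the field with \<open>z = y\<close> on
    \<open>x = 0\<close>, and \<open>w\<close> solves the equation of \<open>F\<close> itself. By
    the product rule \<open>z^k w\<close> solves it too, with the same initial value
    \<open>y^k v\<close> as \<open>F\<close>, so uniqueness identifies them.\<close>
  obtain z where z: "fps_nth z 0 = fps_X" "fps_deriv z = A * fps2_dy z + 0 * z"
    using linear_pde_solution by blast
  obtain w where w: "fps_nth w 0 = v" "fps_deriv w = A * fps2_dy w + B * w"
    using linear_pde_solution by blast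
  have zk: "fps_nth (z ^ j * w) 0 = fps_X ^ j * v \<and>
      fps_deriv (z ^ j * w) = A * fps2_dy (z ^ j * w) + B * (z ^ j * w)" for j
  proof (induction j)
    case (Suc j)
    define g where "g = z ^ j * w"
    have g: "fps_nth g 0 = fps_X ^ j * v" "fps_deriv g = A * fps2_dy g + B * g"
      using Suc by (simp_all add: g_def)
    have "z ^ Suc j * w = z * g" by (simp add: g_def mult.assoc)
    moreover have "fps_deriv (z * g) = A * fps2_dy (z * g) + B * (z * g)"
      unfolding fps_deriv_mult fps2_dy_mult g(2) z(2) by (simp add: algebra_simps)
    moreover have "fps_nth (z * g) 0 = fps_X ^ Suc j * v" by (simp add: g z mult.assoc)
    ultimately show ?case by (simp only:)
  qed (simp add: w)
  have "fps_nth (F - z ^ k * w) 0 = 0" using zk[of k] v by (simp add: \<phi>_def)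
  moreover have "fps_deriv (F - z ^ k * w) = A * fps2_dy (F - z ^ k * w) + B * (F - z ^ k * w)"
    unfolding fps_deriv_sub fps2_dy_diff using zk[of k] eq by (simp add: algebra_simps)
  ultimately have "F - z ^ k * w = 0" using linear_pde_unique by blast
  define g where "g = z ^ l * w"
  have F: "F = z * (z * g)" using \<open>F - z ^ k * w = 0\<close> by (simp add: k g_def mult.assoc)
  have "fps_deriv F = z * (2 * fps_deriv z * g + z * fps_deriv g)"
    unfolding F fps_deriv_mult by (simp add: algebra_simps)
  moreover have "fps2_dy F = z * (2 * fps2_dy z * g + z * fps2_dy g)"
    unfolding F fps2_dy_mult by (simp add: algebra_simps)
  ultimately have "fps_X ^ N = z * (p * (2 * fps_deriv z * g + z * fps_deriv g) + q * (2 * fps2_dy z * g + z * fps2_dy g))"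
    using X by (simp add: algebra_simps)
  \<comment> \<open>As \<open>F\<close> is \<open>z^2 g\<close>, both derivatives are divisible by
    \<open>z\<close>. But \<open>z\<close> is \<open>y\<close> on \<open>x = 0\<close>, so
    \<open>x\<close> can be cancelled from \<open>x^N = z h\<close> until \<open>z\<close> would be
    a unit.\<close>
  hence "\<exists>h. fps_X ^ N = z * h" by blast
  thus False
  proof (induction N)
    case 0
    then obtain h where "1 = z * h" by auto
    hence "1 = fps_X * fps_nth h 0" by (metis fps_mult_nth_0 fps_one_nth z(1))
    hence "fps_nth (1 :: complex fps) 0 = fps_nth (fps_X * fps_nth h 0) 0" by simp
    thus False by simp
  next
    case (Suc N)
    then obtain h where h: "fps_X * fps_X ^ N = z * h" by auto
    hence "fps_nth (z * h) 0 = 0" by (metis fps_X_mult_nth)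
    hence "fps_nth h 0 = 0" by (simp add: z(1))
    hence "h = fps_X * fps_shift 1 h"
      by (intro fps_ext) (simp add: fps_X_mult_nth)
    with h have "fps_X * fps_X ^ N = fps_X * (z * fps_shift 1 h)" by (metis mult.left_commute)
    hence "fps_X ^ N = z * fps_shift 1 h" by simp
    thus False using Suc.IH by blast
  qed
qed

text \<open>Interchange of the variables, which reduces a field with a unit in front of the
  \<open>y\<close>-derivative to the case just settled. It acts on formal series, so convergence of
  the swapped series is no issue.\<close>

definition fps2_swap :: "complex fps fps \<Rightarrow> complex fps fps" where
  "fps2_swap F = Abs_fps (\<lambda>i. Abs_fps (\<lambda>j. fps_nth (fps_nth F j) i))"

lemma fps2_swap_nth [simp]: "fps_nth (fps_nth (fps2_swap F) i) j = fps_nth (fps_nth F j) i"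
  by (simp add: fps2_swap_def)

lemma fps2_eqI: "(\<And>i j. fps_nth (fps_nth F i) j = fps_nth (fps_nth G i) j) \<Longrightarrow> F = G"
  by (auto simp: fps_eq_iff)

lemma fps2_swap_add: "fps2_swap (F + G) = fps2_swap F + fps2_swap G"
  by (rule fps2_eqI) simp

lemma fps2_swap_mult: "fps2_swap (F * G) = fps2_swap F * fps2_swap G"
  by (rule fps2_eqI) (simp add: fps_mult_nth fps_sum_nth, rule sum.swap)

lemma fps2_swap_dx: "fps2_swap (fps_deriv F) = fps2_dy (fps2_swap F)"
proof (rule fps2_eqI)
  fix i j
  have "fps_nth (fps_nth (fps_deriv F) j) i = of_nat (Suc j) * fps_nth (fps_nth F (Suc j)) i"
    unfolding fps_deriv_nth fps_of_nat[of "j + 1", symmetric] fps_mult_left_const_nth by simp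
  thus "fps_nth (fps_nth (fps2_swap (fps_deriv F)) i) j = fps_nth (fps_nth (fps2_dy (fps2_swap F)) i) j"
    by (simp del: of_nat_Suc)
qed

lemma fps2_swap_swap [simp]: "fps2_swap (fps2_swap F) = F"
  by (rule fps2_eqI) simp

lemma fps2_swap_dy: "fps2_swap (fps2_dy F) = fps_deriv (fps2_swap F)"
  using fps2_swap_dx[of "fps2_swap F"] by (metis fps2_swap_swap)

lemma fps2_swap_Y_power: "fps2_swap (fps_const fps_X ^ n) = fps_X ^ n"
proof (induction n)
  case 0
  show ?case by (rule fps2_eqI) (auto simp: fps_one_def)
next
  case (Suc n)
  have "fps2_swap (fps_const fps_X) = fps_X"
    by (rule fps2_eqI) (auto simp: fps_X_def)
  thus ?case using Suc unfolding power_Suc fps2_swap_mult by simp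
qed

lemma fps2_of_conv_power: "fps2_of_conv (F ^ n) = fps2_of_conv F ^ n"
  by (induction n) (auto simp: one_conv_ps2.rep_eq times_conv_ps2.rep_eq)

lemmas fps2_of_conv_simps = plus_conv_ps2.rep_eq times_conv_ps2.rep_eq fps2_of_conv_power
  ps_X.rep_eq ps_Y.rep_eq deriv_x.rep_eq deriv_y.rep_eq[folded fps2_dy_def]

lemma no_transversal_field_x:
  assumes "ps_coeff f 0 0 = 0" "ps_coeff (deriv_y f) 0 0 = 0"
    and "deriv_x f = a * deriv_y f + b * f"
    and "ps_X ^ n = c * deriv_x f + d * deriv_y f"
  shows False
proof (rule formal_no_transversal_field)
  show "fps_nth (fps_nth (fps2_of_conv f) 0) 0 = 0" "fps_nth (fps_nth (fps2_of_conv f) 0) 1 = 0"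
    using assms(1,2) by (simp_all add: ps_coeff.rep_eq deriv_y.rep_eq)
qed (use assms(3,4)[THEN arg_cong, of fps2_of_conv] in \<open>simp_all only: fps2_of_conv_simps\<close>)

lemma no_transversal_field_y:
  assumes "ps_coeff f 0 0 = 0" "ps_coeff (deriv_x f) 0 0 = 0"
    and "deriv_y f = a * deriv_x f + b * f"
    and "ps_Y ^ n = c * deriv_x f + d * deriv_y f"
  shows False
proof (rule formal_no_transversal_field)
  let ?F = "fps2_swap (fps2_of_conv f)"
  show "fps_nth (fps_nth ?F 0) 0 = 0" using assms(1) by (simp add: ps_coeff.rep_eq)
  show "fps_nth (fps_nth ?F 0) 1 = 0" using assms(2) by (simp add: ps_coeff.rep_eq deriv_x.rep_eq)
  show "fps_deriv ?F = fps2_swap (fps2_of_conv a) * fps2_dy ?F + fps2_swap (fps2_of_conv b) * ?F"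
    using arg_cong[OF assms(3), of "\<lambda>g. fps2_swap (fps2_of_conv g)"]
    by (simp only: fps2_of_conv_simps fps2_swap_add fps2_swap_mult fps2_swap_dx fps2_swap_dy)
  show "fps_X ^ n = fps2_swap (fps2_of_conv d) * fps_deriv ?F + fps2_swap (fps2_of_conv c) * fps2_dy ?F"
    using arg_cong[OF assms(4), of "\<lambda>g. fps2_swap (fps2_of_conv g)"]
    by (simp only: fps2_of_conv_simps fps2_swap_add fps2_swap_mult fps2_swap_dx fps2_swap_dy
      fps2_swap_Y_power add.commute)
qed

section \<open>The syzygies of a singularity that is not quasi-homogeneous\<close>

text \<open>A component of a cross product is a 2-by-2 minor, and such minors are multiplied by the
  determinant of the coefficients when two vectors are replaced by combinations of them.\<close>

lemma cross_product_lincomb: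
  fixes b1 :: "'a::comm_ring_1"
  shows "(s1 * b1 + t1 * b2) * (s2 * c1 + t2 * c2) - (s1 * c1 + t1 * c2) * (s2 * b1 + t2 * b2) =
    (s1 * t2 - t1 * s2) * (b1 * c2 - c1 * b2)"
  by (simp add: algebra_simps)

text \<open>The ideal memberships are kept as explicit combinations, the form in which
  \<open>koszul_exact\<close> takes them; \<open>f_notin\<close> is the failure of
  quasi-homogeneity.\<close>

locale isolated_non_qh =
  fixes f n m \<alpha> \<beta> \<gamma> \<delta>
  assumes f00: "ps_coeff f 0 0 = 0"
    and X_power: "ps_X ^ n = \<alpha> * deriv_x f + \<beta> * deriv_y f"
    and Y_power: "ps_Y ^ m = \<gamma> * deriv_x f + \<delta> * deriv_y f"
    and f_notin: "\<And>u v. f \<noteq> u * deriv_x f + v * deriv_y f"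
begin

abbreviation "fx \<equiv> deriv_x f"
abbreviation "fy \<equiv> deriv_y f"

text \<open>Were the Jacobian ideal the unit ideal, it would contain \<open>f\<close>. Hence both
  partial derivatives vanish at the origin, which the exclusion of transversal fields
  requires.\<close>

lemma not_unit_J: "\<not> (u * fx + v * fy) dvd 1"
proof
  assume "(u * fx + v * fy) dvd 1"
  then obtain e where e: "(u * fx + v * fy) * e = 1" by (metis dvdE)
  have "f = ((u * fx + v * fy) * e) * f" using e by simp
  also have "\<dots> = (u * e * f) * fx + (v * e * f) * fy" by (simp add: algebra_simps)
  finally show False using f_notin by blast
qed

lemma fx00: "ps_coeff fx 0 0 = 0"
  using not_unit_J[of 1 0] conv_unit by auto

lemma fy00: "ps_coeff fy 0 0 = 0"
  using not_unit_J[of 0 1] conv_unit by auto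

lemma fx_or_fy_nonzero: "fx \<noteq> 0 \<or> fy \<noteq> 0"
  using X_power by auto

lemma not_dvd_J: "t dvd fx \<Longrightarrow> t dvd fy \<Longrightarrow> t dvd 1"
  using unit_dvd_X_Y_powers[of t n m] unfolding X_power Y_power by simp

lemma syz_entries_max_ideal:
  assumes "a * fx + b * fy + c * f = 0"
  shows "ps_coeff a 0 0 = 0" "ps_coeff b 0 0 = 0" "ps_coeff c 0 0 = 0"
proof -
  show "ps_coeff c 0 0 = 0"
  proof (rule ccontr)
    assume "ps_coeff c 0 0 \<noteq> 0"
    then obtain e where e: "c * e = 1" using conv_unit by (metis dvdE)
    have "f = (c * e) * f" by (simp add: e)
    also have "\<dots> = e * (c * f)" by (simp only: mult_ac)
    also have "c * f = - (a * fx + b * fy)" using assms by (simp only: add_eq_0_iff)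
    also have "e * - (a * fx + b * fy) = (- e * a) * fx + (- e * b) * fy" by (simp add: algebra_simps)
    finally show False using f_notin by blast
  qed
  show "ps_coeff a 0 0 = 0"
  proof (rule ccontr)
    assume "ps_coeff a 0 0 \<noteq> 0"
    then obtain e where e: "a * e = 1" using conv_unit by (metis dvdE)
    have "fx = (a * e) * fx" by (simp add: e)
    also have "\<dots> = e * (a * fx)" by (simp only: mult_ac)
    also have "a * fx = - (b * fy + c * f)"
      using assms by (simp only: eq_neg_iff_add_eq_0 add.assoc)
    also have "e * - (b * fy + c * f) = (- e * b) * fy + (- e * c) * f" by (simp add: algebra_simps)
    finally show False using no_transversal_field_x[OF f00 fy00] X_power by blast
  qed
  show "ps_coeff b 0 0 = 0"
  proof (rule ccontr)
    assume "ps_coeff b 0 0 \<noteq> 0"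
    then obtain e where e: "b * e = 1" using conv_unit by (metis dvdE)
    have "fy = (b * e) * fy" by (simp add: e)
    also have "\<dots> = e * (b * fy)" by (simp only: mult_ac)
    also have "b * fy = - (a * fx + c * f)"
      using assms by (simp only: eq_neg_iff_add_eq_0 add_ac)
    also have "e * - (a * fx + c * f) = (- e * a) * fx + (- e * c) * f" by (simp add: algebra_simps)
    finally show False using no_transversal_field_y[OF f00 fx00] Y_power by blast
  qed
qed

end

locale syz_basis = isolated_non_qh +
  fixes a1 b1 c1 a2 b2 c2
  assumes rel1: "a1 * fx + b1 * fy + c1 * f = 0"
    and rel2: "a2 * fx + b2 * fy + c2 * f = 0"
    and generates: "\<And>a b c. a * fx + b * fy + c * f = 0 \<Longrightarrow>
      \<exists>s t. a = s * a1 + t * a2 \<and> b = s * b1 + t * b2 \<and> c = s * c1 + t * c2"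
begin

text \<open>The Hilbert-Burch theorem in this case. The Koszul syzygies are written in the basis;
  the cross product of the first with the second and with the third is \<open>fx\<close>,
  respectively \<open>fy\<close>, times the vector \<open>(fx, fy, f)\<close>.\<close>

lemma minors_eq_unit_mult:
  "\<exists>t. t dvd 1 \<and> b1 * c2 - c1 * b2 = t * fx \<and> c1 * a2 - a1 * c2 = t * fy \<and> a1 * b2 - b1 * a2 = t * f"
proof -
  define d1 where "d1 = b1 * c2 - c1 * b2"
  define d2 where "d2 = c1 * a2 - a1 * c2"
  define d3 where "d3 = a1 * b2 - b1 * a2"
  obtain s t where st: "fy = s * a1 + t * a2" "- fx = s * b1 + t * b2" "0 = s * c1 + t * c2"
    using generates[of fy "- fx" 0] by (auto simp: mult.commute)
  obtain s' t' where st': "f = s' * a1 + t' * a2" "0 = s' * b1 + t' * b2" "- fx = s' * c1 + t' * c2"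
    using generates[of f 0 "- fx"] by (auto simp: mult.commute)
  obtain s'' t'' where st'': "0 = s'' * a1 + t'' * a2" "f = s'' * b1 + t'' * b2" "- fy = s'' * c1 + t'' * c2"
    using generates[of 0 f "- fy"] by (auto simp: mult.commute)
  define e where "e = s * t' - t * s'"
  define e' where "e' = s * t'' - t * s''"
  have e: "e * d1 = fx * fx" "e * d2 = fx * fy" "e * d3 = fx * f"
    using cross_product_lincomb[of s b1 t b2 s' c1 t' c2, folded st st']
      cross_product_lincomb[of s c1 t c2 s' a1 t' a2, folded st st']
      cross_product_lincomb[of s a1 t a2 s' b1 t' b2, folded st st']
    by (simp_all add: e_def d1_def d2_def d3_def mult.commute)
  have e': "e' * d1 = fy * fx" "e' * d2 = fy * fy" "e' * d3 = fy * f"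
    using cross_product_lincomb[of s b1 t b2 s'' c1 t'' c2, folded st st'']
      cross_product_lincomb[of s c1 t c2 s'' a1 t'' a2, folded st st'']
      cross_product_lincomb[of s a1 t a2 s'' b1 t'' b2, folded st st'']
    by (simp_all add: e'_def d1_def d2_def d3_def mult.commute)
  \<comment> \<open>\<open>e\<close> and \<open>e'\<close> times \<open>(d1, d2, d3)\<close> are
    proportional to \<open>(fx, fy, f)\<close>. Cancelling whichever of them is nonzero shows that
    \<open>(- d2, d1)\<close> is a syzygy of \<open>(fx, fy)\<close>, hence a Koszul one.\<close>
  have "e * (- d2 * fx + d1 * fy) = - (e * d2) * fx + (e * d1) * fy" by (simp add: algebra_simps)
  hence 1: "e * (- d2 * fx + d1 * fy) = 0" unfolding e by (simp add: mult_ac)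
  have "e' * (- d2 * fx + d1 * fy) = - (e' * d2) * fx + (e' * d1) * fy" by (simp add: algebra_simps)
  hence 2: "e' * (- d2 * fx + d1 * fy) = 0" unfolding e' by (simp add: mult_ac)
  have ee': "e \<noteq> 0 \<or> e' \<noteq> 0" using fx_or_fy_nonzero e(1) e'(2) by auto
  with 1 2 have "- d2 * fx + d1 * fy = 0" by auto
  then obtain s0 where s0: "- d2 = s0 * fy" "d1 = - s0 * fx"
    using koszul_exact[OF X_power Y_power] by blast
  define u where "u = - s0"
  have "d2 = - (- d2)" by simp
  hence d12: "d1 = u * fx" "d2 = u * fy" using s0 by (simp_all only: u_def mult_minus_left)
  \<comment> \<open>Cancelling \<open>fx\<close> from \<open>fx^2 = e u fx\<close> requires
    \<open>fx\<close> to be nonzero; otherwise the second component gives \<open>e u fy = 0\<close>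
    with \<open>fy\<close> nonzero.\<close>
  have eu: "fx = e * u"
  proof (cases "fx = 0")
    case True
    hence "e * u * fy = 0" using e(2) d12(2) by (simp add: mult_ac)
    moreover have "fy \<noteq> 0" using True fx_or_fy_nonzero by simp
    ultimately show ?thesis using True by simp
  next
    case False
    have "fx * fx = (e * u) * fx" using e(1) d12(1) by (simp only: mult_ac)
    thus ?thesis using False by simp
  qed
  have e'u: "fy = e' * u"
  proof (cases "fy = 0")
    case True
    hence "e' * u * fx = 0" using e'(1) d12(1) by (simp add: mult_ac)
    moreover have "fx \<noteq> 0" using True fx_or_fy_nonzero by simp
    ultimately show ?thesis using True by simp
  next
    case False
    have "fy * fy = (e' * u) * fy" using e'(2) d12(2) by (simp only: mult_ac)
    thus ?thesis using False by simp
  qed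
  have "e * d3 = e * (u * f)" using e(3) arg_cong[OF eu, of "\<lambda>z. z * f"] by (simp only: mult.assoc)
  moreover have "e' * d3 = e' * (u * f)" using e'(3) arg_cong[OF e'u, of "\<lambda>z. z * f"] by (simp only: mult.assoc)
  ultimately have "d3 = u * f" using ee' by auto
  moreover have "u dvd fx" "u dvd fy" by (metis dvd_triv_right eu) (metis dvd_triv_right e'u)
  hence "u dvd 1" by (rule not_dvd_J)
  ultimately show ?thesis using d12 unfolding d1_def d2_def d3_def by blast
qed

definition ann where "ann = {g. \<exists>u v. g * f = u * fx + v * fy}"

lemma ann_eq: "ann = {s * c1 + t * c2 | s t. True}"
proof (intro equalityI subsetI)
  fix g assume "g \<in> ann"
  then obtain u v where "g * f = u * fx + v * fy" by (auto simp: ann_def)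
  hence "(- u) * fx + (- v) * fy + g * f = 0" by simp
  from generates[OF this] show "g \<in> {s * c1 + t * c2 | s t. True}" by auto
next
  fix g assume "g \<in> {s * c1 + t * c2 | s t. True}"
  then obtain s t where g: "g = s * c1 + t * c2" by auto
  have "c1 * f = - (a1 * fx + b1 * fy)" "c2 * f = - (a2 * fx + b2 * fy)"
    using rel1 rel2 by (simp_all only: add_eq_0_iff)
  hence "g * f = s * - (a1 * fx + b1 * fy) + t * - (a2 * fx + b2 * fy)"
    by (simp only: g distrib_right mult.assoc)
  also have "\<dots> = (- s * a1 - t * a2) * fx + (- s * b1 - t * b2) * fy" by (simp add: algebra_simps)
  finally show "g \<in> ann" by (auto simp: ann_def)
qed

lemma J_subset_ann: "u * fx + v * fy \<in> ann"
proof -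
  have "(u * fx + v * fy) * f = (u * f) * fx + (v * f) * fy" by (simp add: algebra_simps)
  thus ?thesis by (auto simp: ann_def)
qed

lemma X_Y_power_ann: "\<exists>s t. ps_X ^ n = s * c1 + t * c2" "\<exists>s t. ps_Y ^ m = s * c1 + t * c2"
  using J_subset_ann[of \<alpha> \<beta>] J_subset_ann[of \<gamma> \<delta>] unfolding ann_eq X_power Y_power by auto

lemma ann_00: "g \<in> ann \<Longrightarrow> ps_coeff g 0 0 = 0"
  using syz_entries_max_ideal(3)[OF rel1] syz_entries_max_ideal(3)[OF rel2] by (auto simp: ann_eq)

text \<open>A single generator would divide \<open>x^n\<close> and \<open>y^m\<close> and be a unit,
  whereas all elements of \<open>ann\<close> have constant term 0, because third entries of syzygies
  do.\<close>

lemma ann_not_principal: "ann \<noteq> {s * c | s. True}"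
proof
  assume eq: "ann = {s * c | s. True}"
  have "ps_X ^ n \<in> ann" "ps_Y ^ m \<in> ann"
    unfolding X_power Y_power by (rule J_subset_ann)+
  hence "c dvd ps_X ^ n" "c dvd ps_Y ^ m" unfolding eq by auto
  hence "c dvd 1" by (rule unit_dvd_X_Y_powers)
  hence "ps_coeff c 0 0 \<noteq> 0" by (rule conv_unit_iff[THEN iffD1])
  moreover have "c \<in> ann" unfolding eq by (auto intro!: exI[of _ 1])
  ultimately show False using ann_00 by blast
qed

text \<open>If \<open>c1\<close> were 0 or equal to \<open>c2\<close>, then \<open>c2\<close> alone
  would generate the annihilator. Regularity is Koszul exactness again, now for \<open>c1\<close>
  and \<open>c2\<close>, of which \<open>x^n\<close> and \<open>y^m\<close> are
  combinations.\<close>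

lemma c1_regular:
  shows "c1 \<noteq> 0" "c1 \<noteq> c2" "\<And>g h. c2 * g = h * c1 \<Longrightarrow> \<exists>s. g = s * c1"
proof -
  show "c1 \<noteq> 0" using ann_not_principal[of c2] by (auto simp: ann_eq)
  show "c1 \<noteq> c2"
  proof
    assume "c1 = c2"
    have "{s * c1 + t * c2 | s t. True} = {s * c2 | s. True}"
    proof (intro equalityI subsetI)
      fix g assume "g \<in> {s * c1 + t * c2 | s t. True}"
      then obtain s t where "g = (s + t) * c2" using \<open>c1 = c2\<close> by (auto simp: distrib_right)
      thus "g \<in> {s * c2 | s. True}" by blast
    next
      fix g assume "g \<in> {s * c2 | s. True}"
      then obtain s where "g = 0 * c1 + s * c2" by auto
      thus "g \<in> {s * c1 + t * c2 | s t. True}" by blast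
    qed
    thus False using ann_not_principal ann_eq by auto
  qed
  show "\<exists>s. g = s * c1" if eq: "c2 * g = h * c1" for g h
  proof -
    obtain s t where X: "ps_X ^ n = s * c1 + t * c2" using X_Y_power_ann by auto
    obtain s' t' where Y: "ps_Y ^ m = s' * c1 + t' * c2" using X_Y_power_ann by auto
    have "(- h) * c1 + g * c2 = 0" using eq by (simp add: mult.commute)
    from koszul_exact[OF X Y this] show ?thesis by (metis mult_minus_left)
  qed
qed

end

section \<open>Ideals of finite colength\<close>

lemma Idl_pair: "Idl\<^bsub>class_ring\<^esub> {a, b} = {s * a + t * b | s t. True}" for a b :: "'a::comm_ring_1"
proof
  have "ideal {s * a + t * b | s t. True} class_ring"
  proof (rule ideal_classI)
    show "0 \<in> {s * a + t * b | s t. True}" by (auto intro!: exI[of _ 0])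
    fix x y assume "x \<in> {s * a + t * b | s t. True}" "y \<in> {s * a + t * b | s t. True}"
    then obtain s t s' t' where "x = s * a + t * b" "y = s' * a + t' * b" by auto
    hence "x + y = (s + s') * a + (t + t') * b" by (simp add: algebra_simps)
    thus "x + y \<in> {s * a + t * b | s t. True}" by blast
  next
    fix c x assume "x \<in> {s * a + t * b | s t. True}"
    then obtain s t where "x = s * a + t * b" by auto
    hence "c * x = (c * s) * a + (c * t) * b" by (simp add: algebra_simps)
    thus "c * x \<in> {s * a + t * b | s t. True}" by blast
  qed
  moreover have "a = 1 * a + 0 * b" "b = 0 * a + 1 * b" by simp_all
  hence "{a, b} \<subseteq> {s * a + t * b | s t. True}" by blast
  ultimately show "Idl\<^bsub>class_ring\<^esub> {a, b} \<subseteq> {s * a + t * b | s t. True}" by (rule Idl_subset)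
  show "{s * a + t * b | s t. True} \<subseteq> Idl\<^bsub>class_ring\<^esub> {a, b}"
  proof clarify
    fix s t
    show "s * a + t * b \<in> Idl\<^bsub>class_ring\<^esub> {a, b}"
      by (intro ideal_add[OF ideal_Idl] ideal_mult[OF ideal_Idl]; rule Idl_base; simp)
  qed
qed

lemma Idl_singleton: "Idl\<^bsub>class_ring\<^esub> {a} = {s * a | s. True}" for a :: "'a::comm_ring_1"
proof -
  have "{s * a + t * a | s t. True} = {s * a | s. True}"
  proof (intro equalityI subsetI)
    fix x assume "x \<in> {s * a + t * a | s t. True}"
    then obtain s t where "x = (s + t) * a" by (auto simp: distrib_right)
    thus "x \<in> {s * a | s. True}" by blast
  next
    fix x assume "x \<in> {s * a | s. True}"
    then obtain s where "x = s * a + 0 * a" by auto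
    thus "x \<in> {s * a + t * a | s t. True}" by blast
  qed
  thus ?thesis using Idl_pair[of a a] by simp
qed

lemma Idl_empty: "Idl\<^bsub>class_ring\<^esub> {} = {0 :: 'a::comm_ring_1}"
proof
  show "Idl\<^bsub>class_ring\<^esub> {} \<subseteq> {0 :: 'a}" by (rule Idl_subset) (auto intro!: ideal_classI)
qed (auto intro: ideal_0)

lemma Idl_triple:
  "Idl\<^bsub>class_ring\<^esub> {a, b, c} = {r * a + s * b + t * c | r s t. True}" for a b c :: "'a::comm_ring_1"
proof
  have "ideal {r * a + s * b + t * c | r s t. True} class_ring"
  proof (rule ideal_classI)
    show "0 \<in> {r * a + s * b + t * c | r s t. True}" by (auto intro!: exI[of _ 0])
    fix x y assume "x \<in> {r * a + s * b + t * c | r s t. True}" "y \<in> {r * a + s * b + t * c | r s t. True}"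
    then obtain r s t r' s' t' where "x = r * a + s * b + t * c" "y = r' * a + s' * b + t' * c" by auto
    hence "x + y = (r + r') * a + (s + s') * b + (t + t') * c" by (simp add: algebra_simps)
    thus "x + y \<in> {r * a + s * b + t * c | r s t. True}" by blast
  next
    fix d x assume "x \<in> {r * a + s * b + t * c | r s t. True}"
    then obtain r s t where "x = r * a + s * b + t * c" by auto
    hence "d * x = (d * r) * a + (d * s) * b + (d * t) * c" by (simp add: algebra_simps)
    thus "d * x \<in> {r * a + s * b + t * c | r s t. True}" by blast
  qed
  moreover have "a = 1 * a + 0 * b + 0 * c" "b = 0 * a + 1 * b + 0 * c" "c = 0 * a + 0 * b + 1 * c" by simp_all
  hence "{a, b, c} \<subseteq> {r * a + s * b + t * c | r s t. True}" by blast
  ultimately show "Idl\<^bsub>class_ring\<^esub> {a, b, c} \<subseteq> {r * a + s * b + t * c | r s t. True}" by (rule Idl_subset)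
  show "{r * a + s * b + t * c | r s t. True} \<subseteq> Idl\<^bsub>class_ring\<^esub> {a, b, c}"
  proof clarify
    fix r s t
    show "r * a + s * b + t * c \<in> Idl\<^bsub>class_ring\<^esub> {a, b, c}"
      by (intro ideal_add[OF ideal_Idl] ideal_mult[OF ideal_Idl]; rule Idl_base; simp)
  qed
qed

section \<open>The quotient algebra as a complex vector space\<close>

lemma coset_eq_iff:
  fixes I :: "'a::comm_ring_1 set"
  assumes "ideal I class_ring"
  shows "I +>\<^bsub>class_ring\<^esub> x = I +>\<^bsub>class_ring\<^esub> y \<longleftrightarrow> x - y \<in> I"
proof
  assume "I +>\<^bsub>class_ring\<^esub> x = I +>\<^bsub>class_ring\<^esub> y"
  moreover have "x \<in> I +>\<^bsub>class_ring\<^esub> x"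
    using ideal_0[OF assms] by (auto simp: a_r_coset_def' intro: bexI[of _ 0])
  ultimately show "x - y \<in> I" by (auto simp: a_r_coset_def')
next
  assume *: "x - y \<in> I"
  have "I +>\<^bsub>class_ring\<^esub> u \<subseteq> I +>\<^bsub>class_ring\<^esub> v" if "u - v \<in> I" for u v
  proof
    fix z assume "z \<in> I +>\<^bsub>class_ring\<^esub> u"
    then obtain h where "h \<in> I" "z = h + u" by (auto simp: a_r_coset_def')
    hence h: "h + (u - v) \<in> I" "z = (h + (u - v)) + v" using ideal_add[OF assms] that by auto
    have "w + v \<in> I +>\<^bsub>class_ring\<^esub> v" if "w \<in> I" for w
      using that by (auto simp: a_r_coset_def')
    from this[OF h(1)] show "z \<in> I +>\<^bsub>class_ring\<^esub> v" by (simp only: h(2))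
  qed
  moreover have "y - x \<in> I" using ideal_uminus[OF assms *] by simp
  ultimately show "I +>\<^bsub>class_ring\<^esub> x = I +>\<^bsub>class_ring\<^esub> y" using * by blast
qed

lemma coset_0: "I +>\<^bsub>class_ring\<^esub> (0 :: 'a::comm_ring_1) = I"
  by (auto simp: a_r_coset_def')

lemma quotient_algebra_simps:
  fixes J :: "conv_ps2 set"
  assumes J: "ideal J ps_ring"
  shows "carrier (quotient_algebra J) = range (\<lambda>x. J +>\<^bsub>ps_ring\<^esub> x)"
    and "\<zero>\<^bsub>quotient_algebra J\<^esub> = J +>\<^bsub>ps_ring\<^esub> 0"
    and "(J +>\<^bsub>ps_ring\<^esub> x) \<oplus>\<^bsub>quotient_algebra J\<^esub> (J +>\<^bsub>ps_ring\<^esub> y) = J +>\<^bsub>ps_ring\<^esub> (x + y)"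
    and "c \<odot>\<^bsub>quotient_algebra J\<^esub> (J +>\<^bsub>ps_ring\<^esub> x) = J +>\<^bsub>ps_ring\<^esub> (ps_const c * x)"
proof -
  note hom = ideal.rcos_ring_hom[OF J]
  show "carrier (quotient_algebra J) = range (\<lambda>x. J +>\<^bsub>ps_ring\<^esub> x)"
    by (auto simp: quotient_algebra_def FactRing_def A_RCOSETS_def')
  show "\<zero>\<^bsub>quotient_algebra J\<^esub> = J +>\<^bsub>ps_ring\<^esub> 0"
    by (simp add: quotient_algebra_def FactRing_def coset_0)
  show "(J +>\<^bsub>ps_ring\<^esub> x) \<oplus>\<^bsub>quotient_algebra J\<^esub> (J +>\<^bsub>ps_ring\<^esub> y) = J +>\<^bsub>ps_ring\<^esub> (x + y)"
    using ring_hom_add[OF hom, of x y] by (simp add: quotient_algebra_def)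
  show "c \<odot>\<^bsub>quotient_algebra J\<^esub> (J +>\<^bsub>ps_ring\<^esub> x) = J +>\<^bsub>ps_ring\<^esub> (ps_const c * x)"
    using ring_hom_mult[OF hom, of "ps_const c" x] by (simp add: quotient_algebra_def)
qed

lemma ps_const_add: "ps_const (c + d) = ps_const c + ps_const d"
  by (rule conv_ps2_eqI) (simp add: ps_coeff_const)

lemma ps_const_mult: "ps_const (c * d) = ps_const c * ps_const d"
  by transfer simp

lemma ps_const_1: "ps_const 1 = 1"
  by transfer simp

lemma vectorspace_quotient_algebra:
  assumes J: "ideal J ps_ring"
  shows "vectorspace class_ring (quotient_algebra J)"
proof -
  note q = quotient_algebra_simps[OF J]
  have "abelian_group (quotient_algebra J)"
  proof (rule abelian_groupI)
    fix K assume "K \<in> carrier (quotient_algebra J)"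
    then obtain x where "K = J +>\<^bsub>ps_ring\<^esub> x" by (auto simp: q)
    thus "\<exists>L\<in>carrier (quotient_algebra J). L \<oplus>\<^bsub>quotient_algebra J\<^esub> K = \<zero>\<^bsub>quotient_algebra J\<^esub>"
      by (intro bexI[of _ "J +>\<^bsub>ps_ring\<^esub> (- x)"]) (auto simp: q)
  qed (auto simp: q add_ac)
  hence "Module.module class_ring (quotient_algebra J)"
    by (intro moduleI class_cring.cring_axioms)
      (auto simp: q class_ring_simps ps_const_add ps_const_mult ps_const_1 algebra_simps)
  thus ?thesis unfolding vectorspace_def using class_field by blast
qed

lemma ps_coeff_sum [simp]: "ps_coeff (sum g A) i j = (\<Sum>a\<in>A. ps_coeff (g a) i j)"
  by (induction A rule: infinite_finite_induct) auto

text \<open>In finite dimension the powers of \<open>z\<close> satisfy a nontrivial linear relation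
  modulo \<open>J\<close>. Its lowest term factors out, and the cofactor is a unit because
  \<open>z\<close> has constant term 0.\<close>

lemma power_in_ideal_of_fin_dim:
  assumes J: "ideal J ps_ring" and fd: "fin_dim_complex (quotient_algebra J)"
    and z: "ps_coeff z 0 0 = 0"
  shows "\<exists>n. z ^ n \<in> J"
proof -
  interpret V: vectorspace "class_ring :: complex ring" "quotient_algebra J"
    by (rule vectorspace_quotient_algebra[OF J])
  note q = quotient_algebra_simps[OF J]
  define c where "c = (\<lambda>i. J +>\<^bsub>ps_ring\<^esub> z ^ i)"
  have unit_mult: "z ^ k \<in> J" if u: "u dvd 1" and zu: "z ^ k * u \<in> J" for k u
  proof -
    obtain v where v: "1 = u * v" using u by (rule dvdE)
    have "v * (z ^ k * u) = z ^ k * (u * v)" by (simp only: mult_ac)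
    hence "v * (z ^ k * u) = z ^ k" by (simp only: v[symmetric] mult_1_right)
    thus ?thesis using ideal_mult[OF J zu, of v] by (simp only:)
  qed
  show ?thesis
  \<comment> \<open>Linear dependence concerns sets, so coinciding residues of powers are treated
    apart; they already give the relation \<open>z^i - z^j\<close>.\<close>
  proof (cases "inj c")
    case False
    then obtain i' j' where "i' \<noteq> j'" "c i' = c j'" by (auto simp: inj_def)
    hence "i' < j' \<and> c i' = c j' \<or> j' < i' \<and> c j' = c i'" by auto
    then obtain i j where ij: "i < j" "c i = c j" by blast
    hence "z ^ i - z ^ j \<in> J" by (simp only: c_def coset_eq_iff[OF J])
    also have "z ^ i - z ^ j = z ^ i * (1 - z ^ (j - i))"
      using ij(1) by (simp add: right_diff_distrib flip: power_add)
    finally have "z ^ i \<in> J"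
      using ij(1) z by (intro unit_mult[of "1 - z ^ (j - i)"]) (auto simp: conv_unit_iff ps_coeff_1 zero_power)
    thus ?thesis by blast
  next
    case True
    have sub: "range c \<subseteq> carrier (quotient_algebra J)" by (auto simp: q c_def)
    have "infinite (range c)" using True by (rule range_inj_infinite)
    hence "V.lin_dep (range c)" using V.li_le_dim(1)[OF fd sub] by blast
    then obtain A a v where A: "finite A" "A \<subseteq> range c" "V.lincomb a A = \<zero>\<^bsub>quotient_algebra J\<^esub>"
      "v \<in> A" "a v \<noteq> 0" unfolding V.lin_dep_def by auto
    define F where "F = c -` A"
    have F: "finite F" "A = c ` F"
      using A(1,2) True by (auto simp: F_def intro: finite_vimageI)
    have fin: "finsum (quotient_algebra J) (\<lambda>i. J +>\<^bsub>ps_ring\<^esub> g i) E = J +>\<^bsub>ps_ring\<^esub> sum g E"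
      if "finite E" for g :: "nat \<Rightarrow> conv_ps2" and E
      using that
    proof induction
      case (insert x E)
      thus ?case by (subst V.finsum_insert) (auto simp: q)
    qed (simp add: q)
    define b where "b = (\<lambda>i. a (c i))"
    have "V.lincomb a A = finsum (quotient_algebra J) (\<lambda>i. b i \<odot>\<^bsub>quotient_algebra J\<^esub> c i) F"
      unfolding V.lincomb_def F(2) b_def
      by (rule V.finsum_reindex) (use True in \<open>auto simp: q c_def inj_def inj_on_def\<close>)
    also have "\<dots> = J +>\<^bsub>ps_ring\<^esub> (\<Sum>i\<in>F. ps_const (b i) * z ^ i)"
      unfolding c_def q by (rule fin[OF F(1)])
    finally have "J +>\<^bsub>ps_ring\<^esub> (\<Sum>i\<in>F. ps_const (b i) * z ^ i) = J +>\<^bsub>ps_ring\<^esub> 0"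
      using A(3) q by simp
    hence sum: "(\<Sum>i\<in>F. ps_const (b i) * z ^ i) \<in> J" unfolding coset_eq_iff[OF J] by simp
    define k where "k = (LEAST i. i \<in> F \<and> b i \<noteq> 0)"
    have "\<exists>i. i \<in> F \<and> b i \<noteq> 0" using A(4,5) F(2) by (auto simp: b_def)
    hence k: "k \<in> F" "b k \<noteq> 0" unfolding k_def by (metis (mono_tags, lifting) LeastI_ex)+
    have below: "b i = 0" if "i \<in> F" "i < k" for i
      using not_less_Least[of i "\<lambda>i. i \<in> F \<and> b i \<noteq> 0"] that unfolding k_def by blast
    \<comment> \<open>Truncation of \<open>i - k\<close> does no harm, since \<open>b i\<close>
      vanishes for \<open>i < k\<close>. The constant term of \<open>u\<close> is
      \<open>b k\<close>.\<close>
    define u where "u = (\<Sum>i\<in>F. ps_const (b i) * z ^ (i - k))"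
    have const_0: "ps_const 0 = 0" by (rule conv_ps2_eqI) (simp add: ps_coeff_const)
    have "ps_const (b i) * z ^ i = z ^ k * (ps_const (b i) * z ^ (i - k))" if "i \<in> F" for i
    proof (cases "i < k")
      case True thus ?thesis using below[OF that] by (simp add: const_0)
    next
      case False
      hence "z ^ i = z ^ k * z ^ (i - k)" by (simp flip: power_add)
      thus ?thesis by (simp add: mult.left_commute)
    qed
    hence "(\<Sum>i\<in>F. ps_const (b i) * z ^ i) = z ^ k * u"
      unfolding u_def sum_distrib_left by (rule sum.cong[OF refl])
    with sum have "z ^ k * u \<in> J" by simp
    moreover have "ps_coeff u 0 0 = (\<Sum>i\<in>F. if i = k then b k else 0)"
      unfolding u_def ps_coeff_sum
    proof (rule sum.cong[OF refl])
      fix i assume "i \<in> F"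
      show "ps_coeff (ps_const (b i) * z ^ (i - k)) 0 0 = (if i = k then b k else 0)"
        using below[OF \<open>i \<in> F\<close>] by (cases i k rule: linorder_cases) (auto simp: ps_coeff_const z ps_coeff_1)
    qed
    hence "u dvd 1" using k F(1) by (simp add: conv_unit_iff)
    ultimately show ?thesis using unit_mult by blast
  qed
qed

section \<open>Modules over a commutative ring\<close>

lemma module_ideal_module:
  assumes I: "ideal I (class_ring :: 'a::comm_ring_1 ring)"
  shows "Module.module class_ring (ideal_module I)"
proof (rule moduleI[OF class_cring.cring_axioms])
  show "abelian_group (ideal_module I)"
  proof (rule abelian_groupI)
    fix x assume "x \<in> carrier (ideal_module I)"
    thus "\<exists>y\<in>carrier (ideal_module I). y \<oplus>\<^bsub>ideal_module I\<^esub> x = \<zero>\<^bsub>ideal_module I\<^esub>"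
      using ideal_uminus[OF I] by (intro bexI[of _ "- x"]) (auto simp: ideal_module_def)
  qed (auto simp: ideal_module_def add_ac intro: ideal_add[OF I] ideal_0[OF I])
qed (auto simp: ideal_module_def class_ring_simps algebra_simps intro: ideal_mult[OF I])

text \<open>Bases are sets, in which a repeated vector counts once; for distinct vectors the
  coefficient function amounts to a pair \<open>s\<close>, \<open>t\<close>.\<close>

lemma module_basis_pair:
  fixes M :: "('a::comm_ring_1, 'b) module"
  assumes M: "Module.module class_ring M" and xy: "x \<in> carrier M" "y \<in> carrier M" "x \<noteq> y"
  shows "module_basis M {x, y} \<longleftrightarrow>
    (\<forall>z\<in>carrier M. \<exists>s t. z = s \<odot>\<^bsub>M\<^esub> x \<oplus>\<^bsub>M\<^esub> t \<odot>\<^bsub>M\<^esub> y) \<and>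
    (\<forall>s t. s \<odot>\<^bsub>M\<^esub> x \<oplus>\<^bsub>M\<^esub> t \<odot>\<^bsub>M\<^esub> y = \<zero>\<^bsub>M\<^esub> \<longrightarrow> s = 0 \<and> t = 0)"
proof -
  interpret M: Module.module "class_ring :: 'a ring" M by (rule M)
  have closed: "s \<odot>\<^bsub>M\<^esub> x \<oplus>\<^bsub>M\<^esub> t \<odot>\<^bsub>M\<^esub> y \<in> carrier M" for s t
    using xy by (intro M.add.m_closed M.smult_closed) auto
  have comb: "M.lincomb a {x, y} = a x \<odot>\<^bsub>M\<^esub> x \<oplus>\<^bsub>M\<^esub> a y \<odot>\<^bsub>M\<^esub> y" for a
    unfolding M.lincomb_def using xy by (simp add: M.finsum_insert)
  have comb': "M.lincomb (\<lambda>z. if z = x then s else t) {x, y} = s \<odot>\<^bsub>M\<^esub> x \<oplus>\<^bsub>M\<^esub> t \<odot>\<^bsub>M\<^esub> y" for s t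
    unfolding comb using xy by simp
  have span: "M.span {x, y} = {s \<odot>\<^bsub>M\<^esub> x \<oplus>\<^bsub>M\<^esub> t \<odot>\<^bsub>M\<^esub> y | s t. True}"
  proof -
    have "M.span {x, y} = {M.lincomb a {x, y} | a. True}"
      by (subst M.finite_span) (use xy in auto)
    also have "\<dots> = {s \<odot>\<^bsub>M\<^esub> x \<oplus>\<^bsub>M\<^esub> t \<odot>\<^bsub>M\<^esub> y | s t. True}"
    proof (intro equalityI subsetI)
      fix z assume "z \<in> {M.lincomb a {x, y} | a. True}"
      thus "z \<in> {s \<odot>\<^bsub>M\<^esub> x \<oplus>\<^bsub>M\<^esub> t \<odot>\<^bsub>M\<^esub> y | s t. True}" unfolding comb by blast
    next
      fix z assume "z \<in> {s \<odot>\<^bsub>M\<^esub> x \<oplus>\<^bsub>M\<^esub> t \<odot>\<^bsub>M\<^esub> y | s t. True}"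
      then obtain s t where "z = M.lincomb (\<lambda>z. if z = x then s else t) {x, y}" unfolding comb' by blast
      thus "z \<in> {M.lincomb a {x, y} | a. True}" by blast
    qed
    finally show ?thesis .
  qed
  have dep: "M.lin_dep {x, y} \<longleftrightarrow> (\<exists>s t. s \<odot>\<^bsub>M\<^esub> x \<oplus>\<^bsub>M\<^esub> t \<odot>\<^bsub>M\<^esub> y = \<zero>\<^bsub>M\<^esub> \<and> \<not> (s = 0 \<and> t = 0))"
  proof
    assume "M.lin_dep {x, y}"
    then obtain a v where "M.lincomb a {x, y} = \<zero>\<^bsub>M\<^esub>" "v \<in> {x, y}" "a v \<noteq> 0"
      using M.finite_lin_dep[of "{x, y}"] xy by auto
    thus "\<exists>s t. s \<odot>\<^bsub>M\<^esub> x \<oplus>\<^bsub>M\<^esub> t \<odot>\<^bsub>M\<^esub> y = \<zero>\<^bsub>M\<^esub> \<and> \<not> (s = 0 \<and> t = 0)" unfolding comb by auto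
  next
    assume "\<exists>s t. s \<odot>\<^bsub>M\<^esub> x \<oplus>\<^bsub>M\<^esub> t \<odot>\<^bsub>M\<^esub> y = \<zero>\<^bsub>M\<^esub> \<and> \<not> (s = 0 \<and> t = 0)"
    then obtain s t where st: "M.lincomb (\<lambda>z. if z = x then s else t) {x, y} = \<zero>\<^bsub>M\<^esub>" "s \<noteq> 0 \<or> t \<noteq> 0"
      unfolding comb' by blast
    show "M.lin_dep {x, y}"
      by (rule M.lin_dep_crit[OF _ subset_refl _ _ _ st(1), of "if s \<noteq> 0 then x else y"])
         (use st(2) xy in auto)
  qed
  show ?thesis unfolding module_basis_def dep span using xy closed by blast
qed

lemma det_mat_2:
  "det (mat 2 2 (\<lambda>(i, j). g i j)) = g 0 0 * g 1 1 - g 0 1 * (g 1 0 :: 'a::comm_ring_1)"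
proof -
  have 1: "det (mat (Suc 0) (Suc 0) (\<lambda>(i, j). h i j)) = h 0 0" for h :: "nat \<Rightarrow> nat \<Rightarrow> 'a"
    by (subst det_laplace_mat[of 0]) simp_all
  show ?thesis
    unfolding numeral_2_eq_2 by (subst det_laplace_mat[of 0]) (simp_all add: 1 insert_index_def)
qed

lemma module_hom_vecI:
  fixes \<pi> :: "'a::comm_ring_1 vec \<Rightarrow> 'b"
  assumes "\<And>u. u \<in> carrier_vec n \<Longrightarrow> \<pi> u \<in> carrier N"
    and "\<And>u v. u \<in> carrier_vec n \<Longrightarrow> v \<in> carrier_vec n \<Longrightarrow> \<pi> (u + v) = \<pi> u \<oplus>\<^bsub>N\<^esub> \<pi> v"
    and "\<And>c u. u \<in> carrier_vec n \<Longrightarrow> \<pi> (c \<cdot>\<^sub>v u) = c \<odot>\<^bsub>N\<^esub> \<pi> u"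
  shows "\<pi> \<in> LinearCombinations.module_hom class_ring (module_vec TYPE('a) n) N"
  using assms unfolding LinearCombinations.module_hom_def module_vec_simps by blast

section \<open>Vectors of length three and the module of syzygies\<close>

lemma vec3_eq: "w \<in> carrier_vec 3 \<Longrightarrow> w = vec_of_list [w $ 0, w $ 1, w $ 2]"
  by (rule eq_vecI) (auto simp: vec_of_list_index nth_Cons numeral_3_eq_3 less_Suc_eq numeral_2_eq_2
      simp del: vec_of_list_Cons)

lemma vec3_lincomb:
  fixes s t :: "'a::comm_ring_1"
  assumes dim: "v \<in> carrier_vec 3" "w \<in> carrier_vec 3"
  shows "s \<cdot>\<^sub>v v + t \<cdot>\<^sub>v w =
    vec_of_list [s * v $ 0 + t * w $ 0, s * v $ 1 + t * w $ 1, s * v $ 2 + t * w $ 2]"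
proof -
  let ?u = "s \<cdot>\<^sub>v v + t \<cdot>\<^sub>v w"
  have "?u \<in> carrier_vec 3" using dim by simp
  hence "?u = vec_of_list [?u $ 0, ?u $ 1, ?u $ 2]" by (rule vec3_eq)
  also have "?u $ 0 = s * v $ 0 + t * w $ 0" using dim by simp
  also have "?u $ 1 = s * v $ 1 + t * w $ 1" using dim by simp
  also have "?u $ 2 = s * v $ 2 + t * w $ 2" using dim by simp
  finally show ?thesis .
qed

lemma syz_iff: "w \<in> syz f \<longleftrightarrow>
  w \<in> carrier_vec 3 \<and> w $ 0 * deriv_x f + w $ 1 * deriv_y f + w $ 2 * f = 0"
proof
  assume "w \<in> syz f"
  then obtain a b c where w: "w = vec_of_list [a, b, c]" "a * deriv_x f + b * deriv_y f + c * f = 0"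
    unfolding syz_def by (elim CollectE exE conjE)
  have "w $ 0 = a" "w $ 1 = b" "w $ 2 = c" "dim_vec w = 3"
    unfolding w(1) vec_of_list_index by (simp_all del: vec_of_list_Cons)
  thus "w \<in> carrier_vec 3 \<and> w $ 0 * deriv_x f + w $ 1 * deriv_y f + w $ 2 * f = 0"
    using w(2) by (simp only: carrier_vec_def mem_Collect_eq simp_thms)
next
  assume w: "w \<in> carrier_vec 3 \<and> w $ 0 * deriv_x f + w $ 1 * deriv_y f + w $ 2 * f = 0"
  hence eq: "w = vec_of_list [w $ 0, w $ 1, w $ 2]" by (intro vec3_eq) (rule conjunct1)
  show "w \<in> syz f" unfolding syz_def
    by (rule CollectI, intro exI conjI, rule eq) (rule w[THEN conjunct2])
qed

lemma syz_module_simps: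
  "carrier (syz_module f) = syz f" "\<zero>\<^bsub>syz_module f\<^esub> = 0\<^sub>v 3"
  "v \<oplus>\<^bsub>syz_module f\<^esub> w = v + w" "c \<odot>\<^bsub>syz_module f\<^esub> w = c \<cdot>\<^sub>v w"
  by (simp_all add: syz_module_def module_vec_def)

lemma syz_add:
  assumes "v \<in> syz f" "w \<in> syz f" shows "v + w \<in> syz f"
proof -
  have dim: "v \<in> carrier_vec 3" "w \<in> carrier_vec 3"
    and v: "v $ 0 * deriv_x f + v $ 1 * deriv_y f + v $ 2 * f = 0"
    and w: "w $ 0 * deriv_x f + w $ 1 * deriv_y f + w $ 2 * f = 0"
    using assms by (simp_all add: syz_iff)
  have "(v $ 0 + w $ 0) * deriv_x f + (v $ 1 + w $ 1) * deriv_y f + (v $ 2 + w $ 2) * f =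
      (v $ 0 * deriv_x f + v $ 1 * deriv_y f + v $ 2 * f) + (w $ 0 * deriv_x f + w $ 1 * deriv_y f + w $ 2 * f)"
    by (simp only: distrib_right add_ac)
  also have "\<dots> = 0" by (simp only: v w add_0_left)
  finally show ?thesis using dim by (simp add: syz_iff)
qed

lemma syz_smult:
  assumes "w \<in> syz f" shows "d \<cdot>\<^sub>v w \<in> syz f"
proof -
  have dim: "w \<in> carrier_vec 3" and w: "w $ 0 * deriv_x f + w $ 1 * deriv_y f + w $ 2 * f = 0"
    using assms by (simp_all add: syz_iff)
  have "(d * w $ 0) * deriv_x f + (d * w $ 1) * deriv_y f + (d * w $ 2) * f =
      d * (w $ 0 * deriv_x f + w $ 1 * deriv_y f + w $ 2 * f)"
    by (simp only: distrib_left mult.assoc)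
  also have "\<dots> = 0" by (simp only: w mult_zero_right)
  finally show ?thesis using dim by (simp add: syz_iff)
qed

lemma module_syz_module: "Module.module ps_ring (syz_module f)"
proof (rule moduleI[OF class_cring.cring_axioms], unfold syz_module_simps class_ring_simps)
  have dim: "w \<in> carrier_vec 3" if "w \<in> syz f" for w using that by (simp add: syz_iff)
  show "abelian_group (syz_module f)"
  proof (rule abelian_groupI, unfold syz_module_simps)
    fix u v w assume *: "u \<in> syz f" "v \<in> syz f" "w \<in> syz f"
    show "u + v \<in> syz f" by (rule syz_add[OF *(1,2)])
    show "u + v + w = u + (v + w)" by (rule assoc_add_vec[OF *[THEN dim]])
    show "u + v = v + u" by (rule comm_add_vec[OF *(1,2)[THEN dim]])
    show "0\<^sub>v 3 + u = u" by (rule left_zero_vec[OF dim[OF *(1)]])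
  next
    show "0\<^sub>v 3 \<in> syz f" by (simp add: syz_iff)
  next
    fix w assume w: "w \<in> syz f"
    have "(-1) \<cdot>\<^sub>v w + w = 0\<^sub>v 3" using dim[OF w] by (auto intro!: eq_vecI)
    thus "\<exists>v\<in>syz f. v + w = 0\<^sub>v 3" using syz_smult[OF w] by blast
  qed
  fix a b :: conv_ps2 and v w assume *: "v \<in> syz f" "w \<in> syz f"
  show "a \<cdot>\<^sub>v v \<in> syz f" by (rule syz_smult[OF *(1)])
  show "(a + b) \<cdot>\<^sub>v v = a \<cdot>\<^sub>v v + b \<cdot>\<^sub>v v" by (rule add_smult_distrib_vec)
  show "a \<cdot>\<^sub>v (v + w) = a \<cdot>\<^sub>v v + a \<cdot>\<^sub>v w" by (rule smult_add_distrib_vec[OF *[THEN dim]])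
  show "(a * b) \<cdot>\<^sub>v v = a \<cdot>\<^sub>v (b \<cdot>\<^sub>v v)" by (rule smult_smult_assoc[symmetric])
  show "1 \<cdot>\<^sub>v v = v" by simp
qed

lemma syz_basis_pair:
  assumes "\<rho>1 \<noteq> \<rho>2"
  shows "module_basis (syz_module f) {\<rho>1, \<rho>2} \<longleftrightarrow> \<rho>1 \<in> syz f \<and> \<rho>2 \<in> syz f \<and>
    (\<forall>w\<in>syz f. \<exists>s t. w = s \<cdot>\<^sub>v \<rho>1 + t \<cdot>\<^sub>v \<rho>2) \<and>
    (\<forall>s t. s \<cdot>\<^sub>v \<rho>1 + t \<cdot>\<^sub>v \<rho>2 = 0\<^sub>v 3 \<longrightarrow> s = 0 \<and> t = 0)"
proof (cases "\<rho>1 \<in> syz f \<and> \<rho>2 \<in> syz f")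
  case True
  thus ?thesis using module_basis_pair[OF module_syz_module, of \<rho>1 f \<rho>2] assms
    by (simp add: syz_module_simps)
next
  case False
  thus ?thesis by (auto simp: module_basis_def syz_module_simps)
qed

section \<open>Resolution, Fitting ideals and annihilator\<close>

context syz_basis
begin

definition gens :: "nat \<Rightarrow> nat \<Rightarrow> conv_ps2" where
  "gens j i = (if j = 0 then [a1, b1, c1] else [a2, b2, c2]) ! i"

text \<open>Relations are combinations of the two generating syzygies, so a 2-minor of relations is
  a determinant of coefficients times a 2-minor of the generators. The latter are \<open>fx\<close>,
  \<open>fy\<close>, \<open>f\<close> up to a unit and a sign, or zero.\<close>

lemma gen_minors_ideal_2:
  "gen_minors_ideal 2 3 {w. w 0 * fx + w 1 * fy + w 2 * f = 0} = tjurina_ideal f"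
proof -
  let ?K = "{w :: nat \<Rightarrow> conv_ps2. w 0 * fx + w 1 * fy + w 2 * f = 0}"
  obtain t where t: "t dvd 1" "b1 * c2 - c1 * b2 = t * fx" "c1 * a2 - a1 * c2 = t * fy" "a1 * b2 - b1 * a2 = t * f"
    using minors_eq_unit_mult by blast
  have I: "ideal (tjurina_ideal f) ps_ring" by (simp add: tjurina_ideal_def)
  have "fx \<in> tjurina_ideal f" "fy \<in> tjurina_ideal f" "f \<in> tjurina_ideal f"
    unfolding tjurina_ideal_def by (auto intro: Idl_base)
  hence d: "b1 * c2 - c1 * b2 \<in> tjurina_ideal f" "c1 * a2 - a1 * c2 \<in> tjurina_ideal f"
    "a1 * b2 - b1 * a2 \<in> tjurina_ideal f"
    unfolding t by (auto intro: ideal_mult[OF I])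
  have gens_i: "gens j 0 = (if j = 0 then a1 else a2)" "gens j (Suc 0) = (if j = 0 then b1 else b2)"
    "gens j 2 = (if j = 0 then c1 else c2)" for j
    by (simp_all add: gens_def)
  have minor: "gens 0 i * gens 1 k - gens 1 i * gens 0 k \<in> tjurina_ideal f" if "i < 3" "k < 3" for i k
  proof -
    have "i = 0 \<or> i = 1 \<or> i = 2" "k = 0 \<or> k = 1 \<or> k = 2" using that by auto
    thus ?thesis
      using d d[THEN ideal_uminus[OF I]] ideal_0[OF I] by (elim disjE) (simp_all add: gens_i mult.commute)
  qed
  show ?thesis
  proof
    show "gen_minors_ideal 2 3 ?K \<subseteq> tjurina_ideal f"
    proof (rule gen_minors_ideal_subset[OF I])
      fix r :: "nat \<Rightarrow> nat" and w :: "nat \<Rightarrow> nat \<Rightarrow> conv_ps2"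
      assume r: "\<And>i. i < 2 \<Longrightarrow> r i < 3" and w: "\<And>j. j < 2 \<Longrightarrow> w j \<in> ?K"
      have "\<exists>s t. \<forall>i<3. w j i = s * gens 0 i + t * gens 1 i" if "j < 2" for j
      proof -
        have "w j 0 * fx + w j 1 * fy + w j 2 * f = 0" using w[OF that] by simp
        from generates[OF this] obtain s t where
          "w j 0 = s * a1 + t * a2" "w j 1 = s * b1 + t * b2" "w j 2 = s * c1 + t * c2" by (elim exE conjE)
        hence "w j i = s * gens 0 i + t * gens 1 i" if "i < 3" for i
        proof -
          have "i = 0 \<or> i = 1 \<or> i = 2" using that by auto
          thus ?thesis using \<open>w j 0 = _\<close> \<open>w j 1 = _\<close> \<open>w j 2 = _\<close> by (elim disjE) (simp_all add: gens_i)
        qed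
        thus ?thesis by blast
      qed
      from this[of 0] this[of 1] obtain s t s' t' where
        st: "\<And>i. i < 3 \<Longrightarrow> w 0 i = s * gens 0 i + t * gens 1 i"
        and st': "\<And>i. i < 3 \<Longrightarrow> w 1 i = s' * gens 0 i + t' * gens 1 i" by auto
      have r01: "r 0 < 3" "r 1 < 3" using r by auto
      have "det (mat 2 2 (\<lambda>(i, j). w j (r i))) = w 0 (r 0) * w 1 (r 1) - w 1 (r 0) * w 0 (r 1)"
        by (rule det_mat_2)
      also have "\<dots> = (s * t' - t * s') * (gens 0 (r 0) * gens 1 (r 1) - gens 1 (r 0) * gens 0 (r 1))"
        unfolding st[OF r01(1)] st[OF r01(2)] st'[OF r01(1)] st'[OF r01(2)] by (simp add: algebra_simps)
      also have "\<dots> \<in> tjurina_ideal f" by (rule ideal_mult[OF I minor[OF r01]])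
      finally show "det (mat 2 2 (\<lambda>(i, j). w j (r i))) \<in> tjurina_ideal f" .
    qed
    obtain e where e: "1 = t * e" using t(1) by (rule dvdE)
    have rel: "gens j \<in> ?K" for j using rel1 rel2 by (simp add: gens_i)
    have mem: "gens 0 i * gens 1 k - gens 1 i * gens 0 k \<in> gen_minors_ideal 2 3 ?K" if "i < 3" "k < 3" for i k
    proof -
      have "det (mat 2 2 (\<lambda>(a, b). gens b ((\<lambda>a. if a = 0 then i else k) a))) \<in> gen_minors_ideal 2 3 ?K"
        by (rule gen_minors_idealI) (use that rel in auto)
      thus ?thesis unfolding det_mat_2 by simp
    qed
    have scale: "g \<in> gen_minors_ideal 2 3 ?K" if "t * g \<in> gen_minors_ideal 2 3 ?K" for g
    proof -
      have "e * (t * g) = (t * e) * g" by (simp only: mult_ac)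
      hence "e * (t * g) = g" by (simp only: e[symmetric] mult_1_left)
      thus ?thesis using ideal_mult[OF ideal_gen_minors_ideal that, of e] by (simp only:)
    qed
    have "t * fx \<in> gen_minors_ideal 2 3 ?K" "t * f \<in> gen_minors_ideal 2 3 ?K" "t * fy \<in> gen_minors_ideal 2 3 ?K"
      using mem[of 1 2] mem[of 0 1] mem[of 2 0] t by (simp_all add: gens_i mult.commute)
    from this[THEN scale] show "tjurina_ideal f \<subseteq> gen_minors_ideal 2 3 ?K"
      unfolding tjurina_ideal_def by (intro Idl_subset[OF ideal_gen_minors_ideal]) blast
  qed
qed

end

context isolated_non_qh
begin

lemma syz_basis_of_module_basis:
  assumes "\<rho>1 \<noteq> \<rho>2" "module_basis (syz_module f) {\<rho>1, \<rho>2}"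
  shows "syz_basis f n m \<alpha> \<beta> \<gamma> \<delta> (\<rho>1 $ 0) (\<rho>1 $ 1) (\<rho>1 $ 2) (\<rho>2 $ 0) (\<rho>2 $ 1) (\<rho>2 $ 2)"
proof unfold_locales
  have b: "\<rho>1 \<in> syz f" "\<rho>2 \<in> syz f" "\<And>w. w \<in> syz f \<Longrightarrow> \<exists>s t. w = s \<cdot>\<^sub>v \<rho>1 + t \<cdot>\<^sub>v \<rho>2"
    using assms(2) unfolding syz_basis_pair[OF assms(1)] by blast+
  show "\<rho>1 $ 0 * fx + \<rho>1 $ 1 * fy + \<rho>1 $ 2 * f = 0" "\<rho>2 $ 0 * fx + \<rho>2 $ 1 * fy + \<rho>2 $ 2 * f = 0"
    using b(1,2) by (simp_all add: syz_iff)
  fix a b' c assume "a * fx + b' * fy + c * f = 0"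
  hence "vec_of_list [a, b', c] \<in> syz f" unfolding syz_def by blast
  from b(3)[OF this] obtain s t where st: "vec_of_list [a, b', c] = s \<cdot>\<^sub>v \<rho>1 + t \<cdot>\<^sub>v \<rho>2" by blast
  have dim: "dim_vec \<rho>1 = 3" "dim_vec \<rho>2 = 3" using b(1,2) by (simp_all add: syz_iff)
  have abc: "vec_of_list [a, b', c] $ 0 = a" "vec_of_list [a, b', c] $ 1 = b'" "vec_of_list [a, b', c] $ 2 = c"
    unfolding vec_of_list_index by simp_all
  have "a = s * \<rho>1 $ 0 + t * \<rho>2 $ 0" "b' = s * \<rho>1 $ 1 + t * \<rho>2 $ 1" "c = s * \<rho>1 $ 2 + t * \<rho>2 $ 2"
    using abc unfolding st by (simp_all add: dim)
  thus "\<exists>s t. a = s * \<rho>1 $ 0 + t * \<rho>2 $ 0 \<and> b' = s * \<rho>1 $ 1 + t * \<rho>2 $ 1 \<and> c = s * \<rho>1 $ 2 + t * \<rho>2 $ 2"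
    by blast
qed

lemma exists_syz_basis: "\<exists>\<rho>1 \<rho>2. \<rho>1 \<noteq> \<rho>2 \<and> module_basis (syz_module f) {\<rho>1, \<rho>2}"
proof -
  obtain r1 r2 where r: "r1 \<in> syz3 fx fy f" "r2 \<in> syz3 fx fy f"
    "\<forall>v\<in>syz3 fx fy f. \<exists>s t. v = scale3 s r1 + scale3 t r2"
    "\<forall>s t. scale3 s r1 + scale3 t r2 = 0 \<longrightarrow> s = 0 \<and> t = 0"
    using syz3_basis[OF X_power Y_power, of f] by (elim exE conjE)
  obtain a1 b1 c1 where r1: "r1 = (a1, b1, c1)" by (rule prod_cases3)
  obtain a2 b2 c2 where r2: "r2 = (a2, b2, c2)" by (rule prod_cases3)
  note r12 = r1 r2
  define \<rho>1 where "\<rho>1 = vec_of_list [a1, b1, c1]"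
  define \<rho>2 where "\<rho>2 = vec_of_list [a2, b2, c2]"
  have dim: "\<rho>1 \<in> carrier_vec 3" "\<rho>2 \<in> carrier_vec 3"
    unfolding \<rho>1_def \<rho>2_def by (rule carrier_vecI, simp)+
  have nth: "\<rho>1 $ 0 = a1" "\<rho>1 $ 1 = b1" "\<rho>1 $ 2 = c1" "\<rho>2 $ 0 = a2" "\<rho>2 $ 1 = b2" "\<rho>2 $ 2 = c2"
    unfolding \<rho>1_def \<rho>2_def vec_of_list_index by simp_all
  have comb: "s \<cdot>\<^sub>v \<rho>1 + t \<cdot>\<^sub>v \<rho>2 = vec_of_list [s * a1 + t * a2, s * b1 + t * b2, s * c1 + t * c2]" for s t
    by (simp only: vec3_lincomb[OF dim] nth)
  have indep: "s = 0 \<and> t = 0" if "s \<cdot>\<^sub>v \<rho>1 + t \<cdot>\<^sub>v \<rho>2 = 0\<^sub>v 3" for s t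
  proof -
    have "vec_of_list [s * a1 + t * a2, s * b1 + t * b2, s * c1 + t * c2] $ i = 0" if "i < 3" for i
      unfolding comb[symmetric] \<open>s \<cdot>\<^sub>v \<rho>1 + t \<cdot>\<^sub>v \<rho>2 = 0\<^sub>v 3\<close> using that by simp
    from this[of 0] this[of 1] this[of 2] have "scale3 s r1 + scale3 t r2 = 0"
      unfolding vec_of_list_index r12 by (simp add: zero_prod_def)
    thus ?thesis using r(4) by blast
  qed
  have "\<rho>1 \<noteq> \<rho>2"
  proof
    assume "\<rho>1 = \<rho>2"
    hence "1 \<cdot>\<^sub>v \<rho>1 + (-1) \<cdot>\<^sub>v \<rho>2 = 0\<^sub>v 3" using dim by (auto intro!: eq_vecI)
    from indep[OF this] show False by simp
  qed
  moreover have "module_basis (syz_module f) {\<rho>1, \<rho>2}"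
    unfolding syz_basis_pair[OF \<open>\<rho>1 \<noteq> \<rho>2\<close>]
  proof (intro conjI ballI allI impI)
    show "\<rho>1 \<in> syz f" "\<rho>2 \<in> syz f"
      using r(1,2) unfolding r12 syz3_iff syz_iff nth by (simp_all add: dim)
    fix w assume w: "w \<in> syz f"
    hence "(w $ 0, w $ 1, w $ 2) \<in> syz3 fx fy f" by (simp add: syz_iff syz3_iff)
    with r(3) obtain s t where "(w $ 0, w $ 1, w $ 2) = scale3 s r1 + scale3 t r2" by blast
    hence "w $ 0 = s * a1 + t * a2" "w $ 1 = s * b1 + t * b2" "w $ 2 = s * c1 + t * c2"
      by (simp_all add: r12)
    moreover have "w = vec_of_list [w $ 0, w $ 1, w $ 2]" using w by (intro vec3_eq) (simp add: syz_iff)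
    ultimately have "w = s \<cdot>\<^sub>v \<rho>1 + t \<cdot>\<^sub>v \<rho>2" unfolding comb by metis
    thus "\<exists>s t. w = s \<cdot>\<^sub>v \<rho>1 + t \<cdot>\<^sub>v \<rho>2" by blast
  qed (use indep in blast)+
  ultimately show ?thesis by blast
qed

abbreviation "eval_map \<equiv> (\<lambda>w. w $ 0 * fx + w $ 1 * fy + w $ 2 * f)"

lemma ideal_tjurina: "ideal (tjurina_ideal f) ps_ring"
  by (simp add: tjurina_ideal_def)

lemma eval_map_hom:
  "eval_map \<in> LinearCombinations.module_hom ps_ring (module_vec TYPE(conv_ps2) 3) (ideal_module (tjurina_ideal f))"
proof -
  have "eval_map w \<in> tjurina_ideal f" for w
    unfolding tjurina_ideal_def Idl_triple by blast
  moreover have "eval_map (v + w) = eval_map v + eval_map w" if "v \<in> carrier_vec 3" "w \<in> carrier_vec 3" for v w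
    using that by (simp add: algebra_simps)
  moreover have "eval_map (c \<cdot>\<^sub>v w) = c * eval_map w" if "w \<in> carrier_vec 3" for c w
    using that by (simp add: algebra_simps)
  ultimately show ?thesis
    by (intro module_hom_vecI) (simp_all only: ideal_module_def module.simps ring.simps partial_object.simps monoid.simps)
qed

lemma eval_map_image: "eval_map ` carrier_vec 3 = tjurina_ideal f"
proof (intro equalityI subsetI)
  fix g assume "g \<in> tjurina_ideal f"
  then obtain a b c where g: "g = a * fx + b * fy + c * f"
    unfolding tjurina_ideal_def Idl_triple by blast
  define w where "w = vec_of_list [a, b, c]"
  have "w $ 0 = a" "w $ 1 = b" "w $ 2 = c" unfolding w_def vec_of_list_index by simp_all
  moreover have "w \<in> carrier_vec 3" unfolding w_def by (rule carrier_vecI) simp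
  ultimately show "g \<in> eval_map ` carrier_vec 3" unfolding g by (intro image_eqI[of _ _ w]) simp_all
next
  fix g assume "g \<in> eval_map ` carrier_vec 3"
  thus "g \<in> tjurina_ideal f" unfolding tjurina_ideal_def Idl_triple by blast
qed

lemma presentation_of_basis:
  assumes ne: "\<rho>1 \<noteq> \<rho>2" and basis: "module_basis (syz_module f) {\<rho>1, \<rho>2}"
  defines "u \<equiv> (\<lambda>w. w $ 0 \<cdot>\<^sub>v \<rho>1 + w $ 1 \<cdot>\<^sub>v \<rho>2)"
  shows "minimal_free_resolution 2 3 (ideal_module (tjurina_ideal f)) u eval_map"
    and "finite_free_presentation (ideal_module (tjurina_ideal f)) 3 2 (morphism_matrix 3 2 u) eval_map"
    and "minors_ideal 2 (morphism_matrix 3 2 u) = tjurina_ideal f"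
proof -
  let ?I = "tjurina_ideal f"
  have b: "\<rho>1 \<in> syz f" "\<rho>2 \<in> syz f" "\<And>w. w \<in> syz f \<Longrightarrow> \<exists>s t. w = s \<cdot>\<^sub>v \<rho>1 + t \<cdot>\<^sub>v \<rho>2"
    "\<And>s t. s \<cdot>\<^sub>v \<rho>1 + t \<cdot>\<^sub>v \<rho>2 = 0\<^sub>v 3 \<Longrightarrow> s = 0 \<and> t = 0"
    using basis unfolding syz_basis_pair[OF ne] by blast+
  interpret B: syz_basis f n m \<alpha> \<beta> \<gamma> \<delta> "\<rho>1 $ 0" "\<rho>1 $ 1" "\<rho>1 $ 2" "\<rho>2 $ 0" "\<rho>2 $ 1" "\<rho>2 $ 2"
    by (rule syz_basis_of_module_basis[OF ne basis])
  have dim: "\<rho>1 \<in> carrier_vec 3" "\<rho>2 \<in> carrier_vec 3" using b(1,2) by (simp_all add: syz_iff)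
  have u_syz: "u z \<in> syz f" for z
    unfolding u_def by (intro syz_add syz_smult b(1,2))
  have u_dim: "u z \<in> carrier_vec 3" for z using u_syz by (simp add: syz_iff)
  have kernel: "{w \<in> carrier_vec 3. eval_map w = \<zero>\<^bsub>ideal_module ?I\<^esub>} = syz f"
    by (auto simp: syz_iff ideal_module_def)
  have u_image: "u ` carrier_vec 2 = syz f"
  proof (intro equalityI subsetI)
    fix w assume "w \<in> syz f"
    then obtain s t where w: "w = s \<cdot>\<^sub>v \<rho>1 + t \<cdot>\<^sub>v \<rho>2" using b(3) by blast
    have "u (vec 2 (\<lambda>i. if i = 0 then s else t)) = w" by (simp add: u_def w)
    moreover have "vec 2 (\<lambda>i. if i = 0 then s else t) \<in> carrier_vec 2" by simp
    ultimately show "w \<in> u ` carrier_vec 2" by blast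
  qed (use u_syz in blast)
  have u_hom: "u \<in> LinearCombinations.module_hom ps_ring (module_vec TYPE(conv_ps2) 2) (module_vec TYPE(conv_ps2) 3)"
  proof -
    have "u (v + w) = u v + u w" if "v \<in> carrier_vec 2" "w \<in> carrier_vec 2" for v w
      unfolding u_def using that dim by (intro eq_vecI) (auto simp: algebra_simps)
    moreover have "u (c \<cdot>\<^sub>v w) = c \<cdot>\<^sub>v u w" if "w \<in> carrier_vec 2" for c w
      unfolding u_def using that dim by (intro eq_vecI) (auto simp: algebra_simps)
    ultimately show ?thesis
      unfolding LinearCombinations.module_hom_def by (simp add: module_vec_simps u_dim)
  qed
  have "inj_on u (carrier_vec 2)"
  proof (rule inj_onI)
    fix v w assume vw: "v \<in> carrier_vec 2" "w \<in> carrier_vec 2" and eq: "u v = u w"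
    have "(v $ 0 - w $ 0) \<cdot>\<^sub>v \<rho>1 + (v $ 1 - w $ 1) \<cdot>\<^sub>v \<rho>2 = u v - u w"
      unfolding u_def using dim by (intro eq_vecI) (auto simp: algebra_simps)
    also have "\<dots> = 0\<^sub>v 3" unfolding eq using u_dim[of w] by simp
    finally have "v $ 0 = w $ 0" "v $ 1 = w $ 1" using b(4) by fastforce+
    thus "v = w" using vw by (intro eq_vecI) (auto simp: less_2_cases_iff)
  qed
  moreover have "u ` carrier_vec 2 \<subseteq> {w \<in> carrier_vec 3. \<forall>i<3. w $ i \<in> ps_max_ideal}"
  proof
    fix w assume "w \<in> u ` carrier_vec 2"
    hence w: "w \<in> carrier_vec 3" "w $ 0 * fx + w $ 1 * fy + w $ 2 * f = 0"
      unfolding u_image by (simp_all add: syz_iff)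
    have "w $ i \<in> ps_max_ideal" if "i < 3" for i
    proof -
      have "i = 0 \<or> i = 1 \<or> i = 2" using that by auto
      hence "ps_coeff (w $ i) 0 0 = 0" using syz_entries_max_ideal[OF w(2)] by (elim disjE) simp_all
      thus ?thesis unfolding ps_max_ideal_def Idl_pair max_ideal_iff by blast
    qed
    with w(1) show "w \<in> {w \<in> carrier_vec 3. \<forall>i<3. w $ i \<in> ps_max_ideal}" by blast
  qed
  ultimately show "minimal_free_resolution 2 3 (ideal_module ?I) u eval_map"
    unfolding minimal_free_resolution_def
    using module_ideal_module[OF ideal_tjurina] u_hom eval_map_hom u_image kernel eval_map_image
    by (simp add: ideal_module_def)
  have U: "morphism_matrix 3 2 u *\<^sub>v z = u z" if "z \<in> carrier_vec 2" for z
    using that dim by (intro eq_vecI)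
      (auto simp: morphism_matrix_def u_def scalar_prod_def numeral_2_eq_2 unit_vec_def mult.commute)
  have "(\<lambda>z. morphism_matrix 3 2 u *\<^sub>v z) ` carrier_vec 2 = syz f"
    using U u_image by (simp cong: image_cong)
  thus pres: "finite_free_presentation (ideal_module ?I) 3 2 (morphism_matrix 3 2 u) eval_map"
    unfolding finite_free_presentation_def using eval_map_hom kernel eval_map_image
    by (simp add: ideal_module_def morphism_matrix_def)
  \<comment> \<open>The relations of this presentation are the syzygies, so the 2-minors are
    computed from the kernel and not from the entries of the matrix.\<close>
  have "relations (ideal_module ?I) 3 eval_map = {w. w 0 * fx + w 1 * fy + w 2 * f = 0}"
    by (simp add: relations_def ideal_module_def)
  thus "minors_ideal 2 (morphism_matrix 3 2 u) = ?I"
    unfolding minors_ideal_presentation[OF pres] using B.gen_minors_ideal_2 by simp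
qed

lemma annihilator_eq: "annihilator f = {g. \<exists>u v. g * f = u * fx + v * fy}"
proof -
  have J: "ideal (jacobian_ideal f) ps_ring" by (simp add: jacobian_ideal_def)
  have "annihilator f = {g. g * f \<in> jacobian_ideal f}"
    unfolding annihilator_def milnor_algebra_def quotient_algebra_simps(2)[OF J] coset_eq_iff[OF J] by simp
  thus ?thesis unfolding jacobian_ideal_def Idl_pair by auto
qed

end

section \<open>The annihilator of \<open>f\<close> in the Milnor algebra\<close>

context syz_basis
begin

lemma annihilator_ann: "annihilator f = ann"
  unfolding annihilator_eq ann_def ..

lemma annihilator_Idl: "annihilator f = Idl\<^bsub>class_ring\<^esub> {c1, c2}"
  unfolding annihilator_ann ann_eq Idl_pair ..

lemma minimally_generated_annihilator: "minimally_generated_by (annihilator f) 2"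
  unfolding minimally_generated_by_def
proof (intro conjI allI impI)
  show "\<exists>S. finite S \<and> card S = 2 \<and> Idl\<^bsub>class_ring\<^esub> S = annihilator f"
    using c1_regular(2) by (intro exI[of _ "{c1, c2}"]) (simp add: annihilator_Idl)
  fix S assume S: "finite S \<and> Idl\<^bsub>class_ring\<^esub> S = annihilator f"
  show "2 \<le> card S"
  proof (rule ccontr)
    assume "\<not> 2 \<le> card S"
    hence "card S = 0 \<or> card S = 1" by auto
    hence "\<exists>c. Idl\<^bsub>class_ring\<^esub> S = {s * c | s. True}"
    proof
      assume "card S = 0"
      hence "S = {}" using S by simp
      thus ?thesis by (intro exI[of _ 0]) (auto simp: Idl_empty)
    next
      assume "card S = 1"
      then obtain c where "S = {c}" by (rule card_1_singletonE)
      thus ?thesis using Idl_singleton by blast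
    qed
    thus False using S ann_not_principal unfolding annihilator_ann by auto
  qed
qed

lemma complete_intersection_annihilator: "complete_intersection (annihilator f)"
  unfolding complete_intersection_def
proof (intro exI conjI)
  show "annihilator f = Idl\<^bsub>class_ring\<^esub> (set [c1, c2])" by (simp add: annihilator_Idl)
  have "1 \<notin> Idl\<^bsub>class_ring\<^esub> {c1, c2}"
    unfolding annihilator_Idl[symmetric] annihilator_ann using ann_00[of 1] by (auto simp: ps_coeff_1)
  moreover have "[c1, c2] ! i * g \<in> Idl\<^bsub>class_ring\<^esub> (set (take i [c1, c2])) \<longrightarrow>
      g \<in> Idl\<^bsub>class_ring\<^esub> (set (take i [c1, c2]))" if "i < 2" for i g
  proof -
    consider "i = 0" | "i = 1" using \<open>i < 2\<close> by linarith
    thus ?thesis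
    proof cases
      case 1
      thus ?thesis using c1_regular(1) by (simp add: Idl_empty)
    next
      case 2
      have "g \<in> {s * c1 | s. True}" if "c2 * g \<in> {s * c1 | s. True}"
        using that c1_regular(3)[of g] by blast
      thus ?thesis using 2 by (simp add: Idl_singleton)
    qed
  qed
  ultimately show "regular_sequence [c1, c2]" unfolding regular_sequence_def by auto
qed

text \<open>The image of the maximal ideal is the only prime of the quotient: powers of
  \<open>x\<close> and \<open>y\<close> are zero there, so every prime contains the classes of
  \<open>x\<close> and \<open>y\<close>, and a series with nonzero constant term is a unit.\<close>

lemma zero_dimensional_annihilator: "zero_dimensional (annihilator f)"
proof -
  let ?A = "annihilator f" and ?m = "{g. ps_coeff g 0 0 = 0}"
  interpret A: ideal ?A ps_ring by (simp add: annihilator_Idl)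
  interpret Q: cring "ps_ring Quot ?A" by (rule A.quotient_is_cring[OF class_cring.cring_axioms])
  have car: "carrier (ps_ring Quot ?A) = range (\<lambda>x. ?A +>\<^bsub>ps_ring\<^esub> x)"
    by (auto simp: FactRing_def A_RCOSETS_def')
  define \<pi> where "\<pi> = (\<lambda>x. ?A +>\<^bsub>ps_ring\<^esub> x)"
  have carE: "\<exists>x. K = \<pi> x" if "K \<in> carrier (ps_ring Quot ?A)" for K
    using that unfolding car \<pi>_def by blast
  have closed: "\<pi> x \<in> carrier (ps_ring Quot ?A)" for x unfolding car \<pi>_def by blast
  have mult: "\<pi> x \<otimes>\<^bsub>ps_ring Quot ?A\<^esub> \<pi> y = \<pi> (x * y)" for x y
    using ring_hom_mult[OF A.rcos_ring_hom, of x y] by (simp add: \<pi>_def)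
  have add: "\<pi> x \<oplus>\<^bsub>ps_ring Quot ?A\<^esub> \<pi> y = \<pi> (x + y)" for x y
    using ring_hom_add[OF A.rcos_ring_hom, of x y] by (simp add: \<pi>_def)
  have one: "\<one>\<^bsub>ps_ring Quot ?A\<^esub> = \<pi> 1"
    using ring_hom_one[OF A.rcos_ring_hom] by (simp add: \<pi>_def)
  have zero: "\<zero>\<^bsub>ps_ring Quot ?A\<^esub> = \<pi> 0" by (simp add: FactRing_def \<pi>_def coset_0)
  have A_sub: "ps_coeff g 0 0 = 0" if "g \<in> ?A" for g
    using that ann_00 unfolding annihilator_ann by blast
  have in_A: "ps_X ^ n \<in> ?A" "ps_Y ^ m \<in> ?A"
    unfolding annihilator_ann X_power Y_power by (rule J_subset_ann)+
  have mem_m: "\<pi> x \<in> \<pi> ` ?m \<longleftrightarrow> ps_coeff x 0 0 = 0" for x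
  proof
    assume "\<pi> x \<in> \<pi> ` ?m"
    then obtain y where y: "ps_coeff y 0 0 = 0" "\<pi> x = \<pi> y" by blast
    hence "x - y \<in> ?A" unfolding \<pi>_def coset_eq_iff[OF A.ideal_axioms] by blast
    from A_sub[OF this] y(1) show "ps_coeff x 0 0 = 0" by simp
  qed blast
  have unit_ideal: "P = carrier (ps_ring Quot ?A)"
    if P: "ideal P (ps_ring Quot ?A)" and x: "\<pi> x \<in> P" "ps_coeff x 0 0 \<noteq> 0" for P x
  proof -
    obtain e where e: "1 = x * e" using conv_unit[OF x(2)] by (rule dvdE)
    have "\<pi> x \<otimes>\<^bsub>ps_ring Quot ?A\<^esub> \<pi> e \<in> P" by (rule ideal.I_r_closed[OF P x(1) closed])
    hence "\<one>\<^bsub>ps_ring Quot ?A\<^esub> \<in> P" unfolding mult e[symmetric] one .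
    thus ?thesis by (rule ideal.one_imp_carrier[OF P])
  qed
  have m: "ideal (\<pi> ` ?m) (ps_ring Quot ?A)"
    unfolding \<pi>_def
    by (rule ring.ring_ideal_imp_quot_ideal[OF class_ring.ring_axioms A.ideal_axioms])
       (auto intro!: ideal_classI)
  have proper: "carrier (ps_ring Quot ?A) \<noteq> \<pi> ` ?m"
    using closed[of 1] mem_m[of 1] by (auto simp: ps_coeff_1)
  have "primeideal (\<pi> ` ?m) (ps_ring Quot ?A)"
  proof (rule primeidealI[OF m Q.cring_axioms proper])
    fix K L assume "K \<in> carrier (ps_ring Quot ?A)" "L \<in> carrier (ps_ring Quot ?A)"
      and KL: "K \<otimes>\<^bsub>ps_ring Quot ?A\<^esub> L \<in> \<pi> ` ?m"
    then obtain x y where xy: "K = \<pi> x" "L = \<pi> y" using carE by blast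
    show "K \<in> \<pi> ` ?m \<or> L \<in> \<pi> ` ?m" using KL unfolding xy mult mem_m by simp
  qed
  moreover have "maximalideal P (ps_ring Quot ?A)" if prime: "primeideal P (ps_ring Quot ?A)" for P
  proof -
    interpret P: primeideal P "ps_ring Quot ?A" by (rule prime)
    have radical: "\<pi> z \<in> P" if "\<pi> (z ^ k) \<in> P" for z k
      using that
    proof (induction k)
      case 0
      hence "P = carrier (ps_ring Quot ?A)" by (intro unit_ideal[OF P.ideal_axioms, of 1]) (auto simp: ps_coeff_1)
      thus ?case using closed by simp
    next
      case (Suc k)
      hence "\<pi> z \<otimes>\<^bsub>ps_ring Quot ?A\<^esub> \<pi> (z ^ k) \<in> P" by (simp add: mult)
      from P.I_prime[OF closed closed this] show ?case using Suc.IH by blast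
    qed
    have in_P: "\<pi> g \<in> P" if "g \<in> ?A" for g
    proof -
      have "\<pi> g = \<pi> 0" unfolding \<pi>_def coset_eq_iff[OF A.ideal_axioms] using that by simp
      thus ?thesis using P.zero_closed unfolding zero by simp
    qed
    have XY: "\<pi> ps_X \<in> P" "\<pi> ps_Y \<in> P" using in_A by (auto intro: radical in_P)
    have m_sub: "\<pi> x \<in> P" if x: "ps_coeff x 0 0 = 0" for x
    proof -
      obtain a b where ab: "x = a * ps_X + b * ps_Y" using x unfolding max_ideal_iff by blast
      have "\<pi> a \<otimes>\<^bsub>ps_ring Quot ?A\<^esub> \<pi> ps_X \<oplus>\<^bsub>ps_ring Quot ?A\<^esub> \<pi> b \<otimes>\<^bsub>ps_ring Quot ?A\<^esub> \<pi> ps_Y \<in> P"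
        by (intro P.a_closed P.I_l_closed XY closed)
      thus ?thesis unfolding mult add ab .
    qed
    show ?thesis
    proof (rule maximalidealI[OF P.ideal_axioms])
      show "carrier (ps_ring Quot ?A) \<noteq> P" by (rule P.I_notcarr)
      fix J assume J: "ideal J (ps_ring Quot ?A)" "P \<subseteq> J" "J \<subseteq> carrier (ps_ring Quot ?A)"
      show "J = P \<or> J = carrier (ps_ring Quot ?A)"
      proof (cases "J \<subseteq> P")
        case True thus ?thesis using J(2) by blast
      next
        case False
        then obtain K where K: "K \<in> J" "K \<notin> P" by blast
        then obtain x where x: "K = \<pi> x" using carE J(3) by blast
        hence "ps_coeff x 0 0 \<noteq> 0" using m_sub K(2) by blast
        thus ?thesis using unit_ideal[OF J(1)] K(1) x by blast
      qed
    qed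
  qed
  ultimately show ?thesis unfolding zero_dimensional_def by blast
qed

end

text \<open>Finite dimension supplies the powers of \<open>x\<close> and \<open>y\<close>; and
  \<open>f\<close> in the Jacobian ideal would make the two ideals in
  \<open>quasi_homogeneous\<close> equal.\<close>

lemma isolated_non_qhI:
  assumes "isolated_singularity f" "\<not> quasi_homogeneous f"
  shows "\<exists>n m \<alpha> \<beta> \<gamma> \<delta>. isolated_non_qh f n m \<alpha> \<beta> \<gamma> \<delta>"
proof -
  have J: "ideal (jacobian_ideal f) ps_ring" by (simp add: jacobian_ideal_def)
  have f00: "ps_coeff f 0 0 = 0" and fd: "fin_dim_complex (quotient_algebra (jacobian_ideal f))"
    using assms(1) by (simp_all add: isolated_singularity_def milnor_algebra_def)
  obtain n m where X: "ps_X ^ n \<in> jacobian_ideal f" and Y: "ps_Y ^ m \<in> jacobian_ideal f"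
    using power_in_ideal_of_fin_dim[OF J fd ps_coeff_X_Y_00(1)]
      power_in_ideal_of_fin_dim[OF J fd ps_coeff_X_Y_00(2)] by blast
  obtain \<alpha> \<beta> where \<alpha>: "ps_X ^ n = \<alpha> * deriv_x f + \<beta> * deriv_y f"
    using X unfolding jacobian_ideal_def Idl_pair by blast
  obtain \<gamma> \<delta> where \<gamma>: "ps_Y ^ m = \<gamma> * deriv_x f + \<delta> * deriv_y f"
    using Y unfolding jacobian_ideal_def Idl_pair by blast
  have "f \<noteq> u * deriv_x f + v * deriv_y f" for u v
  proof
    assume "f = u * deriv_x f + v * deriv_y f"
    hence "f \<in> jacobian_ideal f" unfolding jacobian_ideal_def Idl_pair by blast
    hence "tjurina_ideal f \<subseteq> jacobian_ideal f"
      unfolding tjurina_ideal_def by (intro Idl_subset[OF J]) (auto simp: jacobian_ideal_def intro: Idl_base)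
    moreover have "jacobian_ideal f \<subseteq> tjurina_ideal f"
      unfolding jacobian_ideal_def tjurina_ideal_def by (intro Idl_le) (auto intro: Idl_base)
    ultimately show False using assms(2) by (simp add: quasi_homogeneous_def)
  qed
  from isolated_non_qh.intro[OF f00 \<alpha> \<gamma> this] show ?thesis by (intro exI)
qed

theorem proposition1p1:
  fixes f :: conv_ps2
  assumes "isolated_singularity f"
    and "\<not> quasi_homogeneous f"
  shows
    "free_of_rank (syz_module f) 2 \<and>
     (\<forall>\<rho>1 \<rho>2. \<rho>1 \<noteq> \<rho>2 \<and> module_basis (syz_module f) {\<rho>1, \<rho>2} \<longrightarrow>
        (let u = (\<lambda>w. w $ 0 \<cdot>\<^sub>v \<rho>1 + w $ 1 \<cdot>\<^sub>v \<rho>2);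
             v = (\<lambda>w. w $ 0 * deriv_x f + w $ 1 * deriv_y f + w $ 2 * f);
             U = morphism_matrix 3 2 u
         in minimal_free_resolution 2 3 (ideal_module (tjurina_ideal f)) u v \<and>
            (\<forall>j\<in>{1, 2}. minors_ideal j U = fitting_ideal (3 - j) (ideal_module (tjurina_ideal f))) \<and>
            tjurina_ideal f = minors_ideal 2 U)) \<and>
     tjurina_ideal f = fitting_ideal 1 (ideal_module (tjurina_ideal f)) \<and>
     tjurina_number f =
       dim_complex (quotient_algebra (fitting_ideal 1 (ideal_module (tjurina_ideal f)))) \<and>
     minimally_generated_by (annihilator f) 2 \<and>
     zero_dimensional (annihilator f) \<and>
     complete_intersection (annihilator f)"
proof -
  obtain n m \<alpha> \<beta> \<gamma> \<delta> where "isolated_non_qh f n m \<alpha> \<beta> \<gamma> \<delta>"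
    using isolated_non_qhI[OF assms] by blast
  then interpret isolated_non_qh f n m \<alpha> \<beta> \<gamma> \<delta> .
  let ?N = "ideal_module (tjurina_ideal f)"
  note N = module_ideal_module[OF ideal_tjurina]
  \<comment> \<open>A fixed basis for the claims that mention none: freeness, the first Fitting
    ideal and the annihilator. The claims about the resolution are proved for an arbitrary
    basis.\<close>
  obtain \<sigma>1 \<sigma>2 where \<sigma>: "\<sigma>1 \<noteq> \<sigma>2" "module_basis (syz_module f) {\<sigma>1, \<sigma>2}"
    using exists_syz_basis by blast
  interpret syz_basis f n m \<alpha> \<beta> \<gamma> \<delta> "\<sigma>1 $ 0" "\<sigma>1 $ 1" "\<sigma>1 $ 2" "\<sigma>2 $ 0" "\<sigma>2 $ 1" "\<sigma>2 $ 2"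
    by (rule syz_basis_of_module_basis[OF \<sigma>])
  have free: "free_of_rank (syz_module f) 2"
    unfolding free_of_rank_def
  proof (intro conjI exI)
    show "card {\<sigma>1, \<sigma>2} = 2" using \<sigma>(1) by simp
  qed (simp_all add: module_syz_module \<sigma>(2))
  have fitting: "minors_ideal j (morphism_matrix 3 2 (\<lambda>w. w $ 0 \<cdot>\<^sub>v \<rho>1 + w $ 1 \<cdot>\<^sub>v \<rho>2)) = fitting_ideal (3 - j) ?N"
    if "\<rho>1 \<noteq> \<rho>2" "module_basis (syz_module f) {\<rho>1, \<rho>2}" "j \<in> {1, 2}" for \<rho>1 \<rho>2 j
  proof -
    \<comment> \<open>The presentation has three generators, so \<open>fitting_ideal (3 - j)\<close>
      is formed from minors of size \<open>3 - (3 - j)\<close>.\<close>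
    have "3 - (3 - j) = j" using that(3) by auto
    thus ?thesis
      using fitting_ideal_presentation[OF N presentation_of_basis(2)[OF that(1,2)], of "3 - j"] by (simp only:)
  qed
  have tjurina: "tjurina_ideal f = fitting_ideal 1 ?N"
  proof -
    have "minors_ideal 2 (morphism_matrix 3 2 (\<lambda>w. w $ 0 \<cdot>\<^sub>v \<sigma>1 + w $ 1 \<cdot>\<^sub>v \<sigma>2)) = fitting_ideal 1 ?N"
      using fitting[OF \<sigma>, of 2] by simp
    thus ?thesis unfolding presentation_of_basis(3)[OF \<sigma>] .
  qed
  show ?thesis
    unfolding Let_def tjurina_number_def
  proof (intro conjI allI impI ballI)
    fix \<rho>1 \<rho>2 j assume "\<rho>1 \<noteq> \<rho>2 \<and> module_basis (syz_module f) {\<rho>1, \<rho>2}"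
    hence \<rho>: "\<rho>1 \<noteq> \<rho>2" "module_basis (syz_module f) {\<rho>1, \<rho>2}" by (rule conjunct1, rule conjunct2)
    show "minimal_free_resolution 2 3 ?N (\<lambda>w. w $ 0 \<cdot>\<^sub>v \<rho>1 + w $ 1 \<cdot>\<^sub>v \<rho>2)
        (\<lambda>w. w $ 0 * deriv_x f + w $ 1 * deriv_y f + w $ 2 * f)"
      by (rule presentation_of_basis(1)[OF \<rho>])
    show "tjurina_ideal f = minors_ideal 2 (morphism_matrix 3 2 (\<lambda>w. w $ 0 \<cdot>\<^sub>v \<rho>1 + w $ 1 \<cdot>\<^sub>v \<rho>2))"
      by (rule presentation_of_basis(3)[OF \<rho>, symmetric])
    show "minors_ideal j (morphism_matrix 3 2 (\<lambda>w. w $ 0 \<cdot>\<^sub>v \<rho>1 + w $ 1 \<cdot>\<^sub>v \<rho>2)) = fitting_ideal (3 - j) ?N"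
      if "j \<in> {1, 2}"
      by (rule fitting[OF \<rho> that])
  next
    show "dim_complex (quotient_algebra (tjurina_ideal f)) = dim_complex (quotient_algebra (fitting_ideal 1 ?N))"
      by (simp only: tjurina[symmetric])
  qed (rule free tjurina minimally_generated_annihilator zero_dimensional_annihilator
      complete_intersection_annihilator)+
qed

end
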